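(* Let $J,P\ge1$ be integers, $h=1/(J+1)$, $\tau>0$, $t_n=n\tau$, $\epsilon\ge0$, $\lambda=\pm1$. Consider the spatially semi-discretized equation in $\mathbb{C}^J$ $$d\Psi-\mathbf{i}\left(\frac1{h^2}A\Psi+\mathbf{i}\alpha\Psi+\lambda F(\Psi)\Psi\right)dt=\epsilon\,\sigma\Lambda\,d\beta,\qquad \Psi(0)=(\psi_0(x_1),\dots,\psi_0(x_J))^T,$$ and the fully discrete scheme $$\Psi^{n+1}=\left(I-\frac{\mathbf{i}\tau}{2h^2}A+\frac14\alpha\tau I\right)^{-1}\left(I+\frac{\mathbf{i}\tau}{2h^2}A-\frac14\alpha\tau I\right)e^{f(\Psi^n)}\Psi^n+\left(I-\frac{\mathbf{i}\tau}{2h^2}A+\frac14\alpha\tau I\right)^{-1}\epsilon\,\sigma\Lambda\,\delta_{n+1}\beta,$$ with $\Psi^0=\Psi(0)$ and $f(\Psi^n)=\left(-\frac12\alpha I+\mathbf{i}\lambda F(\Psi^n)\right)\tau$. Assume that $\mathbb{E}\|\psi_0\|_{L^2}^2<\infty$, that $Q$ is a Hilbert–Schmidt operator from $L^2$ to $\dot H^2$, that $\alpha\ge\frac12$, and that $\tau=O(h^4)$. Then for any $T>0$ the scheme converges with order one in probability, i.e. $$\lim_{K\to\infty}\mathbb{P}\left(\sup_{1\le n\le[T/\tau]}\sqrt{h}\,\|\Psi(t_n)-\Psi^n\|\ge K\tau\right)=0 .$$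
   Context: $A\in\mathbb{R}^{J\times J}$ is the tridiagonal matrix with $-2$ on the diagonal and $1$ on the adjacent off-diagonals; $F(v)=\mathrm{diag}\{|v_1|^2,\dots,|v_J|^2\}$ for $v\in\mathbb{C}^J$. $x_j=jh$; $e_k(x)=\sqrt2\sin(k\pi x)$; $\sigma\in\mathbb{R}^{J\times P}$ has entries $\sigma_{jk}=e_k(x_j)$. $Q$ is a linear positive operator on $L^2=L^2(0,1)$ with $Qe_k=\sqrt{\eta_k}\,e_k$, $k\ge1$, and $\Lambda=\mathrm{diag}\{\sqrt{\eta_1},\dots,\sqrt{\eta_P}\}$. $\dot H^2=D(\Delta)$ is the domain of the Dirichlet Laplacian on $(0,1)$ with norm $\|\Delta u\|_{L^2}$; $Q$ being Hilbert–Schmidt from $L^2$ to $\dot H^2$ means $\sum_{k\ge1}(k\pi)^4\eta_k<\infty$. $\beta=(\beta_1,\dots,\beta_P)^T$, $\beta_k=\beta_k^1+\mathbf{i}\beta_k^2$, with $\{\beta_k^i\}$ independent standard real Brownian motions with respect to a filtration $\{\mathcal F_t\}$; $\delta_{n+1}\beta=\beta(t_{n+1})-\beta(t_n)$. $\|\cdot\|$ is the Euclidean norm on $\mathbb{C}^J$; $[T/\tau]$ is the integer part of $T/\tau$. The initial function $\psi_0$ may be random and is $\mathcal F_0$-measurable, with meaningful point values. *)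

theory Defs
  imports "HOL-Probability.Probability"
begin

section \<open>The space $L^2(0,1)$ and the operator $Q$\<close>

definition sine_basis :: "nat \<Rightarrow> real \<Rightarrow> real" where
  "sine_basis k x = sqrt 2 * sin (real k * pi * x)"

definition L2_norm_sq :: "(real \<Rightarrow> complex) \<Rightarrow> ennreal" where
  "L2_norm_sq u = (\<integral>\<^sup>+ x. ennreal ((cmod (u x))\<^sup>2) \<partial>lebesgue_on {0<..<1})"

definition L2 :: "(real \<Rightarrow> complex) set" where
  "L2 = {u \<in> borel_measurable (lebesgue_on {0<..<1}). L2_norm_sq u < \<infinity>}"

definition eq_L2 :: "(real \<Rightarrow> complex) \<Rightarrow> (real \<Rightarrow> complex) \<Rightarrow> bool" where
  "eq_L2 u v \<longleftrightarrow> (AE x in lebesgue_on {0<..<1}. u x = v x)"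

definition inner_L2 :: "(real \<Rightarrow> complex) \<Rightarrow> (real \<Rightarrow> complex) \<Rightarrow> complex" where
  "inner_L2 u v = (LINT x|lebesgue_on {0<..<1}. u x * cnj (v x))"

text \<open>
  Operators on $L^2$ act on representatives, so all their properties are required up to
  equality almost everywhere.  No continuity is demanded: an everywhere defined positive operator
  on a complex Hilbert space is bounded.
\<close>

definition positive_operator_L2 :: "((real \<Rightarrow> complex) \<Rightarrow> real \<Rightarrow> complex) \<Rightarrow> bool" where
  "positive_operator_L2 Q \<longleftrightarrow>
     (\<forall>u\<in>L2. Q u \<in> L2) \<and>
     (\<forall>u\<in>L2. \<forall>v\<in>L2. eq_L2 u v \<longrightarrow> eq_L2 (Q u) (Q v)) \<and>
     (\<forall>u\<in>L2. \<forall>v\<in>L2. eq_L2 (Q (\<lambda>x. u x + v x)) (\<lambda>x. Q u x + Q v x)) \<and>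
     (\<forall>c. \<forall>u\<in>L2. eq_L2 (Q (\<lambda>x. c * u x)) (\<lambda>x. c * Q u x)) \<and>
     (\<forall>u\<in>L2. inner_L2 (Q u) u \<in> \<real>\<^sub>\<ge>\<^sub>0)"

definition has_eigenvalues :: "((real \<Rightarrow> complex) \<Rightarrow> real \<Rightarrow> complex) \<Rightarrow> (nat \<Rightarrow> real) \<Rightarrow> bool" where
  "has_eigenvalues Q \<eta> \<longleftrightarrow>
     (\<forall>k\<ge>1. \<eta> k \<ge> 0 \<and>
        eq_L2 (Q (\<lambda>x. complex_of_real (sine_basis k x)))
              (\<lambda>x. complex_of_real (sqrt (\<eta> k) * sine_basis k x)))"

text \<open>
  For an operator with $Q e_k = \sqrt{\eta_k}\, e_k$ the squared Hilbert--Schmidt norm from $L^2$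
  to $\dot H^2$ is $\sum_k \|\Delta Q e_k\|^2 = \sum_k (k\pi)^4 \eta_k$.  The series is indexed by
  $k+1$ because $k$ starts at $1$.
\<close>

definition hilbert_schmidt_L2_H2 :: "(nat \<Rightarrow> real) \<Rightarrow> bool" where
  "hilbert_schmidt_L2_H2 \<eta> \<longleftrightarrow> summable (\<lambda>k. (real (Suc k) * pi) ^ 4 * \<eta> (Suc k))"

section \<open>Matrices\<close>

text \<open>
  $\mathbb{C}^J$ is \<open>complex^'j\<close> with $J$ the cardinality of \<open>'j\<close>.  The elements of the linearly ordered
  index type are numbered $1, \dots, J$ by \<open>index_of\<close>.
\<close>

definition index_of :: "'a::{finite,linorder} \<Rightarrow> nat" where
  "index_of i = card {j. j \<le> i}"

definition grid :: "real \<Rightarrow> 'j::{finite,linorder} \<Rightarrow> real" where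
  "grid h j = real (index_of j) * h"

definition cscale :: "complex \<Rightarrow> complex^'n^'m \<Rightarrow> complex^'n^'m" (infixr "*\<^sub>C" 75) where
  "c *\<^sub>C M = (\<chi> i j. c * M $ i $ j)"

definition diag_mat :: "('n \<Rightarrow> complex) \<Rightarrow> complex^'n^'n" where
  "diag_mat d = (\<chi> i j. if i = j then d i else 0)"

definition mat_exp :: "complex^'n^'n \<Rightarrow> complex^'n^'n" where
  "mat_exp M = (\<Sum>m. (1 / fact m) *\<^sub>R (((\<lambda>X. M ** X) ^^ m) (mat 1)))"

definition laplace_mat :: "complex^'j::{finite,linorder}^'j::{finite,linorder}" where
  "laplace_mat = (\<chi> i j. if i = j then - 2
               else if index_of i = index_of j + 1 \<or> index_of j = index_of i + 1 then 1 else 0)"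

definition F_mat :: "complex^'j \<Rightarrow> complex^'j^'j" where
  "F_mat v = diag_mat (\<lambda>j. complex_of_real ((cmod (v $ j))\<^sup>2))"

definition sigma_mat :: "real \<Rightarrow> complex^'p::{finite,linorder}^'j::{finite,linorder}" where
  "sigma_mat h = (\<chi> j k. complex_of_real (sine_basis (index_of k) (grid h j)))"

definition Lambda_mat :: "(nat \<Rightarrow> real) \<Rightarrow> complex^'p::{finite,linorder}^'p::{finite,linorder}" where
  "Lambda_mat \<eta> = diag_mat (\<lambda>k. complex_of_real (sqrt (\<eta> (index_of k))))"

section \<open>The driving noise\<close>

text \<open>
  Only the times $t \ge 0$ matter.  A filtration indexed by $[0,\infty)$ is turned into one indexed
  by \<open>real\<close> by repeating its initial $\sigma$-algebra at negative times.
\<close>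

definition brownian_motion ::
    "'w measure \<Rightarrow> (real \<Rightarrow> 'w measure) \<Rightarrow> (real \<Rightarrow> 'w \<Rightarrow> real) \<Rightarrow> bool" where
  "brownian_motion M \<F> b \<longleftrightarrow>
     (\<forall>t\<ge>0. b t \<in> borel_measurable (\<F> t)) \<and>
     (AE \<omega> in M. b 0 \<omega> = 0) \<and>
     (AE \<omega> in M. continuous_on {0..} (\<lambda>t. b t \<omega>)) \<and>
     (\<forall>s t. 0 \<le> s \<longrightarrow> s < t \<longrightarrow>
        distributed M lborel (\<lambda>\<omega>. b t \<omega> - b s \<omega>) (normal_density 0 (sqrt (t - s))) \<and>
        prob_space.indep_set M (sets (\<F> s))
          (sets (vimage_algebra (space M) (\<lambda>\<omega>. b t \<omega> - b s \<omega>) borel)))"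

text \<open>
  \<open>b k i\<close>, \<open>i \<in> {1, 2}\<close>, are the real and imaginary parts $\beta_k^1, \beta_k^2$.  Independence is
  that of the whole processes, viewed as random elements of $\mathbb{R}^{[0,\infty)}$.
\<close>

definition independent_brownian_motions ::
    "'w measure \<Rightarrow> (real \<Rightarrow> 'w measure) \<Rightarrow> ('p \<Rightarrow> nat \<Rightarrow> real \<Rightarrow> 'w \<Rightarrow> real) \<Rightarrow> bool" where
  "independent_brownian_motions M \<F> b \<longleftrightarrow>
     (\<forall>k. \<forall>i\<in>{1,2}. brownian_motion M \<F> (b k i)) \<and>
     prob_space.indep_vars M (\<lambda>_. \<Pi>\<^sub>M t\<in>{0..}. borel)
       (\<lambda>(k, i) \<omega>. \<lambda>t\<in>{0..}. b k i t \<omega>) (UNIV \<times> {1,2})"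

definition complex_noise :: "('p \<Rightarrow> nat \<Rightarrow> real \<Rightarrow> 'w \<Rightarrow> real) \<Rightarrow> real \<Rightarrow> 'w \<Rightarrow> complex^'p" where
  "complex_noise b t \<omega> = (\<chi> k. Complex (b k 1 t \<omega>) (b k 2 t \<omega>))"

section \<open>The semi-discretized equation and the fully discrete scheme\<close>

definition drift :: "real \<Rightarrow> real \<Rightarrow> real \<Rightarrow> complex^'j::{finite,linorder} \<Rightarrow> complex^'j::{finite,linorder}" where
  "drift h \<alpha> lam v =
     \<i> *s (complex_of_real (1 / h\<^sup>2) *s (laplace_mat *v v) + (\<i> * complex_of_real \<alpha>) *s v
           + complex_of_real lam *s (F_mat v *v v))"

text \<open>
  The noise is additive, so the stochastic integral is $\epsilon\,\sigma\Lambda\,\beta(t)$ and the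
  equation is a pathwise integral equation.
\<close>

definition semidiscrete_solution ::
    "'w measure \<Rightarrow> (real \<Rightarrow> 'w measure) \<Rightarrow> real \<Rightarrow> real \<Rightarrow> real \<Rightarrow> real \<Rightarrow> (nat \<Rightarrow> real) \<Rightarrow>
     (real \<Rightarrow> 'w \<Rightarrow> complex^'p::{finite,linorder}) \<Rightarrow> ('w \<Rightarrow> real \<Rightarrow> complex) \<Rightarrow>
     (real \<Rightarrow> 'w \<Rightarrow> complex^'j::{finite,linorder}) \<Rightarrow> bool" where
  "semidiscrete_solution M \<F> h \<alpha> lam \<epsilon> \<eta> \<beta> \<psi>\<^sub>0 \<Psi> \<longleftrightarrow>
     (\<forall>t\<ge>0. \<Psi> t \<in> borel_measurable (\<F> t)) \<and>
     (AE \<omega> in M. \<Psi> 0 \<omega> = (\<chi> j. \<psi>\<^sub>0 \<omega> (grid h j))) \<and>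
     (AE \<omega> in M. continuous_on {0..} (\<lambda>t. \<Psi> t \<omega>)) \<and>
     (AE \<omega> in M. \<forall>t\<ge>0. \<Psi> t \<omega> =
        \<Psi> 0 \<omega> + integral {0..t} (\<lambda>s. drift h \<alpha> lam (\<Psi> s \<omega>))
        + \<epsilon> *\<^sub>R ((sigma_mat h ** Lambda_mat \<eta>) *v \<beta> t \<omega>))"

definition f_mat :: "real \<Rightarrow> real \<Rightarrow> real \<Rightarrow> complex^'j \<Rightarrow> complex^'j^'j" where
  "f_mat \<tau> \<alpha> lam v =
     complex_of_real \<tau> *\<^sub>C
       (complex_of_real (- \<alpha> / 2) *\<^sub>C mat 1 + (\<i> * complex_of_real lam) *\<^sub>C F_mat v)"

definition left_matrix :: "real \<Rightarrow> real \<Rightarrow> real \<Rightarrow> complex^'j::{finite,linorder}^'j::{finite,linorder}" where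
  "left_matrix h \<tau> \<alpha> =
     mat 1 - (\<i> * complex_of_real (\<tau> / (2 * h\<^sup>2))) *\<^sub>C laplace_mat + complex_of_real (\<alpha> * \<tau> / 4) *\<^sub>C mat 1"

definition right_matrix :: "real \<Rightarrow> real \<Rightarrow> real \<Rightarrow> complex^'j::{finite,linorder}^'j::{finite,linorder}" where
  "right_matrix h \<tau> \<alpha> =
     mat 1 + (\<i> * complex_of_real (\<tau> / (2 * h\<^sup>2))) *\<^sub>C laplace_mat - complex_of_real (\<alpha> * \<tau> / 4) *\<^sub>C mat 1"

text \<open>For $\alpha, \tau \ge 0$ the matrix \<open>left_matrix h \<tau> \<alpha>\<close> is invertible, since $A$ is symmetric.\<close>

primrec scheme ::
    "real \<Rightarrow> real \<Rightarrow> real \<Rightarrow> real \<Rightarrow> real \<Rightarrow> (nat \<Rightarrow> real) \<Rightarrow>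
     (real \<Rightarrow> 'w \<Rightarrow> complex^'p::{finite,linorder}) \<Rightarrow>
     ('w \<Rightarrow> complex^'j::{finite,linorder}) \<Rightarrow> nat \<Rightarrow> 'w \<Rightarrow> complex^'j::{finite,linorder}" where
  "scheme h \<tau> \<alpha> lam \<epsilon> \<eta> \<beta> \<Psi>\<^sub>0 0 \<omega> = \<Psi>\<^sub>0 \<omega>"
| "scheme h \<tau> \<alpha> lam \<epsilon> \<eta> \<beta> \<Psi>\<^sub>0 (Suc n) \<omega> =
     (matrix_inv (left_matrix h \<tau> \<alpha>) ** right_matrix h \<tau> \<alpha>
        ** mat_exp (f_mat \<tau> \<alpha> lam (scheme h \<tau> \<alpha> lam \<epsilon> \<eta> \<beta> \<Psi>\<^sub>0 n \<omega>)))
       *v scheme h \<tau> \<alpha> lam \<epsilon> \<eta> \<beta> \<Psi>\<^sub>0 n \<omega>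
     + \<epsilon> *\<^sub>R ((matrix_inv (left_matrix h \<tau> \<alpha>) ** sigma_mat h ** Lambda_mat \<eta>)
             *v (\<beta> (real (Suc n) * \<tau>) \<omega> - \<beta> (real n * \<tau>) \<omega>))"

text \<open>
  The supremum is taken in \<open>ennreal\<close>, so it is $0$ if there is no step $n$ with
  $1 \le n \le [T/\tau]$.
\<close>

definition sup_error ::
    "real \<Rightarrow> real \<Rightarrow> real \<Rightarrow> (real \<Rightarrow> 'w \<Rightarrow> complex^'j) \<Rightarrow> (nat \<Rightarrow> 'w \<Rightarrow> complex^'j) \<Rightarrow>
     'w \<Rightarrow> ennreal" where
  "sup_error h \<tau> T \<Psi> \<Psi>d \<omega> =
     (SUP n\<in>{1..nat \<lfloor>T / \<tau>\<rfloor>}. ennreal (sqrt h * norm (\<Psi> (real n * \<tau>) \<omega> - \<Psi>d n \<omega>)))"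

end

(* With h fixed the equation is a locally Lipschitz ODE system driven by additive noise w. Off an
   event of small probability, psi and w stay in a ball of radius R on [0,T]. In summed form the error is
     e_n = tau * sum_{k<n} (G(psi(t_k)) - G(y_k)) + sum_{k<n} rho_k,
   so Gronwall's inequality reduces everything to sum_{k<n} rho_k = O(tau) uniformly in n. The part
   of rho_k that comes from the implicit treatment of the noise telescopes. By Taylor's formula the
   rest is, up to O(tau^2) terms, D(psi(t_k)) applied to the integral of w(s) - w(t_k) over one step,
   plus the integral of |w(s) - w(t_k)|^2. The former are martingale differences of variance
   O(tau^3), so their partial sums are O(tau) by a maximal inequality; the latter has expectation
   O(tau^2), so Markov's inequality suffices. Step sizes bounded away from zero allow only boundedly
   many steps and are covered by a crude bound. *)
theory Submission
  imports Defs
begin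

section \<open>Weighted sums of Brownian integrals\<close>

text \<open>The cubic term is only locally Lipschitz, so every constant lives on a ball. Its radius,
  and from it the bounds on drift and derivative, are fixed by the admissible probability before the
  step size, which makes the final constant uniform in \<tau>. The weights D(psi(t_k)) are set to 0
  outside the ball, which keeps them bounded and adapted; off the bad event nothing changes. The
  scheme itself is never assumed bounded: as long as the error is at most 1 it stays in the ball
  enlarged by 1, and the estimate reproduces itself. Local errors are kept inside one sum, since
  adding their norms would give only order one half. The Brownian integrals are replaced by Riemann
  sums, so that moments and orthogonality concern finitely many Gaussian increments; the integrals
  return pathwise as the mesh shrinks. Every real direction of the noise, paired with every
  coordinate of the solution space, gives a separate scalar sum, and the finitely many bad events
  are united.\<close>

lemma riemann_sum_error:
  fixes f :: "real \<Rightarrow> 'a::banach"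
  assumes f: "continuous_on {a..a + m * d} f" and d: "0 \<le> d"
    and osc: "\<And>x y. x \<in> {a..a + m * d} \<Longrightarrow> y \<in> {a..a + m * d} \<Longrightarrow> \<bar>x - y\<bar> \<le> d \<Longrightarrow> norm (f x - f y) \<le> e"
  shows "norm (integral {a..a + real m * d} f - d *\<^sub>R (\<Sum>i<m. f (a + real (Suc i) * d))) \<le> real m * d * e"
  using assms
proof (induction m)
  case 0
  then show ?case by simp
next
  case (Suc m)
  let ?t = "a + real m * d" and ?u = "a + real (Suc m) * d"
  have le: "a \<le> ?t" "?t \<le> ?u" and ut: "?u = ?t + d"
    using Suc.prems(2) by (auto simp: algebra_simps intro: add_nonneg_nonneg)
  then have le': "a \<le> ?u" by linarith
  have int: "f integrable_on {a..?u}"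
    using Suc.prems(1) by (rule integrable_continuous_real)
  have IH: "norm (integral {a..?t} f - d *\<^sub>R (\<Sum>i<m. f (a + real (Suc i) * d))) \<le> real m * d * e"
  proof (rule Suc.IH)
    show "continuous_on {a..?t} f"
      using continuous_on_subset[OF Suc.prems(1)] le by auto
    fix x y assume "x \<in> {a..?t}" "y \<in> {a..?t}" "\<bar>x - y\<bar> \<le> d"
    then show "norm (f x - f y) \<le> e" using le by (intro Suc.prems(3)) auto
  qed (use Suc.prems in auto)
  have split: "integral {a..?u} f = integral {a..?t} f + integral {?t..?u} f"
    using Henstock_Kurzweil_Integration.integral_combine[OF le int] by simp
  have int2: "f integrable_on {?t..?u}"
    by (rule integrable_subinterval_real[OF int]) (use le in auto)
  \<comment> \<open>On one panel the integrand stays within e of its value at the right endpoint, so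
    each panel costs d * e.\<close>
  have "integral {?t..?u} f - d *\<^sub>R f ?u = integral {?t..?u} (\<lambda>x. f x - f ?u)"
    using int2 le by (subst Henstock_Kurzweil_Integration.integral_diff) (auto simp: algebra_simps)
  also have "norm \<dots> \<le> e * (?u - ?t)"
  proof (rule integral_bound)
    show "continuous_on {?t..?u} (\<lambda>x. f x - f ?u)"
      using continuous_on_subset[OF Suc.prems(1)] le by (intro continuous_intros) auto
    fix x assume "x \<in> {?t..?u}"
    then have x: "?t \<le> x" "x \<le> ?u" by auto
    have "x \<in> {a..?u}" "?u \<in> {a..?u}" using x order_trans[OF le(1) x(1)] le' by auto
    moreover have "\<bar>x - ?u\<bar> \<le> d" using x ut by linarith
    ultimately show "norm (f x - f ?u) \<le> e" by (rule Suc.prems(3))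
  qed (use le in auto)
  finally have *: "norm (integral {?t..?u} f - d *\<^sub>R f ?u) \<le> d * e"
    unfolding ut by (simp add: mult.commute)
  have "integral {a..?u} f - d *\<^sub>R (\<Sum>i<Suc m. f (a + real (Suc i) * d)) =
      (integral {a..?t} f - d *\<^sub>R (\<Sum>i<m. f (a + real (Suc i) * d))) + (integral {?t..?u} f - d *\<^sub>R f ?u)"
    unfolding split by (simp add: algebra_simps)
  also have "norm \<dots> \<le> real m * d * e + d * e"
    by (rule norm_triangle_le[OF add_mono[OF IH *]])
  finally show ?case by (simp add: algebra_simps)
qed

lemma riemann_sum_tendsto:
  fixes f :: "real \<Rightarrow> 'a::banach"
  assumes f: "continuous_on {a..a + l} f" and l: "0 \<le> l"
  shows "(\<lambda>m. (l / real m) *\<^sub>R (\<Sum>i<m. f (a + real (Suc i) * (l / real m)))) \<longlonglongrightarrow> integral {a..a + l} f"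
proof (rule LIMSEQ_I)
  fix r :: real assume r: "r > 0"
  \<comment> \<open>The summand 1 keeps the denominator positive for l = 0; the total error l * e is
    then below r.\<close>
  define e where "e = r / (2 * (l + 1))"
  have e: "e > 0" using r l by (simp add: e_def)
  have "uniformly_continuous_on {a..a + l} f"
    using f by (intro compact_uniformly_continuous) auto
  then obtain \<delta> where \<delta>: "\<delta> > 0"
    and uc: "\<And>x y. x \<in> {a..a + l} \<Longrightarrow> y \<in> {a..a + l} \<Longrightarrow> dist x y < \<delta> \<Longrightarrow> dist (f x) (f y) < e"
    using e unfolding uniformly_continuous_on_def by metis
  obtain N :: nat where N: "l / \<delta> < real N" using reals_Archimedean2 by blast
  show "\<exists>N. \<forall>m\<ge>N. norm ((l / real m) *\<^sub>R (\<Sum>i<m. f (a + real (Suc i) * (l / real m)))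
      - integral {a..a + l} f) < r"
  proof (intro exI allI impI)
    \<comment> \<open>\<open>Suc N\<close> excludes m = 0, where division by zero yields 0.\<close>
    fix m assume "m \<ge> Suc N"
    then have m: "m > 0" "real m > real N" by auto
    have eq: "real m * (l / real m) = l" using m by simp
    have small: "l / real m < \<delta>"
      using order_less_trans[OF N m(2)] m(1) \<delta> by (simp add: field_simps)
    have "norm (integral {a..a + real m * (l / real m)} f
        - (l / real m) *\<^sub>R (\<Sum>i<m. f (a + real (Suc i) * (l / real m)))) \<le> real m * (l / real m) * e"
    proof (rule riemann_sum_error)
      show "continuous_on {a..a + real m * (l / real m)} f" using f eq by simp
      fix x y assume "x \<in> {a..a + real m * (l / real m)}" "y \<in> {a..a + real m * (l / real m)}"
        "\<bar>x - y\<bar> \<le> l / real m"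
      then show "norm (f x - f y) \<le> e"
        using uc[of x y] small unfolding eq by (simp add: dist_norm less_imp_le)
    qed (use l in auto)
    then have "norm ((l / real m) *\<^sub>R (\<Sum>i<m. f (a + real (Suc i) * (l / real m))) - integral {a..a + l} f)
        \<le> l * e"
      unfolding eq by (simp add: norm_minus_commute)
    also have "l * e < r"
      using r l mult_nonneg_nonneg[of l r] by (simp add: e_def field_simps add_nonneg_pos)
    finally show "norm ((l / real m) *\<^sub>R (\<Sum>i<m. f (a + real (Suc i) * (l / real m)))
      - integral {a..a + l} f) < r" .
  qed
qed

section \<open>Increments of one Brownian motion and Riemann sums of its integrals\<close>

locale adapted_brownian_motion = prob_space M
  for M :: "'w measure" +
  fixes F :: "real \<Rightarrow> 'w measure" and b :: "real \<Rightarrow> 'w \<Rightarrow> real"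
  assumes filtration: "filtration (space M) F"
    and subalg: "subalgebra M (F t)"
    and bm: "brownian_motion M F b"
begin

lemma measurable_mono:
  assumes "s \<le> t" "f \<in> borel_measurable (F s)"
  shows "f \<in> borel_measurable (F t)"
proof (rule measurable_from_subalg[OF _ assms(2)])
  show "subalgebra (F t) (F s)"
    unfolding subalgebra_def filtration.space_F[OF filtration]
    using filtration.sets_F_mono[OF filtration assms(1)] by blast
qed

lemma measurable_M: "f \<in> borel_measurable (F s) \<Longrightarrow> f \<in> borel_measurable M"
  using subalg by (rule measurable_from_subalg)

lemma b_measurable: "0 \<le> s \<Longrightarrow> s \<le> t \<Longrightarrow> b s \<in> borel_measurable (F t)"
  using bm measurable_mono unfolding brownian_motion_def by blast

lemma increment_distributed:
  "0 \<le> s \<Longrightarrow> s < t \<Longrightarrow> distributed M lborel (\<lambda>\<omega>. b t \<omega> - b s \<omega>) (normal_density 0 (sqrt (t - s)))"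
  using bm unfolding brownian_motion_def by blast

lemma increment_integrable:
  assumes "0 \<le> s" "s < t"
  shows "integrable M (\<lambda>\<omega>. b t \<omega> - b s \<omega>)"
proof (rule distributed_integrable_var[OF increment_distributed[OF assms]])
  show "integrable lborel (\<lambda>x. normal_density 0 (sqrt (t - s)) x * x)"
    using assms by (intro integrable_normal_moment_nz_1) simp
qed simp

lemma increment_expectation:
  assumes "0 \<le> s" "s < t"
  shows "expectation (\<lambda>\<omega>. b t \<omega> - b s \<omega>) = 0"
  using assms by (intro normal_distributed_expectation[OF _ increment_distributed[OF assms]]) simp

lemma increment_square_integrable:
  assumes "0 \<le> s" "s < t"
  shows "integrable M (\<lambda>\<omega>. (b t \<omega> - b s \<omega>)\<^sup>2)"
proof -
  have "integrable lborel (\<lambda>x. normal_density 0 (sqrt (t - s)) x * (x - 0)\<^sup>2)"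
    using assms by (intro integrable_normal_moment) simp
  then show ?thesis
    using distributed_integrable[OF increment_distributed[OF assms], of "\<lambda>x. x\<^sup>2"] by simp
qed

lemma increment_variance:
  assumes "0 \<le> s" "s < t"
  shows "expectation (\<lambda>\<omega>. (b t \<omega> - b s \<omega>)\<^sup>2) = t - s"
proof -
  have "0 < sqrt (t - s)" using assms by simp
  from normal_distributed_variance[OF this increment_distributed[OF assms]] show ?thesis
    unfolding increment_expectation[OF assms] using assms by simp
qed

text \<open>Independence passes to smaller families on both sides: the events of \<open>Z\<close>
  belong to \<open>F s\<close> by measurability, those of the increment to its preimage
  algebra.\<close>

lemma increment_indep:
  assumes s: "0 \<le> s" "s < t" and Z: "Z \<in> borel_measurable (F s)"
  shows "indep_var borel Z borel (\<lambda>\<omega>. b t \<omega> - b s \<omega>)"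
proof -
  let ?d = "\<lambda>\<omega>. b t \<omega> - b s \<omega>"
  have ind: "indep_set (sets (F s)) (sets (vimage_algebra (space M) ?d borel))"
    using bm s unfolding brownian_motion_def by blast
  have sp: "space (F s) = space M" using subalg by (simp add: subalgebra_def)
  have 1: "sigma_sets (space M) {Z -` A \<inter> space M |A. A \<in> sets borel} \<subseteq> sets (F s)"
    using measurable_sets[OF Z] unfolding sp[symmetric]
    by (intro sets.sigma_sets_subset) auto
  have 2: "sigma_sets (space M) {?d -` A \<inter> space M |A. A \<in> sets borel} \<subseteq> sets (vimage_algebra (space M) ?d borel)"
    by (auto simp: sets_vimage_algebra)
  have "indep_set (sigma_sets (space M) {Z -` A \<inter> space M |A. A \<in> sets borel})
     (sigma_sets (space M) {?d -` A \<inter> space M |A. A \<in> sets borel})"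
    using ind 1 2 unfolding indep_set_def
    by (rule_tac indep_sets_mono_sets) (auto split: bool.split)
  moreover have "?d \<in> borel_measurable M"
    using increment_distributed[OF s] by (simp add: distributed_def)
  ultimately show ?thesis
    unfolding indep_var_eq using measurable_M[OF Z] by auto
qed

text \<open>The martingale property in product form: by independence the expectation factorises, and
  the increment has mean 0.\<close>

lemma increment_orthogonal:
  assumes s: "0 \<le> s" "s < t" and Z: "Z \<in> borel_measurable (F s)" "integrable M Z"
  shows "integrable M (\<lambda>\<omega>. Z \<omega> * (b t \<omega> - b s \<omega>))"
    and "expectation (\<lambda>\<omega>. Z \<omega> * (b t \<omega> - b s \<omega>)) = 0"
proof -
  note ind = increment_indep[OF s Z(1)]
  show "integrable M (\<lambda>\<omega>. Z \<omega> * (b t \<omega> - b s \<omega>))"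
    by (rule indep_var_integrable[OF ind Z(2) increment_integrable[OF s]])
  show "expectation (\<lambda>\<omega>. Z \<omega> * (b t \<omega> - b s \<omega>)) = 0"
    unfolding indep_var_lebesgue_integral[OF ind Z(2) increment_integrable[OF s]] increment_expectation[OF s] by simp
qed

text \<open>The Riemann sum, with m panels, for the integral of b(s) - b(k \<tau>) over the k-th
  step. With right endpoints every increment in it has positive length, as the normal density
  requires.\<close>

definition rsum :: "real \<Rightarrow> nat \<Rightarrow> nat \<Rightarrow> 'w \<Rightarrow> real" where
  "rsum \<tau> m k \<omega> = \<tau> / m * (\<Sum>i<m. b (real k * \<tau> + real (Suc i) * (\<tau> / m)) \<omega> - b (real k * \<tau>) \<omega>)"

definition rsum_sq :: "real \<Rightarrow> nat \<Rightarrow> nat \<Rightarrow> 'w \<Rightarrow> real" where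
  "rsum_sq \<tau> m k \<omega> = \<tau> / m * (\<Sum>i<m. (b (real k * \<tau> + real (Suc i) * (\<tau> / m)) \<omega> - b (real k * \<tau>) \<omega>)\<^sup>2)"

context
  fixes \<tau> :: real and m :: nat
  assumes \<tau>: "\<tau> > 0" and m: "m > 0"
begin

lemma node:
  assumes "i < m"
  shows "0 \<le> real k * \<tau>" "real k * \<tau> < real k * \<tau> + real (Suc i) * (\<tau> / m)"
    "real k * \<tau> + real (Suc i) * (\<tau> / m) \<le> real (Suc k) * \<tau>" "0 \<le> real (Suc i) * (\<tau> / m)"
    "real (Suc i) * (\<tau> / m) \<le> \<tau>"
proof -
  show 1: "0 \<le> real k * \<tau>" "0 \<le> real (Suc i) * (\<tau> / m)" "real k * \<tau> < real k * \<tau> + real (Suc i) * (\<tau> / m)"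
    using \<tau> m by auto
  have "real (Suc i) * (\<tau> / m) \<le> real m * (\<tau> / m)"
    using assms \<tau> by (intro mult_right_mono) auto
  then show "real (Suc i) * (\<tau> / m) \<le> \<tau>" using m by simp
  then show "real k * \<tau> + real (Suc i) * (\<tau> / m) \<le> real (Suc k) * \<tau>"
    by (simp only: of_nat_Suc distrib_right)
qed

lemma rsum_measurable: "rsum \<tau> m k \<in> borel_measurable (F (real (Suc k) * \<tau>))"
proof -
  have "b (real k * \<tau> + real (Suc i) * (\<tau> / m)) \<in> borel_measurable (F (real (Suc k) * \<tau>))" if "i < m" for i
    using node(1-3)[OF that, of k] by (intro b_measurable) linarith+
  moreover have "b (real k * \<tau>) \<in> borel_measurable (F (real (Suc k) * \<tau>))"
    using \<tau> by (intro b_measurable) auto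
  ultimately show ?thesis unfolding rsum_def[abs_def]
    by (intro borel_measurable_times borel_measurable_sum borel_measurable_diff) auto
qed

lemma rsum_sq_integrable: "integrable M (rsum_sq \<tau> m k)"
  unfolding rsum_sq_def[abs_def]
  using node by (intro integrable_mult_right Bochner_Integration.integrable_sum increment_square_integrable) auto

text \<open>The mean of a squared increment is its length, hence at most \<tau>, and the weights add
  up to \<tau>.\<close>

lemma rsum_sq_expectation: "expectation (rsum_sq \<tau> m k) \<le> \<tau>\<^sup>2"
proof -
  have "expectation (rsum_sq \<tau> m k) =
      \<tau> / m * (\<Sum>i<m. expectation (\<lambda>\<omega>. (b (real k * \<tau> + real (Suc i) * (\<tau> / m)) \<omega> - b (real k * \<tau>) \<omega>)\<^sup>2))"
    unfolding rsum_sq_def[abs_def] using node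
    by (subst integral_mult_right_zero, subst Bochner_Integration.integral_sum) (auto intro!: increment_square_integrable)
  also have "\<dots> = \<tau> / m * (\<Sum>i<m. real (Suc i) * (\<tau> / m))"
    using node(1,2) by (intro arg_cong2[where f="(*)"] refl sum.cong) (subst increment_variance, auto)
  also have "\<dots> \<le> \<tau> / m * (\<Sum>i<m. \<tau>)"
    using \<tau> node(5) by (intro mult_left_mono sum_mono) auto
  also have "\<dots> = \<tau>\<^sup>2" using m by (simp add: power2_eq_square)
  finally show ?thesis .
qed

text \<open>Cauchy-Schwarz against the constant 1, as for the square of an integral. It spares the
  covariances of the overlapping increments.\<close>

lemma rsum_square_le: "(rsum \<tau> m k \<omega>)\<^sup>2 \<le> \<tau> * rsum_sq \<tau> m k \<omega>"
proof -
  define a where "a i = b (real k * \<tau> + real (Suc i) * (\<tau> / m)) \<omega> - b (real k * \<tau>) \<omega>" for i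
  have "(\<Sum>i<m. a i)\<^sup>2 \<le> (\<Sum>i<m. 1\<^sup>2) * (\<Sum>i<m. (a i)\<^sup>2)"
    using Cauchy_Schwarz_ineq_sum[of "\<lambda>_. 1" a "{..<m}"] by simp
  then have "(\<tau> / m)\<^sup>2 * (\<Sum>i<m. a i)\<^sup>2 \<le> (\<tau> / m)\<^sup>2 * (real m * (\<Sum>i<m. (a i)\<^sup>2))"
    by (intro mult_left_mono) auto
  also have "\<dots> = \<tau> * (\<tau> / m * (\<Sum>i<m. (a i)\<^sup>2))"
    using m by (simp add: power2_eq_square)
  finally show ?thesis
    unfolding rsum_def rsum_sq_def a_def power_mult_distrib .
qed

lemma rsum_square_integrable: "integrable M (\<lambda>\<omega>. (rsum \<tau> m k \<omega>)\<^sup>2)"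
proof (rule Bochner_Integration.integrable_bound[OF integrable_mult_right[OF rsum_sq_integrable, of \<tau> k]])
  show "(\<lambda>\<omega>. (rsum \<tau> m k \<omega>)\<^sup>2) \<in> borel_measurable M"
    using measurable_M[OF rsum_measurable] by measurable
  show "AE \<omega> in M. norm ((rsum \<tau> m k \<omega>)\<^sup>2) \<le> norm (\<tau> * rsum_sq \<tau> m k \<omega>)"
    using rsum_square_le by (auto intro: order_trans[OF _ abs_ge_self])
qed

lemma rsum_square_expectation: "expectation (\<lambda>\<omega>. (rsum \<tau> m k \<omega>)\<^sup>2) \<le> \<tau> ^ 3"
proof -
  have "expectation (\<lambda>\<omega>. (rsum \<tau> m k \<omega>)\<^sup>2) \<le> expectation (\<lambda>\<omega>. \<tau> * rsum_sq \<tau> m k \<omega>)"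
    by (rule integral_mono[OF rsum_square_integrable integrable_mult_right[OF rsum_sq_integrable] rsum_square_le])
  also have "\<dots> \<le> \<tau> * \<tau>\<^sup>2"
    using \<tau> rsum_sq_expectation by simp
  finally show ?thesis by (simp add: power2_eq_square power3_eq_cube)
qed

text \<open>All increments in the sum start at k * \<tau>, so a factor known at that time is
  orthogonal to each of them.\<close>

lemma rsum_orthogonal:
  assumes Z: "Z \<in> borel_measurable (F (real k * \<tau>))" "integrable M Z"
  shows "integrable M (\<lambda>\<omega>. Z \<omega> * rsum \<tau> m k \<omega>)" "expectation (\<lambda>\<omega>. Z \<omega> * rsum \<tau> m k \<omega>) = 0"
proof -
  have eq: "Z \<omega> * rsum \<tau> m k \<omega> = \<tau> / m * (\<Sum>i<m. Z \<omega> * (b (real k * \<tau> + real (Suc i) * (\<tau> / m)) \<omega> - b (real k * \<tau>) \<omega>))" for \<omega>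
    by (simp add: rsum_def sum_distrib_left mult_ac)
  note o = increment_orthogonal[OF node(1,2) Z]
  show "integrable M (\<lambda>\<omega>. Z \<omega> * rsum \<tau> m k \<omega>)"
    unfolding eq by (intro integrable_mult_right Bochner_Integration.integrable_sum o(1)) auto
  show "expectation (\<lambda>\<omega>. Z \<omega> * rsum \<tau> m k \<omega>) = 0"
    unfolding eq integral_mult_right_zero
    using o by (subst Bochner_Integration.integral_sum) (auto intro!: sum.neutral)
qed

section \<open>A maximal inequality for adapted weighted sums\<close>

context
  fixes G :: "nat \<Rightarrow> 'w \<Rightarrow> real" and B :: real
  assumes G: "\<And>k. G k \<in> borel_measurable (F (real k * \<tau>))" and GB: "\<And>k \<omega>. \<bar>G k \<omega>\<bar> \<le> B"
begin

text \<open>Stopping at level \<open>a\<close> turns Chebyshev's inequality at the last index into a maximal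
  inequality, since the stopped sum keeps its value once it has left \<open>(-a, a)\<close>.\<close>

primrec stopped_sum :: "real \<Rightarrow> nat \<Rightarrow> 'w \<Rightarrow> real" where
  "stopped_sum a 0 \<omega> = 0"
| "stopped_sum a (Suc n) \<omega> = stopped_sum a n \<omega> + (if \<bar>stopped_sum a n \<omega>\<bar> < a then G n \<omega> else 0) * rsum \<tau> m n \<omega>"

lemma stopped_sum_measurable: "stopped_sum a n \<in> borel_measurable (F (real n * \<tau>))"
proof (induction n)
  case 0
  then show ?case by (simp add: stopped_sum.simps(1)[abs_def])
next
  case (Suc n)
  have le: "real n * \<tau> \<le> real (Suc n) * \<tau>" using \<tau> by simp
  have [measurable]: "stopped_sum a n \<in> borel_measurable (F (real (Suc n) * \<tau>))"
    "G n \<in> borel_measurable (F (real (Suc n) * \<tau>))" "rsum \<tau> m n \<in> borel_measurable (F (real (Suc n) * \<tau>))"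
    using measurable_mono[OF le Suc.IH] measurable_mono[OF le G] rsum_measurable by auto
  show ?case unfolding stopped_sum.simps(2)[abs_def] by measurable
qed

text \<open>Second moments add: in the square of S + g X the mixed term is X times 2 g S, which is
  known at time n * \<tau>, so its mean is 0, and (g X)^2 contributes at most B^2 \<tau>^3. The
  cut-off depends on the past only, hence \<open>g\<close> is still adapted.\<close>

lemma stopped_sum_square:
  "integrable M (\<lambda>\<omega>. (stopped_sum a n \<omega>)\<^sup>2) \<and> expectation (\<lambda>\<omega>. (stopped_sum a n \<omega>)\<^sup>2) \<le> real n * (B\<^sup>2 * \<tau> ^ 3)"
proof (induction n)
  case 0
  then show ?case by simp
next
  case (Suc n)
  define g where "g \<omega> = (if \<bar>stopped_sum a n \<omega>\<bar> < a then G n \<omega> else 0)" for \<omega>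
  define S where "S = stopped_sum a n"
  define X where "X = rsum \<tau> m n"
  note [measurable] = stopped_sum_measurable[of a n] G[of n]
  have B0: "0 \<le> B" using GB[of 0 undefined] by linarith
  have gm: "g \<in> borel_measurable (F (real n * \<tau>))" unfolding g_def[abs_def] by measurable
  have gB: "\<bar>g \<omega>\<bar> \<le> B" for \<omega> using GB[of n \<omega>] B0 by (auto simp: g_def)
  note [measurable] = measurable_M[OF gm] measurable_M[OF stopped_sum_measurable[of a n], folded S_def]
    measurable_M[OF rsum_measurable[of n], folded X_def]
  have S2: "integrable M (\<lambda>\<omega>. (S \<omega>)\<^sup>2)" "expectation (\<lambda>\<omega>. (S \<omega>)\<^sup>2) \<le> real n * (B\<^sup>2 * \<tau> ^ 3)"
    using Suc.IH by (auto simp: S_def)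
  have S1: "integrable M S"
    by (rule square_integrable_imp_integrable) (use S2 in auto)
  \<comment> \<open>\<open>g\<close> is bounded, and \<open>S\<close>, being square integrable on a
    probability space, is integrable; so the mixed factor qualifies for
    \<open>rsum_orthogonal\<close>.\<close>
  have gS: "integrable M (\<lambda>\<omega>. 2 * (g \<omega> * S \<omega>))"
  proof (rule Bochner_Integration.integrable_bound[OF integrable_mult_right[OF S1, of "2 * B"]])
    show "AE \<omega> in M. norm (2 * (g \<omega> * S \<omega>)) \<le> norm (2 * B * S \<omega>)"
      using gB B0 by (auto simp: abs_mult intro!: mult_right_mono)
  qed measurable
  have "(\<lambda>\<omega>. 2 * (g \<omega> * S \<omega>)) \<in> borel_measurable (F (real n * \<tau>))"
    using gm stopped_sum_measurable[of a n] unfolding S_def by measurable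
  note o = rsum_orthogonal[OF this gS, folded X_def]
  have gX_le: "(g \<omega> * X \<omega>)\<^sup>2 \<le> B\<^sup>2 * (X \<omega>)\<^sup>2" for \<omega>
    unfolding power_mult_distrib using gB[of \<omega>] B0
    by (intro mult_right_mono) (auto simp: abs_le_square_iff[symmetric])
  have X2: "integrable M (\<lambda>\<omega>. B\<^sup>2 * (X \<omega>)\<^sup>2)"
    unfolding X_def by (intro integrable_mult_right rsum_square_integrable)
  have gX: "integrable M (\<lambda>\<omega>. (g \<omega> * X \<omega>)\<^sup>2)"
    proof (rule Bochner_Integration.integrable_bound[OF X2])
    show "AE \<omega> in M. norm ((g \<omega> * X \<omega>)\<^sup>2) \<le> norm (B\<^sup>2 * (X \<omega>)\<^sup>2)"
      using gX_le by (intro AE_I2) (simp add: abs_mult)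
  qed measurable
  have eq: "(stopped_sum a (Suc n) \<omega>)\<^sup>2 = (S \<omega>)\<^sup>2 + 2 * (g \<omega> * S \<omega>) * X \<omega> + (g \<omega> * X \<omega>)\<^sup>2" for \<omega>
    by (simp add: S_def g_def X_def power2_eq_square algebra_simps)
  have "expectation (\<lambda>\<omega>. (g \<omega> * X \<omega>)\<^sup>2) \<le> expectation (\<lambda>\<omega>. B\<^sup>2 * (X \<omega>)\<^sup>2)"
    by (intro integral_mono gX X2 gX_le)
  also have "\<dots> \<le> B\<^sup>2 * \<tau> ^ 3"
    using rsum_square_expectation[of n] by (simp add: X_def mult_left_mono)
  finally have "expectation (\<lambda>\<omega>. (stopped_sum a (Suc n) \<omega>)\<^sup>2) \<le> real n * (B\<^sup>2 * \<tau> ^ 3) + B\<^sup>2 * \<tau> ^ 3"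
    unfolding eq using S2 o gX by simp
  moreover have "integrable M (\<lambda>\<omega>. (stopped_sum a (Suc n) \<omega>)\<^sup>2)"
    unfolding eq using S2 o gX by simp
  ultimately show ?case by (simp add: algebra_simps)
qed

lemma stopped_sum_frozen: "a \<le> \<bar>stopped_sum a n \<omega>\<bar> \<Longrightarrow> n \<le> k \<Longrightarrow> stopped_sum a k \<omega> = stopped_sum a n \<omega>"
  by (induction k) (auto simp: le_Suc_eq)

lemma stopped_sum_eq:
  "(\<And>k. k < n \<Longrightarrow> \<bar>stopped_sum a k \<omega>\<bar> < a) \<Longrightarrow> stopped_sum a n \<omega> = (\<Sum>k<n. G k \<omega> * rsum \<tau> m k \<omega>)"
proof (induction n)
  case (Suc n)
  then have "\<bar>stopped_sum a n \<omega>\<bar> < a" by blast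
  with Suc show ?case by simp
qed simp

text \<open>An estimate at the single index n. Its event is written with squares to fit Markov's
  inequality; the complement controls all earlier partial sums by
  \<open>abs_weighted_sum_less\<close>.\<close>

lemma maximal_inequality:
  assumes a: "a > 0"
  shows "measure M {\<omega> \<in> space M. a\<^sup>2 \<le> (stopped_sum a n \<omega>)\<^sup>2} \<le> real n * (B\<^sup>2 * \<tau> ^ 3) / a\<^sup>2"
proof -
  have "measure M {\<omega> \<in> space M. a\<^sup>2 \<le> (stopped_sum a n \<omega>)\<^sup>2} \<le> expectation (\<lambda>\<omega>. (stopped_sum a n \<omega>)\<^sup>2) / a\<^sup>2"
    by (rule integral_Markov_inequality_measure[where A="{}"]) (use stopped_sum_square a in auto)
  also have "\<dots> \<le> real n * (B\<^sup>2 * \<tau> ^ 3) / a\<^sup>2"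
    using stopped_sum_square by (intro divide_right_mono) auto
  finally show ?thesis .
qed

text \<open>Had some earlier stopped sum reached level a, freezing would carry it to index N,
  against the assumption. So nothing was ever stopped, and the stopped sums are the plain
  ones.\<close>

lemma abs_weighted_sum_less:
  assumes "\<not> a\<^sup>2 \<le> (stopped_sum a N \<omega>)\<^sup>2" "n \<le> N" "a > 0"
  shows "\<bar>\<Sum>k<n. G k \<omega> * rsum \<tau> m k \<omega>\<bar> < a"
proof -
  have *: "\<bar>stopped_sum a k \<omega>\<bar> < a" if "k \<le> N" for k
  proof (rule ccontr)
    assume "\<not> \<bar>stopped_sum a k \<omega>\<bar> < a"
    then have "a \<le> \<bar>stopped_sum a N \<omega>\<bar>"
      using stopped_sum_frozen[of a k \<omega> N] that by auto
    then show False using assms abs_le_square_iff[of a "stopped_sum a N \<omega>"] by auto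
  qed
  then show ?thesis using stopped_sum_eq[of n a \<omega>] assms(2) *[of n] by auto
qed

end

end

text \<open>The quantifier order matters: \<open>A\<close> is chosen before the step size and the
  weights, while \<open>Bad\<close> may depend on both. Continuity of the path stays a premise
  because the continuous paths need not form a measurable event.\<close>

lemma weighted_sums_small:
  assumes T: "T > 0" and e: "e > 0" and B: "B > 0"
  shows "\<exists>A>0. \<forall>\<tau>>0. \<forall>G. (\<forall>k. G k \<in> borel_measurable (F (real k * \<tau>)) \<and> (\<forall>\<omega>. \<bar>G k \<omega>\<bar> \<le> B)) \<longrightarrow>
    (\<exists>Bad\<in>sets M. measure M Bad \<le> e \<and>
      (\<forall>\<omega>\<in>space M - Bad. continuous_on {0..} (\<lambda>t. b t \<omega>) \<longrightarrow>
        (\<forall>n\<le>nat \<lfloor>T / \<tau>\<rfloor>. \<bar>\<Sum>k<n. G k \<omega> * integral {real k * \<tau>..real (Suc k) * \<tau>} (\<lambda>s. b s \<omega> - b (real k * \<tau>) \<omega>)\<bar> \<le> A * \<tau>) \<and>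
        (\<Sum>k<nat \<lfloor>T / \<tau>\<rfloor>. integral {real k * \<tau>..real (Suc k) * \<tau>} (\<lambda>s. (b s \<omega> - b (real k * \<tau>) \<omega>)\<^sup>2)) \<le> A * \<tau>))"
proof -
  \<comment> \<open>The first entry brings the Chebyshev bound B^2 T / A^2 below e / 2, the second
    the Markov bound T / A.\<close>
  define A where "A = max (B * sqrt (2 * T / e)) (2 * T / e)"
  have A: "A > 0" using T e by (simp add: A_def less_max_iff_disj)
  have A1: "B\<^sup>2 * T / A\<^sup>2 \<le> e / 2"
  proof -
    have "B\<^sup>2 * (2 * T / e) = (B * sqrt (2 * T / e))\<^sup>2"
      using T e by (simp add: power_mult_distrib)
    also have "\<dots> \<le> A\<^sup>2"
      using B T e by (intro power_mono) (auto simp: A_def)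
    finally show ?thesis using A e by (simp add: field_simps)
  qed
  have A2: "T / A \<le> e / 2"
  proof -
    have "2 * T / e \<le> A" by (simp add: A_def)
    then show ?thesis using A e by (simp add: field_simps)
  qed
  show ?thesis
  proof (intro exI[of _ A] conjI A allI impI)
    fix \<tau> :: real and G :: "nat \<Rightarrow> 'w \<Rightarrow> real"
    assume \<tau>: "\<tau> > 0" and G: "\<forall>k. G k \<in> borel_measurable (F (real k * \<tau>)) \<and> (\<forall>\<omega>. \<bar>G k \<omega>\<bar> \<le> B)"
    define N where "N = nat \<lfloor>T / \<tau>\<rfloor>"
    have "0 \<le> T / \<tau>" using T \<tau> by simp
    then have "real N \<le> T / \<tau>" by (simp add: N_def)
    then have N: "real N * \<tau> \<le> T" using \<tau> by (simp add: field_simps)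
    have G1: "\<And>k. G k \<in> borel_measurable (F (real k * \<tau>))" and G2: "\<And>k \<omega>. \<bar>G k \<omega>\<bar> \<le> B"
      using G by auto
    define S where "S m = stopped_sum \<tau> m G (A * \<tau>) N" for m
    define Q where "Q m \<omega> = (\<Sum>k<N. rsum_sq \<tau> m k \<omega>)" for m \<omega>
    define bad where "bad m = {\<omega> \<in> space M. (A * \<tau>)\<^sup>2 \<le> (S m \<omega>)\<^sup>2} \<union> {\<omega> \<in> space M. A * \<tau> \<le> Q m \<omega>}" for m
    have Sm: "S m \<in> borel_measurable M" if "m > 0" for m
      unfolding S_def using measurable_M[OF stopped_sum_measurable[OF \<tau> that G1 G2]] by simp
    have Qi: "integrable M (Q m)" if "m > 0" for m
      unfolding Q_def[abs_def] by (intro Bochner_Integration.integrable_sum rsum_sq_integrable \<tau> that)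
    have bad_sets: "bad m \<in> sets M" if "m > 0" for m
      unfolding bad_def using Sm[OF that] borel_measurable_integrable[OF Qi[OF that]] by measurable
    have bad_small: "measure M (bad m) \<le> e" if m: "m > 0" for m
    proof -
      have "measure M {\<omega> \<in> space M. (A * \<tau>)\<^sup>2 \<le> (S m \<omega>)\<^sup>2} \<le> real N * (B\<^sup>2 * \<tau> ^ 3) / (A * \<tau>)\<^sup>2"
        unfolding S_def by (rule maximal_inequality[OF \<tau> m G1 G2]) (use A \<tau> in auto)
      \<comment> \<open>Here the rate appears: N steps of variance at most B^2 \<tau>^3 against the
        squared level (A \<tau>)^2 leave only N * \<tau>, which is bounded by T.\<close>
      also have "\<dots> = B\<^sup>2 * (real N * \<tau>) / A\<^sup>2"
        using \<tau> A by (simp add: power2_eq_square power3_eq_cube)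
      also have "\<dots> \<le> B\<^sup>2 * T / A\<^sup>2"
        using N by (intro divide_right_mono mult_left_mono) auto
      finally have 1: "measure M {\<omega> \<in> space M. (A * \<tau>)\<^sup>2 \<le> (S m \<omega>)\<^sup>2} \<le> e / 2"
        using A1 by linarith
      have nn: "0 \<le> Q m \<omega>" for \<omega>
        unfolding Q_def rsum_sq_def using \<tau> by (intro sum_nonneg mult_nonneg_nonneg) auto
      have "measure M {\<omega> \<in> space M. A * \<tau> \<le> Q m \<omega>} \<le> expectation (Q m) / (A * \<tau>)"
        by (rule integral_Markov_inequality_measure[where A="{}"]) (use Qi[OF m] nn A \<tau> in auto)
      also have "\<dots> \<le> (\<Sum>k<N. \<tau>\<^sup>2) / (A * \<tau>)"
        unfolding Q_def[abs_def]
        using A \<tau> rsum_sq_integrable[OF \<tau> m] rsum_sq_expectation[OF \<tau> m]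
        by (subst Bochner_Integration.integral_sum) (auto intro!: divide_right_mono sum_mono simp del: sum_constant)
      also have "\<dots> = real N * \<tau> / A"
        using A \<tau> by (simp add: power2_eq_square)
      also have "\<dots> \<le> T / A" using N A by (intro divide_right_mono) auto
      finally have 2: "measure M {\<omega> \<in> space M. A * \<tau> \<le> Q m \<omega>} \<le> e / 2"
        using A2 by linarith
      note [measurable] = Sm[OF m] borel_measurable_integrable[OF Qi[OF m]]
      have "measure M (bad m) \<le> measure M {\<omega> \<in> space M. (A * \<tau>)\<^sup>2 \<le> (S m \<omega>)\<^sup>2} + measure M {\<omega> \<in> space M. A * \<tau> \<le> Q m \<omega>}"
        unfolding bad_def by (intro measure_Un_le) measurable
      with 1 2 show ?thesis by simp
    qed
    \<comment> \<open>The lower limit of the bad events has small measure by monotone convergence, and off it infinitely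
      many Riemann sums are small, so their limit is small as well.\<close>
    define Bad where "Bad = (\<Union>m0. \<Inter>m\<in>{Suc m0..}. bad m)"
    \<comment> \<open>Tails start at \<open>Suc m0\<close> so that the number of panels is positive,
      as all estimates above require.\<close>
    have tails: "(\<Inter>m\<in>{Suc m0..}. bad m) \<in> sets M" for m0
      using bad_sets by (intro sets.countable_INT') auto
    have Bad_sets: "Bad \<in> sets M" unfolding Bad_def using tails by auto
    have "(\<lambda>m0. measure M (\<Inter>m\<in>{Suc m0..}. bad m)) \<longlonglongrightarrow> measure M Bad"
      unfolding Bad_def using tails by (intro finite_Lim_measure_incseq) (auto simp: incseq_def)
    then have Bad_small: "measure M Bad \<le> e"
    proof (rule LIMSEQ_le_const2, intro exI allI impI)
      fix m0 :: nat
      have "measure M (\<Inter>m\<in>{Suc m0..}. bad m) \<le> measure M (bad (Suc m0))"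
        using bad_sets by (intro finite_measure_mono) auto
      then show "measure M (\<Inter>m\<in>{Suc m0..}. bad m) \<le> e" using bad_small[of "Suc m0"] by simp
    qed
    have good: "(\<forall>n\<le>N. \<bar>\<Sum>k<n. G k \<omega> * integral {real k * \<tau>..real (Suc k) * \<tau>} (\<lambda>s. b s \<omega> - b (real k * \<tau>) \<omega>)\<bar> \<le> A * \<tau>) \<and>
        (\<Sum>k<N. integral {real k * \<tau>..real (Suc k) * \<tau>} (\<lambda>s. (b s \<omega> - b (real k * \<tau>) \<omega>)\<^sup>2)) \<le> A * \<tau>"
      if \<omega>: "\<omega> \<in> space M - Bad" and cont: "continuous_on {0..} (\<lambda>t. b t \<omega>)" for \<omega>
    proof -
      have step: "real (Suc k) * \<tau> = real k * \<tau> + \<tau>" for k by (simp add: algebra_simps)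
      have cont': "continuous_on {real k * \<tau>..real k * \<tau> + \<tau>} (\<lambda>t. b t \<omega>)" for k
        using \<tau> by (intro continuous_on_subset[OF cont]) auto
      have lim1: "(\<lambda>m. rsum \<tau> m k \<omega>) \<longlonglongrightarrow> integral {real k * \<tau>..real (Suc k) * \<tau>} (\<lambda>s. b s \<omega> - b (real k * \<tau>) \<omega>)" for k
      proof -
        have "continuous_on {real k * \<tau>..real k * \<tau> + \<tau>} (\<lambda>s. b s \<omega> - b (real k * \<tau>) \<omega>)"
          by (intro continuous_intros cont')
        from riemann_sum_tendsto[OF this less_imp_le[OF \<tau>]] show ?thesis
          unfolding rsum_def step real_scaleR_def .
      qed
      have lim2: "(\<lambda>m. rsum_sq \<tau> m k \<omega>) \<longlonglongrightarrow> integral {real k * \<tau>..real (Suc k) * \<tau>} (\<lambda>s. (b s \<omega> - b (real k * \<tau>) \<omega>)\<^sup>2)" for k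
      proof -
        have "continuous_on {real k * \<tau>..real k * \<tau> + \<tau>} (\<lambda>s. (b s \<omega> - b (real k * \<tau>) \<omega>)\<^sup>2)"
          by (intro continuous_intros cont')
        from riemann_sum_tendsto[OF this less_imp_le[OF \<tau>]] show ?thesis
          unfolding rsum_sq_def step real_scaleR_def .
      qed
      have fr: "\<exists>m\<ge>Suc m0. \<omega> \<notin> bad m" for m0
        using \<omega> unfolding Bad_def by auto
      \<comment> \<open>Unlike in the usual comparison of limits, the bound on \<open>u\<close> is
        known only for infinitely many m.\<close>
      have fr_le: "L \<le> c" if "u \<longlonglongrightarrow> L" "\<And>m. m > 0 \<Longrightarrow> \<omega> \<notin> bad m \<Longrightarrow> u m \<le> c" for u :: "nat \<Rightarrow> real" and L c
      proof (rule ccontr)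
        assume "\<not> L \<le> c"
        then have "eventually (\<lambda>m. u m > c) sequentially"
          using order_tendstoD(1)[OF that(1), of c] by auto
        then obtain m0 where "\<And>m. m \<ge> m0 \<Longrightarrow> u m > c" by (auto simp: eventually_sequentially)
        moreover obtain m where "m \<ge> Suc m0" "\<omega> \<notin> bad m" using fr by blast
        ultimately show False using that(2)[of m] by (auto simp: not_le[symmetric])
      qed
      have "\<bar>\<Sum>k<n. G k \<omega> * integral {real k * \<tau>..real (Suc k) * \<tau>} (\<lambda>s. b s \<omega> - b (real k * \<tau>) \<omega>)\<bar> \<le> A * \<tau>"
        if n: "n \<le> N" for n
      proof (rule fr_le)
        show "(\<lambda>m. \<bar>\<Sum>k<n. G k \<omega> * rsum \<tau> m k \<omega>\<bar>) \<longlonglongrightarrow>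
          \<bar>\<Sum>k<n. G k \<omega> * integral {real k * \<tau>..real (Suc k) * \<tau>} (\<lambda>s. b s \<omega> - b (real k * \<tau>) \<omega>)\<bar>"
          by (intro tendsto_intros lim1)
        fix m :: nat assume m: "m > 0" and "\<omega> \<notin> bad m"
        then have "\<not> (A * \<tau>)\<^sup>2 \<le> (S m \<omega>)\<^sup>2" using \<omega> by (auto simp: bad_def)
        then show "\<bar>\<Sum>k<n. G k \<omega> * rsum \<tau> m k \<omega>\<bar> \<le> A * \<tau>"
          using abs_weighted_sum_less[OF \<tau> m G1 G2 _ n, of "A * \<tau>" \<omega>] A \<tau> by (simp add: S_def)
      qed
      moreover have "(\<Sum>k<N. integral {real k * \<tau>..real (Suc k) * \<tau>} (\<lambda>s. (b s \<omega> - b (real k * \<tau>) \<omega>)\<^sup>2)) \<le> A * \<tau>"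
      proof (rule fr_le)
        show "(\<lambda>m. Q m \<omega>) \<longlonglongrightarrow> (\<Sum>k<N. integral {real k * \<tau>..real (Suc k) * \<tau>} (\<lambda>s. (b s \<omega> - b (real k * \<tau>) \<omega>)\<^sup>2))"
          unfolding Q_def by (intro tendsto_intros lim2)
        fix m :: nat assume "m > 0" "\<omega> \<notin> bad m"
        then show "Q m \<omega> \<le> A * \<tau>" using \<omega> by (auto simp: bad_def)
      qed
      ultimately show ?thesis by blast
    qed
    show "\<exists>Bad\<in>sets M. measure M Bad \<le> e \<and>
      (\<forall>\<omega>\<in>space M - Bad. continuous_on {0..} (\<lambda>t. b t \<omega>) \<longrightarrow>
        (\<forall>n\<le>nat \<lfloor>T / \<tau>\<rfloor>. \<bar>\<Sum>k<n. G k \<omega> * integral {real k * \<tau>..real (Suc k) * \<tau>} (\<lambda>s. b s \<omega> - b (real k * \<tau>) \<omega>)\<bar> \<le> A * \<tau>) \<and>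
        (\<Sum>k<nat \<lfloor>T / \<tau>\<rfloor>. integral {real k * \<tau>..real (Suc k) * \<tau>} (\<lambda>s. (b s \<omega> - b (real k * \<tau>) \<omega>)\<^sup>2)) \<le> A * \<tau>)"
      using Bad_sets Bad_small good unfolding N_def by blast
  qed
qed

end

section \<open>Pathwise error estimates\<close>

text \<open>Discrete Gronwall with a bootstrap. \<open>G\<close> is Lipschitz only on the ball of
  radius R + 1, and nothing is known about \<open>y\<close> beforehand. By strong induction the
  earlier errors are at most 1, which puts the earlier \<open>y k\<close> into this ball, and
  \<open>small\<close> keeps the next error below 1 again. The residuals enter through their partial
  sums only, so their cancellation is not lost.\<close>

lemma bootstrap_error_bound:
  fixes u y \<rho> :: "nat \<Rightarrow> 'a::real_normed_vector" and G :: "'a \<Rightarrow> 'a"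
  assumes step: "\<And>k. k < N \<Longrightarrow> u (Suc k) - y (Suc k) = u k - y k + \<tau> *\<^sub>R (G (u k) - G (y k)) + \<rho> k"
    and init: "y 0 = u 0"
    and \<rho>: "\<And>n. n \<le> N \<Longrightarrow> norm (\<Sum>k<n. \<rho> k) \<le> a"
    and R: "\<And>k. k \<le> N \<Longrightarrow> norm (u k) \<le> R"
    and lip: "\<And>x z. norm x \<le> R + 1 \<Longrightarrow> norm z \<le> R + 1 \<Longrightarrow> norm (G x - G z) \<le> L * norm (x - z)"
    and pos: "0 \<le> L" "0 \<le> \<tau>" and T: "real N * \<tau> \<le> T" and small: "a * exp (L * T) \<le> 1"
  shows "n \<le> N \<Longrightarrow> norm (u n - y n) \<le> a * exp (L * T)"
proof -
  have a: "0 \<le> a" using \<rho>[of 0] by simp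
  have pow: "a * (1 + L * \<tau>) ^ n \<le> a * exp (L * T)" if "n \<le> N" for n
  proof -
    have "(1 + L * \<tau>) ^ n \<le> exp (L * \<tau>) ^ n"
      using pos by (intro power_mono exp_ge_add_one_self) auto
    also have "\<dots> = exp (L * (real n * \<tau>))"
      by (simp add: exp_of_nat_mult[symmetric] mult_ac)
    also have "\<dots> \<le> exp (L * T)"
    proof -
      have "real n * \<tau> \<le> real N * \<tau>" using that pos by (intro mult_right_mono) auto
      then show ?thesis using T pos by (simp add: mult_left_mono)
    qed
    finally show ?thesis using a by (rule mult_left_mono)
  qed
  have *: "n \<le> N \<longrightarrow> norm (u n - y n) \<le> a * (1 + L * \<tau>) ^ n" for n
  proof (induction n rule: less_induct)
    case (less n)
    show ?case
    proof
      assume n: "n \<le> N"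
      have "u m - y m = (\<Sum>k<m. \<tau> *\<^sub>R (G (u k) - G (y k))) + (\<Sum>k<m. \<rho> k)" if "m \<le> n" for m
        using that
      proof (induction m)
        case (Suc m)
        then show ?case using step[of m] n by (simp add: algebra_simps)
      qed (simp add: init)
      from this[of n] have "norm (u n - y n) \<le> norm (\<Sum>k<n. \<tau> *\<^sub>R (G (u k) - G (y k))) + norm (\<Sum>k<n. \<rho> k)"
        by (simp add: norm_triangle_ineq)
      also have "\<dots> \<le> (\<Sum>k<n. L * \<tau> * (a * (1 + L * \<tau>) ^ k)) + a"
      proof (intro add_mono \<rho>[OF n] sum_norm_le)
        fix k assume "k \<in> {..<n}"
        then have k: "k < n" "k \<le> N" using n by auto
        then have e: "norm (u k - y k) \<le> a * (1 + L * \<tau>) ^ k" using less.IH by blast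
        also have "\<dots> \<le> 1" using pow[OF k(2)] small by linarith
        finally have "norm (y k) \<le> R + 1"
          using R[OF k(2)] norm_triangle_ineq2[of "y k" "u k"] by (simp add: norm_minus_commute)
        then have "norm (G (u k) - G (y k)) \<le> L * norm (u k - y k)"
          using R[OF k(2)] by (intro lip) auto
        also have "\<dots> \<le> L * (a * (1 + L * \<tau>) ^ k)" using e pos by (intro mult_left_mono) auto
        finally have "\<tau> * norm (G (u k) - G (y k)) \<le> \<tau> * (L * (a * (1 + L * \<tau>) ^ k))"
          using pos(2) by (rule mult_left_mono)
        then show "norm (\<tau> *\<^sub>R (G (u k) - G (y k))) \<le> L * \<tau> * (a * (1 + L * \<tau>) ^ k)"
          using pos by (simp add: mult_ac)
      qed
      \<comment> \<open>The geometric sum is exact: a plus the sum of L \<tau> a (1 + L \<tau>)^k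
        over k < n equals a (1 + L \<tau>)^n, so the induction closes without loss.\<close>
      also have "\<dots> = a * (1 + L * \<tau>) ^ n"
      proof (induction n)
        case (Suc n)
        then show ?case by (simp add: algebra_simps)
      qed simp
      finally show "norm (u n - y n) \<le> a * (1 + L * \<tau>) ^ n" .
    qed
  qed
  show "n \<le> N \<Longrightarrow> norm (u n - y n) \<le> a * exp (L * T)"
    using *[of n] pow[of n] by linarith
qed

text \<open>Taylor expansion of \<open>g\<close> at x(s). The increment of \<open>x\<close> is a
  drift part of size O(\<tau>) plus a noise part. Only the derivative applied to the noise part is
  too large to be estimated in one step; it stays in the statement, to be summed over the steps
  later.\<close>

lemma local_drift_error:
  fixes x w :: "real \<Rightarrow> 'a::euclidean_space" and g :: "'a \<Rightarrow> 'a" and D :: "'a \<Rightarrow> 'a \<Rightarrow> 'a"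
  assumes s: "0 \<le> \<tau>"
    and xc: "continuous_on {s..s + \<tau>} x" and wc: "continuous_on {s..s + \<tau>} w" and gc: "continuous_on UNIV g"
    and eq: "\<And>t. t \<in> {s..s + \<tau>} \<Longrightarrow> x t = x s + integral {s..t} (\<lambda>r. g (x r)) + (w t - w s)"
    and R: "\<And>t. t \<in> {s..s + \<tau>} \<Longrightarrow> norm (x t) \<le> R"
    and g: "\<And>v. norm v \<le> R \<Longrightarrow> norm (g v) \<le> c\<^sub>1"
    and Dl: "\<And>v. bounded_linear (D v)"
    and D: "\<And>v d. norm v \<le> R \<Longrightarrow> norm (D v d) \<le> c\<^sub>2 * norm d"
    and taylor: "\<And>v d. norm v \<le> R \<Longrightarrow> norm (v + d) \<le> R \<Longrightarrow> norm (g (v + d) - g v - D v d) \<le> c\<^sub>3 * (norm d)\<^sup>2"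
    and c: "0 \<le> c\<^sub>2" "0 \<le> c\<^sub>3"
  shows "norm (integral {s..s + \<tau>} (\<lambda>t. g (x t)) - \<tau> *\<^sub>R g (x s) - D (x s) (integral {s..s + \<tau>} (\<lambda>t. w t - w s)))
    \<le> (c\<^sub>2 * c\<^sub>1 + 2 * c\<^sub>3 * c\<^sub>1\<^sup>2 * \<tau>) * \<tau>\<^sup>2 + 2 * c\<^sub>3 * integral {s..s + \<tau>} (\<lambda>t. (norm (w t - w s))\<^sup>2)"
proof -
  have sin: "s \<in> {s..s + \<tau>}" using s by simp
  have gxc: "continuous_on {s..s + \<tau>} (\<lambda>t. g (x t))"
    using continuous_on_compose2[OF gc xc] by simp
  have Dc: "continuous_on A (\<lambda>t. D v (f t))" if "continuous_on A f" for A v and f :: "real \<Rightarrow> 'a"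
    using bounded_linear.continuous_on[OF Dl that] .
  have wdc: "continuous_on {s..s + \<tau>} (\<lambda>t. w t - w s)" by (intro continuous_intros wc)
  have Dint: "D (x s) (integral {s..s + \<tau>} (\<lambda>t. w t - w s)) = integral {s..s + \<tau>} (\<lambda>t. D (x s) (w t - w s))"
    using integral_linear[OF integrable_continuous_real[OF wdc] Dl[of "x s"]] by (simp add: o_def)
  have "integral {s..s + \<tau>} (\<lambda>t. g (x t)) - \<tau> *\<^sub>R g (x s) - D (x s) (integral {s..s + \<tau>} (\<lambda>t. w t - w s))
    = integral {s..s + \<tau>} (\<lambda>t. g (x t) - g (x s) - D (x s) (w t - w s))"
    unfolding Dint using s
    by (subst Henstock_Kurzweil_Integration.integral_diff, (intro integrable_continuous_real continuous_intros gxc Dc wc)+,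
        subst Henstock_Kurzweil_Integration.integral_diff, (intro integrable_continuous_real continuous_intros gxc)+) simp
  also have "norm \<dots> \<le> integral {s..s + \<tau>} (\<lambda>t. (c\<^sub>2 * c\<^sub>1 * \<tau> + 2 * c\<^sub>3 * c\<^sub>1\<^sup>2 * \<tau>\<^sup>2) + 2 * c\<^sub>3 * (norm (w t - w s))\<^sup>2)"
  proof (rule integral_norm_bound_integral)
    show "(\<lambda>t. g (x t) - g (x s) - D (x s) (w t - w s)) integrable_on {s..s + \<tau>}"
      by (intro integrable_continuous_real continuous_intros gxc Dc wc)
    show "(\<lambda>t. (c\<^sub>2 * c\<^sub>1 * \<tau> + 2 * c\<^sub>3 * c\<^sub>1\<^sup>2 * \<tau>\<^sup>2) + 2 * c\<^sub>3 * (norm (w t - w s))\<^sup>2) integrable_on {s..s + \<tau>}"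
      by (intro integrable_continuous_real continuous_intros wc)
    fix t assume t: "t \<in> {s..s + \<tau>}"
    define d where "d = x t - x s"
    define I where "I = integral {s..t} (\<lambda>r. g (x r))"
    have d: "d = I + (w t - w s)" using eq[OF t] by (simp add: d_def I_def)
    have "norm I \<le> c\<^sub>1 * (t - s)"
      unfolding I_def
    proof (rule integral_bound)
      show "continuous_on {s..t} (\<lambda>r. g (x r))"
        by (rule continuous_on_subset[OF gxc]) (use t in auto)
      fix r assume "r \<in> {s..t}"
      then show "norm (g (x r)) \<le> c\<^sub>1" using t by (intro g R) auto
    qed (use t in auto)
    also have "\<dots> \<le> c\<^sub>1 * \<tau>"
      using t order_trans[OF norm_ge_zero g[OF R[OF sin]]] by (intro mult_left_mono) auto
    finally have I: "norm I \<le> c\<^sub>1 * \<tau>" .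
    \<comment> \<open>(p + q)^2 \<le> 2 p^2 + 2 q^2 is the source of the factors 2 in the
      claim.\<close>
    have dsq: "(norm d)\<^sup>2 \<le> 2 * (c\<^sub>1 * \<tau>)\<^sup>2 + 2 * (norm (w t - w s))\<^sup>2"
    proof -
      have "norm d \<le> c\<^sub>1 * \<tau> + norm (w t - w s)"
        unfolding d using I norm_triangle_ineq[of I "w t - w s"] by linarith
      then have "(norm d)\<^sup>2 \<le> (c\<^sub>1 * \<tau> + norm (w t - w s))\<^sup>2" by (intro power_mono) auto
      also have "\<dots> \<le> 2 * (c\<^sub>1 * \<tau>)\<^sup>2 + 2 * (norm (w t - w s))\<^sup>2"
        using sum_squares_bound[of "c\<^sub>1 * \<tau>" "norm (w t - w s)"] by (simp add: power2_sum)
      finally show ?thesis .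
    qed
    interpret D: bounded_linear "D (x s)" by (rule Dl)
    \<comment> \<open>The derivative acts on the whole increment \<open>d\<close>; its noise part
      cancels and \<open>D (x s) I\<close> remains.\<close>
    have "g (x t) - g (x s) - D (x s) (w t - w s) = (g (x s + d) - g (x s) - D (x s) d) + D (x s) I"
    proof -
      have "x t = x s + d" "D (x s) d = D (x s) I + D (x s) (w t - w s)"
        by (simp_all add: d_def) (simp add: d_def[symmetric] d D.add)
      then show ?thesis by simp
    qed
    also have "norm \<dots> \<le> c\<^sub>3 * (norm d)\<^sup>2 + c\<^sub>2 * norm I"
      by (rule norm_triangle_le, intro add_mono taylor D R[OF sin]) (use R[OF t] in \<open>simp add: d_def\<close>)
    also have "\<dots> \<le> c\<^sub>3 * (2 * (c\<^sub>1 * \<tau>)\<^sup>2 + 2 * (norm (w t - w s))\<^sup>2) + c\<^sub>2 * (c\<^sub>1 * \<tau>)"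
      using c I dsq by (intro add_mono mult_left_mono) auto
    also have "\<dots> = (c\<^sub>2 * c\<^sub>1 * \<tau> + 2 * c\<^sub>3 * c\<^sub>1\<^sup>2 * \<tau>\<^sup>2) + 2 * c\<^sub>3 * (norm (w t - w s))\<^sup>2"
      by (simp add: algebra_simps power_mult_distrib)
    finally show "norm (g (x t) - g (x s) - D (x s) (w t - w s))
      \<le> (c\<^sub>2 * c\<^sub>1 * \<tau> + 2 * c\<^sub>3 * c\<^sub>1\<^sup>2 * \<tau>\<^sup>2) + 2 * c\<^sub>3 * (norm (w t - w s))\<^sup>2" .
  qed
  also have "\<dots> = (c\<^sub>2 * c\<^sub>1 * \<tau> + 2 * c\<^sub>3 * c\<^sub>1\<^sup>2 * \<tau>\<^sup>2) * \<tau> + 2 * c\<^sub>3 * integral {s..s + \<tau>} (\<lambda>t. (norm (w t - w s))\<^sup>2)"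
    using s by (subst Henstock_Kurzweil_Integration.integral_add)
      (auto intro!: integrable_continuous_real continuous_intros wc)
  also have "\<dots> = (c\<^sub>2 * c\<^sub>1 + 2 * c\<^sub>3 * c\<^sub>1\<^sup>2 * \<tau>) * \<tau>\<^sup>2 + 2 * c\<^sub>3 * integral {s..s + \<tau>} (\<lambda>t. (norm (w t - w s))\<^sup>2)"
    by (simp add: algebra_simps power2_eq_square)
  finally show ?thesis .
qed

text \<open>The summands of \<open>a\<close> are, in order, the linearised noise, the Taylor
  remainders together with the consistency error of \<open>G\<close>, the quadratic noise, and the
  effect of replacing noise increments by their images under \<open>V\<close>. The cap
  \<open>\<tau>\<^sub>m\<close> replaces \<tau> in \<open>a\<close>, which makes this constant
  independent of the step size.\<close>

lemma pathwise_error_bound: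
  fixes x w :: "real \<Rightarrow> 'a::euclidean_space" and g G V :: "'a \<Rightarrow> 'a" and D :: "'a \<Rightarrow> 'a \<Rightarrow> 'a" and y :: "nat \<Rightarrow> 'a"
  assumes \<tau>: "0 < \<tau>" "\<tau> \<le> \<tau>\<^sub>m" and NT: "real N * \<tau> \<le> T"
    and xc: "continuous_on {0..} x" and wc: "continuous_on {0..} w" and gc: "continuous_on UNIV g"
    and eq: "\<And>t. 0 \<le> t \<Longrightarrow> x t = x 0 + integral {0..t} (\<lambda>r. g (x r)) + w t"
    and xR: "\<And>t. t \<in> {0..T} \<Longrightarrow> norm (x t) \<le> R" and wR: "\<And>t. t \<in> {0..T} \<Longrightarrow> norm (w t) \<le> R"
    and g: "\<And>v. norm v \<le> R \<Longrightarrow> norm (g v) \<le> c\<^sub>1"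
    and Dl: "\<And>v. bounded_linear (D v)"
    and D: "\<And>v d. norm v \<le> R \<Longrightarrow> norm (D v d) \<le> c\<^sub>2 * norm d"
    and taylor: "\<And>v d. norm v \<le> R \<Longrightarrow> norm (v + d) \<le> R \<Longrightarrow> norm (g (v + d) - g v - D v d) \<le> c\<^sub>3 * (norm d)\<^sup>2"
    and consistent: "\<And>v. norm v \<le> R \<Longrightarrow> norm (G v - g v) \<le> c\<^sub>4 * \<tau>"
    and Vl: "linear V" and V: "\<And>v. norm (V v - v) \<le> c\<^sub>5 * \<tau> * norm v"
    and lip: "\<And>v u. norm v \<le> R + 1 \<Longrightarrow> norm u \<le> R + 1 \<Longrightarrow> norm (G v - G u) \<le> L * norm (v - u)"
    and c: "0 \<le> c\<^sub>2" "0 \<le> c\<^sub>3" "0 \<le> c\<^sub>5" "0 \<le> L"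
    and y0: "y 0 = x 0"
    and y: "\<And>n. y (Suc n) = y n + \<tau> *\<^sub>R G (y n) + V (w (real (Suc n) * \<tau>) - w (real n * \<tau>))"
    and A1: "\<And>n. n \<le> N \<Longrightarrow> norm (\<Sum>k<n. D (x (real k * \<tau>)) (integral {real k * \<tau>..real (Suc k) * \<tau>} (\<lambda>t. w t - w (real k * \<tau>)))) \<le> A\<^sub>1 * \<tau>"
    and A2: "(\<Sum>k<N. integral {real k * \<tau>..real (Suc k) * \<tau>} (\<lambda>t. (norm (w t - w (real k * \<tau>)))\<^sup>2)) \<le> A\<^sub>2 * \<tau>"
    and a: "a = A\<^sub>1 + (c\<^sub>2 * c\<^sub>1 + 2 * c\<^sub>3 * c\<^sub>1\<^sup>2 * \<tau>\<^sub>m + c\<^sub>4) * T + 2 * c\<^sub>3 * A\<^sub>2 + 2 * c\<^sub>5 * R"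
    and small: "a * \<tau> * exp (L * T) \<le> 1"
    and n: "n \<le> N"
  shows "norm (x (real n * \<tau>) - y n) \<le> a * \<tau> * exp (L * T)"
proof -
  define t where "t k = real k * \<tau>" for k
  have t_Suc: "t (Suc k) = t k + \<tau>" and t0: "0 \<le> t k" for k using \<tau> by (auto simp: t_def algebra_simps)
  have tT: "t k \<le> T" if "k \<le> N" for k
  proof -
    have "t k \<le> real N * \<tau>" unfolding t_def using that \<tau> by (intro mult_right_mono) auto
    then show ?thesis using NT by simp
  qed
  have "0 \<le> T" using NT \<tau> mult_nonneg_nonneg[of "real N" \<tau>] by linarith
  then have R0: "0 \<le> R" and c1: "0 \<le> c\<^sub>1" and c4: "0 \<le> c\<^sub>4"
    using order_trans[OF norm_ge_zero xR[of 0]] order_trans[OF norm_ge_zero g[OF xR[of 0]]]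
      order_trans[OF norm_ge_zero consistent[OF xR[of 0]]] \<tau> by (auto simp: zero_le_mult_iff)
  have gxc: "continuous_on {0..} (\<lambda>r. g (x r))"
    using continuous_on_compose2[OF gc xc] by simp
  have incr: "x r = x s + integral {s..r} (\<lambda>r. g (x r)) + (w r - w s)" if "0 \<le> s" "s \<le> r" for s r
  proof -
    have "(\<lambda>r. g (x r)) integrable_on {0..r}"
      by (intro integrable_continuous_real continuous_on_subset[OF gxc]) auto
    then have "integral {0..r} (\<lambda>r. g (x r)) = integral {0..s} (\<lambda>r. g (x r)) + integral {s..r} (\<lambda>r. g (x r))"
      using Henstock_Kurzweil_Integration.integral_combine[OF that] by metis
    then show ?thesis using eq[of s] eq[of r] that by simp
  qed
  define I where "I k = integral {t k..t (Suc k)} (\<lambda>r. g (x r))" for k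
  define W where "W k = integral {t k..t (Suc k)} (\<lambda>r. w r - w (t k))" for k
  define q where "q k = integral {t k..t (Suc k)} (\<lambda>r. (norm (w r - w (t k)))\<^sup>2)" for k
  define \<delta> where "\<delta> k = w (t (Suc k)) - w (t k)" for k
  define \<rho>\<^sub>1 where "\<rho>\<^sub>1 k = I k - \<tau> *\<^sub>R g (x (t k)) - D (x (t k)) (W k)" for k
  define \<rho> where "\<rho> k = I k - \<tau> *\<^sub>R G (x (t k)) + (\<delta> k - V (\<delta> k))" for k
  have loc: "norm (\<rho>\<^sub>1 k) \<le> (c\<^sub>2 * c\<^sub>1 + 2 * c\<^sub>3 * c\<^sub>1\<^sup>2 * \<tau>\<^sub>m) * \<tau>\<^sup>2 + 2 * c\<^sub>3 * q k" if k: "k < N" for k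
  proof -
    have sub: "{t k..t k + \<tau>} \<subseteq> {0..T}" using tT[of "Suc k"] k t0[of k] by (auto simp: t_Suc)
    have "norm (\<rho>\<^sub>1 k) \<le> (c\<^sub>2 * c\<^sub>1 + 2 * c\<^sub>3 * c\<^sub>1\<^sup>2 * \<tau>) * \<tau>\<^sup>2 + 2 * c\<^sub>3 * q k"
      unfolding \<rho>\<^sub>1_def I_def W_def q_def t_Suc
    proof (rule local_drift_error[OF _ _ _ gc _ _ g Dl D taylor c(1) c(2)])
      show "continuous_on {t k..t k + \<tau>} x" "continuous_on {t k..t k + \<tau>} w"
        using sub by (auto intro: continuous_on_subset[OF xc] continuous_on_subset[OF wc])
      show "x s = x (t k) + integral {t k..s} (\<lambda>r. g (x r)) + (w s - w (t k))" if "s \<in> {t k..t k + \<tau>}" for s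
        using that by (intro incr t0) simp
      show "\<And>s. s \<in> {t k..t k + \<tau>} \<Longrightarrow> norm (x s) \<le> R" using xR sub by blast
    qed (use \<tau> in auto)
    also have "\<dots> \<le> (c\<^sub>2 * c\<^sub>1 + 2 * c\<^sub>3 * c\<^sub>1\<^sup>2 * \<tau>\<^sub>m) * \<tau>\<^sup>2 + 2 * c\<^sub>3 * q k"
      using \<tau> c by (intro add_mono mult_right_mono mult_left_mono order_refl) auto
    finally show ?thesis .
  qed
  have \<rho>: "norm (\<Sum>k<m. \<rho> k) \<le> a * \<tau>" if m: "m \<le> N" for m
  proof -
    have mT: "real m * \<tau> \<le> T" using tT[OF m] by (simp add: t_def)
    have V_add: "V (u + v) = V u + V v" "V (u - v) = V u - V v" for u v
      using Vl by (auto simp: linear_add linear_diff)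
    \<comment> \<open>Linearity of \<open>V\<close> collapses the terms
      \<open>\<delta> k - V (\<delta> k)\<close> to the two ends, where |w| \<le> R and
      \<open>V\<close> is within O(\<tau>) of the identity. Estimated one by one they would only
      give order one half.\<close>
    have "(\<Sum>k<m. \<rho> k) = (\<Sum>k<m. \<rho>\<^sub>1 k) + (\<Sum>k<m. D (x (t k)) (W k)) + (\<Sum>k<m. \<tau> *\<^sub>R (g (x (t k)) - G (x (t k))))
       + ((w (t m) - V (w (t m))) - (w (t 0) - V (w (t 0))))"
      by (induction m) (simp_all add: \<rho>_def \<rho>\<^sub>1_def \<delta>_def V_add algebra_simps)
    also have "norm \<dots> \<le> (norm (\<Sum>k<m. \<rho>\<^sub>1 k) + norm (\<Sum>k<m. D (x (t k)) (W k)) + norm (\<Sum>k<m. \<tau> *\<^sub>R (g (x (t k)) - G (x (t k)))))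
       + (norm (w (t m) - V (w (t m))) + norm (w (t 0) - V (w (t 0))))"
      by (intro order_trans[OF norm_triangle_ineq] add_mono order_refl norm_triangle_ineq4 norm_triangle_ineq)
    also have "\<dots> \<le> ((\<Sum>k<m. norm (\<rho>\<^sub>1 k)) + A\<^sub>1 * \<tau> + (\<Sum>k<m. c\<^sub>4 * \<tau>\<^sup>2)) + (c\<^sub>5 * \<tau> * R + c\<^sub>5 * \<tau> * R)"
    proof (intro add_mono)
      show "norm (sum \<rho>\<^sub>1 {..<m}) \<le> (\<Sum>k<m. norm (\<rho>\<^sub>1 k))" by (rule norm_sum)
      show "norm (\<Sum>k<m. D (x (t k)) (W k)) \<le> A\<^sub>1 * \<tau>"
        using A1[OF m] by (simp add: t_def W_def)
      show "norm (\<Sum>k<m. \<tau> *\<^sub>R (g (x (t k)) - G (x (t k)))) \<le> (\<Sum>k<m. c\<^sub>4 * \<tau>\<^sup>2)"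
      proof (rule sum_norm_le)
        fix k assume "k \<in> {..<m}"
        then have "norm (G (x (t k)) - g (x (t k))) \<le> c\<^sub>4 * \<tau>"
          using m t0[of k] tT[of k] by (intro consistent xR) auto
        then show "norm (\<tau> *\<^sub>R (g (x (t k)) - G (x (t k)))) \<le> c\<^sub>4 * \<tau>\<^sup>2"
          using \<tau> by (simp add: norm_minus_commute power2_eq_square mult_left_mono mult_ac)
      qed
      have "norm (w (t k) - V (w (t k))) \<le> c\<^sub>5 * \<tau> * R" if "k \<le> N" for k
      proof -
        have "norm (w (t k)) \<le> R" using tT[OF that] t0[of k] by (intro wR) auto
        then have "c\<^sub>5 * \<tau> * norm (w (t k)) \<le> c\<^sub>5 * \<tau> * R" using c \<tau> by (intro mult_left_mono) auto
        then show ?thesis using V[of "w (t k)"] by (simp add: norm_minus_commute)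
      qed
      then show "norm (w (t m) - V (w (t m))) \<le> c\<^sub>5 * \<tau> * R" "norm (w (t 0) - V (w (t 0))) \<le> c\<^sub>5 * \<tau> * R"
        using m by auto
    qed
    also have "(\<Sum>k<m. norm (\<rho>\<^sub>1 k)) \<le> (\<Sum>k<m. (c\<^sub>2 * c\<^sub>1 + 2 * c\<^sub>3 * c\<^sub>1\<^sup>2 * \<tau>\<^sub>m) * \<tau>\<^sup>2 + 2 * c\<^sub>3 * q k)"
      using m by (intro sum_mono loc) auto
    also have "\<dots> = real m * \<tau> * ((c\<^sub>2 * c\<^sub>1 + 2 * c\<^sub>3 * c\<^sub>1\<^sup>2 * \<tau>\<^sub>m) * \<tau>) + 2 * c\<^sub>3 * (\<Sum>k<m. q k)"
      by (simp add: sum.distrib sum_distrib_left power2_eq_square)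
    also have "\<dots> \<le> T * ((c\<^sub>2 * c\<^sub>1 + 2 * c\<^sub>3 * c\<^sub>1\<^sup>2 * \<tau>\<^sub>m) * \<tau>) + 2 * c\<^sub>3 * (A\<^sub>2 * \<tau>)"
    proof (intro add_mono mult_right_mono mult_left_mono mT)
      have "(\<Sum>k<m. q k) \<le> (\<Sum>k<N. q k)"
      proof (rule sum_mono2)
        fix k assume "k \<in> {..<N} - {..<m}"
        have "continuous_on {t k..t (Suc k)} w"
          by (rule continuous_on_subset[OF wc]) (use t0[of k] in auto)
        then show "0 \<le> q k" unfolding q_def
          by (intro Henstock_Kurzweil_Integration.integral_nonneg integrable_continuous_real continuous_intros) auto
      qed (use m in auto)
      also have "\<dots> \<le> A\<^sub>2 * \<tau>" using A2 by (simp add: q_def t_def)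
      finally show "(\<Sum>k<m. q k) \<le> A\<^sub>2 * \<tau>" .
    qed (use c c1 \<tau> in auto)
    also have "(\<Sum>k<m. c\<^sub>4 * \<tau>\<^sup>2) = real m * \<tau> * (c\<^sub>4 * \<tau>)" by (simp add: power2_eq_square)
    also have "\<dots> \<le> T * (c\<^sub>4 * \<tau>)" using mT c4 \<tau> by (intro mult_right_mono) auto
    finally show ?thesis by (simp add: a algebra_simps)
  qed
  have "norm (x (t n) - y n) \<le> a * \<tau> * exp (L * T)"
  proof (rule bootstrap_error_bound[where N=N and G=G and R=R and \<tau>=\<tau> and \<rho>=\<rho> and u="\<lambda>k. x (t k)"])
    fix k assume "k < N"
    have "x (t (Suc k)) = x (t k) + I k + \<delta> k"
      using incr[of "t k" "t (Suc k)"] t0[of k] \<tau> by (auto simp: I_def \<delta>_def t_Suc)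
    then show "x (t (Suc k)) - y (Suc k) = x (t k) - y k + \<tau> *\<^sub>R (G (x (t k)) - G (y k)) + \<rho> k"
      unfolding y \<rho>_def \<delta>_def t_def[symmetric] by (simp add: algebra_simps)
  next
    show "\<And>k. k \<le> N \<Longrightarrow> norm (x (t k)) \<le> R" using t0 tT by (intro xR) auto
  qed (use y0 \<rho> lip c \<tau> NT small n t_def in auto)
  then show ?thesis by (simp add: t_def)
qed

section \<open>The scheme and its consistency\<close>

text \<open>Mean value inequality on the closed left half-plane, which is convex and on which the
  derivative of exp has modulus at most 1.\<close>

lemma norm_exp_diff_le:
  fixes a b :: complex
  assumes "Re a \<le> 0" "Re b \<le> 0"
  shows "norm (exp a - exp b) \<le> norm (a - b)"
proof -
  have "norm (exp a - exp b) \<le> 1 * norm (a - b)"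
  proof (rule field_differentiable_bound[where S="{z. Re z \<le> 0}" and f'=exp])
    show "convex {z. Re z \<le> 0}" by (rule convex_halfspace_Re_le)
  qed (use assms in \<open>auto intro!: derivative_eq_intros\<close>)
  then show ?thesis by simp
qed

text \<open>The derivative of exp z - z is exp z - 1, which on the segment from 0 to a is at most
  |a| by \<open>norm_exp_diff_le\<close>.\<close>

lemma norm_exp_taylor_le:
  fixes a :: complex
  assumes "Re a \<le> 0"
  shows "norm (exp a - 1 - a) \<le> (norm a)\<^sup>2"
proof -
  have sub: "Re w \<le> 0" "norm w \<le> norm a" if "w \<in> closed_segment 0 a" for w
    using that assms by (auto simp: closed_segment_def mult_nonneg_nonpos mult_left_le_one_le)
  have "norm ((exp a - a) - (exp 0 - 0)) \<le> norm a * norm (a - 0)"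
  proof (rule field_differentiable_bound[where S="closed_segment 0 a" and f'="\<lambda>z. exp z - 1"])
    fix w assume w: "w \<in> closed_segment 0 a"
    show "norm (exp w - 1) \<le> norm a"
      using norm_exp_diff_le[of w 0] sub[OF w] by simp
  qed (auto intro!: derivative_eq_intros)
  then show ?thesis by (simp add: power2_eq_square algebra_simps)
qed

lemma norm_vec_le_scaled:
  fixes x :: "'a::real_normed_vector^'n" and y :: "'b::real_normed_vector^'n"
  assumes "\<And>j. norm (x $ j) \<le> c * norm (y $ j)" "0 \<le> c"
  shows "norm x \<le> c * norm y"
proof -
  have "norm x \<le> L2_set (\<lambda>j. c * norm (y $ j)) UNIV"
    unfolding norm_vec_def by (intro L2_set_mono assms) auto
  also have "\<dots> = c * norm y"
    unfolding norm_vec_def using assms by (simp add: L2_set_right_distrib)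
  finally show ?thesis .
qed

lemma cscale_mult_vec: "(c *\<^sub>C A) *v x = c *s (A *v x)"
  by (simp add: cscale_def matrix_vector_mult_def vec_eq_iff sum_distrib_left mult_ac)

lemma diag_mult_vec: "diag_mat d *v x = (\<chi> j. d j * x $ j)"
  by (simp add: diag_mat_def matrix_vector_mult_def vec_eq_iff if_distrib[where f="\<lambda>a. a * _"] sum.delta cong: if_cong)

lemma linear_matrix_vec: "linear (\<lambda>x. (A::complex^'n^'m) *v x)"
  by (rule linearI) (simp add: matrix_vector_right_distrib, simp add: matrix_vector_mult_def vec_eq_iff scaleR_sum_right)

text \<open>Since the exponent in the scheme is diagonal, this reduces the matrix exponential to
  scalar ones. Convergence of the series is checked entry by entry.\<close>

lemma mat_exp_diag: "mat_exp (diag_mat d) = diag_mat (\<lambda>j. exp (d j))"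
proof -
  have pow: "((\<lambda>X. diag_mat d ** X) ^^ m) (mat 1) = diag_mat (\<lambda>j. d j ^ m)" for m
  proof (induction m)
    case 0
    then show ?case by (simp add: diag_mat_def mat_def)
  next
    case (Suc m)
    then show ?case
      by (simp add: diag_mat_def matrix_matrix_mult_def vec_eq_iff if_distrib[where f="\<lambda>a. a * _"] sum.delta cong: if_cong)
  qed
  have "(\<lambda>m. (1 / fact m) *\<^sub>R diag_mat (\<lambda>j. d j ^ m)) sums diag_mat (\<lambda>j. exp (d j))"
    unfolding sums_def
  proof (intro vec_tendstoI)
    fix i j
    have "(\<lambda>m. \<Sum>k<m. (1 / fact k) *\<^sub>R (d i ^ k)) \<longlonglongrightarrow> exp (d i)"
      using exp_converges[of "d i"] by (simp add: sums_def divide_inverse)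
    then show "(\<lambda>m. (\<Sum>k<m. (1 / fact k) *\<^sub>R diag_mat (\<lambda>j. d j ^ k)) $ i $ j) \<longlonglongrightarrow> diag_mat (\<lambda>j. exp (d j)) $ i $ j"
      by (cases "i = j") (simp_all add: diag_mat_def)
  qed
  then show ?thesis unfolding mat_exp_def pow by (simp add: sums_iff)
qed

text \<open>The Laplacian matrix is symmetric and real, so multiplication by \<open>\<i>\<close> makes it skew-adjoint.\<close>

lemma inner_i_laplace: "(\<i> *s (laplace_mat *v x)) \<bullet> x = 0"
proof -
  \<comment> \<open>The inner product is the real one, so the claim concerns the real part of a
    Hermitian form. Exchanging j and k conjugates \<open>x $ k * cnj (x $ j)\<close> while the real
    symmetric coefficient stays, and the factor \<i> turns this into a change of sign.\<close>
  define T where "T j k = Re (\<i> * (laplace_mat $ j $ k :: complex) * x $ k * cnj (x $ j))" for j k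
  have anti: "T k j = - T j k" for j k
    by (simp add: T_def laplace_mat_def algebra_simps)
  have "(\<i> *s (laplace_mat *v x)) \<bullet> x = (\<Sum>j\<in>UNIV. \<Sum>k\<in>UNIV. T j k)"
    by (simp add: T_def inner_vec_def inner_complex_def matrix_vector_mult_def sum_distrib_left sum_distrib_right
        sum.distrib sum_negf sum_subtractf algebra_simps)
  moreover have "(\<Sum>j\<in>UNIV. \<Sum>k\<in>UNIV. T j k) = (\<Sum>k\<in>UNIV. \<Sum>j\<in>UNIV. T j k)" by (rule sum.swap)
  moreover have "(\<Sum>k\<in>UNIV. \<Sum>j\<in>UNIV. T j k) = - (\<Sum>k\<in>UNIV. \<Sum>j\<in>UNIV. T k j)"
    unfolding sum_negf[symmetric] using anti by (intro sum.cong refl) (metis minus_minus)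
  ultimately show ?thesis by linarith
qed

section \<open>The substeps of the scheme and their stability\<close>

locale damped_scheme =
  fixes h \<alpha> lam :: real
  assumes \<alpha>: "0 \<le> \<alpha>" and lam: "\<bar>lam\<bar> = 1"
begin

text \<open>The matrix \<open>left_matrix h \<tau> \<alpha>\<close> is \<open>I + \<tau> Z\<close>, \<open>right_matrix h \<tau> \<alpha>\<close> is \<open>I - \<tau> Z\<close>, and the
  linear part of the drift is \<open>- 2 Z\<close> up to the damping \<open>- \<alpha> / 2\<close> carried by \<open>\<phi>\<close>.\<close>

definition Z :: "complex^'j::{finite,linorder}^'j::{finite,linorder}" where
  "Z = complex_of_real (\<alpha> / 4) *\<^sub>C mat 1 - (\<i> * complex_of_real (1 / (2 * h\<^sup>2))) *\<^sub>C laplace_mat"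

lemma Z_mult: "Z *v x = complex_of_real (\<alpha> / 4) *s x - (\<i> * complex_of_real (1 / (2 * h\<^sup>2))) *s (laplace_mat *v x)"
  by (simp add: Z_def matrix_vector_mult_diff_rdistrib cscale_mult_vec)

lemma left_mult: "left_matrix h \<tau> \<alpha> *v x = x + \<tau> *\<^sub>R (Z *v x)"
  unfolding left_matrix_def Z_mult matrix_vector_mult_diff_rdistrib matrix_vector_mult_add_rdistrib
    cscale_mult_vec matrix_vector_mul_lid
  by (simp add: vec_eq_iff scaleR_conv_of_real[where 'a=complex] algebra_simps)

lemma right_mult: "right_matrix h \<tau> \<alpha> *v x = x - \<tau> *\<^sub>R (Z *v x)"
  unfolding right_matrix_def Z_mult matrix_vector_mult_diff_rdistrib matrix_vector_mult_add_rdistrib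
    cscale_mult_vec matrix_vector_mul_lid
  by (simp add: vec_eq_iff scaleR_conv_of_real[where 'a=complex] algebra_simps)

text \<open>The damping contributes a nonnegative multiple of |x|^2, and the skew-adjoint part drops
  out.\<close>

lemma Z_inner: "0 \<le> (Z *v x) \<bullet> x"
proof -
  have "Z *v x = (\<alpha> / 4) *\<^sub>R x - (1 / (2 * h\<^sup>2)) *\<^sub>R (\<i> *s (laplace_mat *v x))"
    unfolding Z_mult by (simp add: vec_eq_iff scaleR_conv_of_real[where 'a=complex])
  then show ?thesis
    using \<alpha> by (simp add: inner_diff_left inner_i_laplace)
qed

text \<open>Test I + \<tau> Z with x and use \<open>Z_inner\<close>. This makes the implicit step
  solvable and its inverse nonexpansive for every \<tau> \<ge> 0.\<close>

lemma norm_left_mult: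
  assumes "0 \<le> \<tau>"
  shows "norm x \<le> norm (left_matrix h \<tau> \<alpha> *v x)"
proof (cases "x = 0")
  case False
  have "norm x * norm x = x \<bullet> x" by (simp add: norm_eq_sqrt_inner)
  also have "\<dots> \<le> (left_matrix h \<tau> \<alpha> *v x) \<bullet> x"
    using assms Z_inner[of x] by (simp add: left_mult inner_add_left)
  also have "\<dots> \<le> norm (left_matrix h \<tau> \<alpha> *v x) * norm x" by (rule norm_cauchy_schwarz)
  finally show ?thesis using False by simp
qed simp

lemma left_matrix_inverse:
  fixes x :: "complex^'j::{finite,linorder}"
  assumes "0 \<le> \<tau>"
  shows "left_matrix h \<tau> \<alpha> *v (matrix_inv (left_matrix h \<tau> \<alpha>) *v x) = x"
    and "matrix_inv (left_matrix h \<tau> \<alpha>) *v (left_matrix h \<tau> \<alpha> *v x) = x"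
proof -
  let ?L = "left_matrix h \<tau> \<alpha> :: complex^'j::{finite,linorder}^'j::{finite,linorder}"
  have "inj ((*v) ?L)"
  proof (rule injI)
    fix u v :: "complex^'j::{finite,linorder}" assume "?L *v u = ?L *v v"
    then have "?L *v (u - v) = 0" by (simp add: matrix_vector_mult_diff_distrib)
    then show "u = v" using norm_left_mult[OF assms, of "u - v"] by simp
  qed
  then have "\<exists>A'. ?L ** A' = mat 1 \<and> A' ** ?L = mat 1"
    using matrix_left_invertible_injective[of ?L] invertible_left_inverse[of ?L] by (auto simp: invertible_def)
  then have "?L ** matrix_inv ?L = mat 1 \<and> matrix_inv ?L ** ?L = mat 1"
    unfolding matrix_inv_def by (rule someI_ex)
  then show "?L *v (matrix_inv ?L *v x) = x" "matrix_inv ?L *v (?L *v x) = x"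
    by (simp_all add: matrix_vector_mul_assoc)
qed

definition V :: "real \<Rightarrow> complex^'j::{finite,linorder} \<Rightarrow> complex^'j::{finite,linorder}" where
  "V \<tau> x = matrix_inv (left_matrix h \<tau> \<alpha>) *v x"

lemma linear_V: "linear (V \<tau>)"
  unfolding V_def by (rule linear_matrix_vec)

lemma norm_V: "0 \<le> \<tau> \<Longrightarrow> norm (V \<tau> x) \<le> norm x"
  using norm_left_mult[of \<tau> "V \<tau> x"] by (simp add: V_def left_matrix_inverse)

text \<open>The resolvent identity, valid for every \<tau> \<ge> 0, unlike a Neumann series.\<close>

lemma V_diff: "0 \<le> \<tau> \<Longrightarrow> V \<tau> x - x = - (\<tau> *\<^sub>R (Z *v V \<tau> x))"
  using left_mult[of \<tau> "V \<tau> x"] by (simp add: V_def left_matrix_inverse algebra_simps)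

lemma V_right_mult: "0 \<le> \<tau> \<Longrightarrow> V \<tau> (right_matrix h \<tau> \<alpha> *v x) = 2 *\<^sub>R V \<tau> x - x"
proof -
  assume "0 \<le> \<tau>"
  have "right_matrix h \<tau> \<alpha> *v x = 2 *\<^sub>R x - left_matrix h \<tau> \<alpha> *v x"
    by (simp add: left_mult right_mult scaleR_2)
  then have "V \<tau> (right_matrix h \<tau> \<alpha> *v x) = 2 *\<^sub>R V \<tau> x - V \<tau> (left_matrix h \<tau> \<alpha> *v x)"
    by (simp add: linear_diff[OF linear_V] linear_cmul[OF linear_V])
  then show ?thesis using left_matrix_inverse(2)[OF \<open>0 \<le> \<tau>\<close>, of x] by (simp add: V_def)
qed

text \<open>The product of the inverse of \<open>I + \<tau> Z\<close> with \<open>I - \<tau> Z = 2 I - (I + \<tau> Z)\<close>.\<close>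

definition S :: "real \<Rightarrow> complex^'j::{finite,linorder} \<Rightarrow> complex^'j::{finite,linorder}" where
  "S \<tau> x = 2 *\<^sub>R V \<tau> x - x"

lemma S_diff: "S \<tau> (x - y) = S \<tau> x - S \<tau> y"
  by (simp add: S_def linear_diff[OF linear_V] scaleR_diff_right)

text \<open>The crude factor 2 + 1 suffices, since the bound enters only where the number of steps
  is bounded.\<close>

lemma norm_S: "0 \<le> \<tau> \<Longrightarrow> norm (S \<tau> x) \<le> 3 * norm x"
  using norm_triangle_ineq4[of "2 *\<^sub>R V \<tau> x" x] norm_V[of \<tau> x] by (simp add: S_def)

text \<open>\<tau> times this is the diagonal entry of \<open>f_mat\<close> at a component z; the
  sign of its real part makes the exponential substep nonexpansive.\<close>

definition \<phi> :: "complex \<Rightarrow> complex" where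
  "\<phi> z = Complex (- \<alpha> / 2) (lam * (cmod z)\<^sup>2)"

definition nl :: "complex^'j::{finite,linorder} \<Rightarrow> complex^'j::{finite,linorder}" where
  "nl v = (\<chi> j. \<phi> (v $ j) * v $ j)"

definition E :: "real \<Rightarrow> complex^'j::{finite,linorder} \<Rightarrow> complex^'j::{finite,linorder}" where
  "E \<tau> v = (\<chi> j. exp (of_real \<tau> * \<phi> (v $ j)) * v $ j)"

text \<open>With this increment function the scheme reads y + \<tau> G(y) plus noise, an Euler-type
  step, and consistency means that \<open>G\<close> is within O(\<tau>) of the drift.\<close>

definition G :: "real \<Rightarrow> complex^'j::{finite,linorder} \<Rightarrow> complex^'j::{finite,linorder}" where
  "G \<tau> v = (1 / \<tau>) *\<^sub>R (S \<tau> (E \<tau> v) - v)"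

text \<open>The derivative of the drift at \<open>v\<close>; it is only real linear because of \<open>|v\<^sub>j|\<^sup>2\<close>.\<close>

definition D :: "complex^'j::{finite,linorder} \<Rightarrow> complex^'j::{finite,linorder} \<Rightarrow> complex^'j::{finite,linorder}" where
  "D v d = (\<chi> j. \<phi> (v $ j) * d $ j + \<i> * of_real (lam * (2 * (v $ j \<bullet> d $ j))) * v $ j) - 2 *\<^sub>R (Z *v d)"

lemma drift_eq: "drift h \<alpha> lam v = nl v - 2 *\<^sub>R (Z *v v)"
  unfolding drift_def nl_def Z_mult F_mat_def diag_mult_vec
  by (simp add: vec_eq_iff \<phi>_def scaleR_conv_of_real[where 'a=complex] complex_eq_iff algebra_simps)

lemma mat_exp_f_mat: "mat_exp (f_mat \<tau> \<alpha> lam v) *v v = E \<tau> v"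
proof -
  have "f_mat \<tau> \<alpha> lam v = diag_mat (\<lambda>j. of_real \<tau> * \<phi> (v $ j))"
    by (simp add: f_mat_def F_mat_def cscale_def diag_mat_def mat_def vec_eq_iff \<phi>_def complex_eq_iff)
  then show ?thesis by (simp add: mat_exp_diag diag_mult_vec E_def)
qed

lemma scheme_Suc:
  fixes \<beta> :: "real \<Rightarrow> 'w \<Rightarrow> complex^'p::{finite,linorder}" and X :: "'w \<Rightarrow> complex^'j::{finite,linorder}"
    and \<epsilon> :: real and \<eta> \<omega>
  assumes "0 < \<tau>"
  defines "y \<equiv> \<lambda>n. scheme h \<tau> \<alpha> lam \<epsilon> \<eta> \<beta> X n \<omega>"
    and "w \<equiv> \<lambda>t. \<epsilon> *\<^sub>R ((sigma_mat h ** Lambda_mat \<eta>) *v \<beta> t \<omega>)"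
  shows "y (Suc n) = S \<tau> (E \<tau> (y n)) + V \<tau> (w (real (Suc n) * \<tau>) - w (real n * \<tau>))"
proof -
  have "(matrix_inv (left_matrix h \<tau> \<alpha>) ** right_matrix h \<tau> \<alpha> ** mat_exp (f_mat \<tau> \<alpha> lam (y n))) *v y n
      = V \<tau> (right_matrix h \<tau> \<alpha> *v (mat_exp (f_mat \<tau> \<alpha> lam (y n)) *v y n))"
    by (simp add: V_def matrix_vector_mul_assoc matrix_mul_assoc)
  also have "\<dots> = S \<tau> (E \<tau> (y n))"
    using assms(1) by (simp add: mat_exp_f_mat V_right_mult S_def)
  finally have 1: "(matrix_inv (left_matrix h \<tau> \<alpha>) ** right_matrix h \<tau> \<alpha> ** mat_exp (f_mat \<tau> \<alpha> lam (y n))) *v y n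
    = S \<tau> (E \<tau> (y n))" .
  have 2: "\<epsilon> *\<^sub>R ((matrix_inv (left_matrix h \<tau> \<alpha>) ** sigma_mat h ** Lambda_mat \<eta>) *v (\<beta> t \<omega> - \<beta> s \<omega>)) = V \<tau> (w t - w s)" for s t
    unfolding w_def scaleR_diff_right[symmetric] matrix_vector_mult_diff_distrib[symmetric] linear_cmul[OF linear_V]
    by (simp only: V_def matrix_vector_mul_assoc matrix_mul_assoc)
  show "y (Suc n) = S \<tau> (E \<tau> (y n)) + V \<tau> (w (real (Suc n) * \<tau>) - w (real n * \<tau>))"
    using 1 unfolding y_def by (simp only: scheme.simps 2)
qed

lemma Re_\<phi>: "Re (\<phi> z) \<le> 0"
  using \<alpha> by (simp add: \<phi>_def)

lemma norm_\<phi>: "norm z \<le> r \<Longrightarrow> norm (\<phi> z) \<le> \<alpha> / 2 + r\<^sup>2"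
proof -
  assume "norm z \<le> r"
  then have "(cmod z)\<^sup>2 \<le> r\<^sup>2" by (intro power_mono) auto
  then show ?thesis
    using cmod_le[of "\<phi> z"] \<alpha> lam by (simp add: \<phi>_def abs_mult)
qed

text \<open>Only the imaginary parts differ, and the difference of squares factors.\<close>

lemma norm_\<phi>_diff:
  assumes "norm z \<le> r" "norm w \<le> r"
  shows "norm (\<phi> z - \<phi> w) \<le> 2 * r * norm (z - w)"
proof -
  have "\<phi> z - \<phi> w = \<i> * of_real (lam * ((cmod z)\<^sup>2 - (cmod w)\<^sup>2))"
    by (simp add: \<phi>_def complex_eq_iff algebra_simps)
  then have "norm (\<phi> z - \<phi> w) = \<bar>(cmod z)\<^sup>2 - (cmod w)\<^sup>2\<bar>"
    using lam by (simp add: norm_mult abs_mult del: of_real_mult of_real_diff)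
  also have "(cmod z)\<^sup>2 - (cmod w)\<^sup>2 = (cmod z + cmod w) * (cmod z - cmod w)"
    by (simp add: power2_eq_square algebra_simps)
  also have "\<bar>\<dots>\<bar> = (cmod z + cmod w) * \<bar>cmod z - cmod w\<bar>" by (simp add: abs_mult)
  also have "\<dots> \<le> (2 * r) * norm (z - w)"
    using assms norm_triangle_ineq3[of z w] order_trans[OF norm_ge_zero assms(1)] by (intro mult_mono) auto
  finally show ?thesis .
qed

lemma norm_E: "0 \<le> \<tau> \<Longrightarrow> norm (E \<tau> v) \<le> norm v"
proof -
  assume "0 \<le> \<tau>"
  then have "norm (E \<tau> v) \<le> 1 * norm v"
    using Re_\<phi> by (intro norm_vec_le_scaled) (auto simp: E_def norm_mult intro!: mult_left_le_one_le mult_nonneg_nonpos)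
  then show ?thesis by simp
qed

lemma Re_scaled: "0 \<le> \<tau> \<Longrightarrow> Re (of_real \<tau> * \<phi> z) \<le> 0"
  using Re_\<phi>[of z] by (simp add: mult_nonneg_nonpos)

lemma E_minus_id:
  assumes "0 \<le> \<tau>" "norm v \<le> r"
  shows "norm (E \<tau> v - v) \<le> \<tau> * (\<alpha> / 2 + r\<^sup>2) * norm v"
proof (rule norm_vec_le_scaled)
  fix j
  have "(E \<tau> v - v) $ j = (exp (of_real \<tau> * \<phi> (v $ j)) - exp 0) * v $ j"
    by (simp add: E_def algebra_simps)
  also have "norm \<dots> \<le> norm (of_real \<tau> * \<phi> (v $ j) - 0) * norm (v $ j)"
    unfolding norm_mult using Re_scaled[OF assms(1), of "v $ j"] by (intro mult_right_mono norm_exp_diff_le) auto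
  also have "\<dots> \<le> (\<tau> * (\<alpha> / 2 + r\<^sup>2)) * norm (v $ j)"
    using assms norm_\<phi>[of "v $ j" r] order_trans[OF Finite_Cartesian_Product.norm_nth_le[of v j] assms(2)]
    by (intro mult_right_mono) (auto simp: norm_mult intro!: mult_left_mono)
  finally show "norm ((E \<tau> v - v) $ j) \<le> \<tau> * (\<alpha> / 2 + r\<^sup>2) * norm (v $ j)" .
qed (use assms \<alpha> in auto)

text \<open>\<open>G\<close> divides by \<tau>, so the identity is subtracted first: what remains of
  \<open>E\<close> has a Lipschitz constant proportional to \<tau>. The difference of products is
  split as (exp a - 1)(v - u) + (exp a - exp b) u.\<close>

lemma E_minus_id_lipschitz:
  assumes "0 \<le> \<tau>" "norm v \<le> r" "norm u \<le> r"
  shows "norm ((E \<tau> v - v) - (E \<tau> u - u)) \<le> \<tau> * (\<alpha> / 2 + r\<^sup>2 + 2 * r * r) * norm (v - u)"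
proof (rule norm_vec_le_scaled)
  fix j
  let ?a = "of_real \<tau> * \<phi> (v $ j)" and ?b = "of_real \<tau> * \<phi> (u $ j)"
  have b: "norm (v $ j) \<le> r" "norm (u $ j) \<le> r"
    using order_trans[OF Finite_Cartesian_Product.norm_nth_le] assms by blast+
  have "((E \<tau> v - v) - (E \<tau> u - u)) $ j = (exp ?a - exp 0) * (v $ j - u $ j) + (exp ?a - exp ?b) * u $ j"
    by (simp add: E_def algebra_simps)
  also have "norm \<dots> \<le> norm (?a - 0) * norm (v $ j - u $ j) + norm (?a - ?b) * norm (u $ j)"
    by (intro order_trans[OF norm_triangle_ineq] add_mono; unfold norm_mult[of "exp _ - _"];
        intro mult_right_mono norm_exp_diff_le Re_scaled assms norm_ge_zero) simp
  also have "\<dots> \<le> \<tau> * (\<alpha> / 2 + r\<^sup>2) * norm (v $ j - u $ j) + \<tau> * (2 * r * norm (v $ j - u $ j)) * r"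
  proof (intro add_mono mult_mono)
    show "norm (?a - 0) \<le> \<tau> * (\<alpha> / 2 + r\<^sup>2)"
      using assms norm_\<phi>[OF b(1)] by (simp add: norm_mult mult_left_mono)
    have "?a - ?b = of_real \<tau> * (\<phi> (v $ j) - \<phi> (u $ j))" by (simp add: algebra_simps)
    then show "norm (?a - ?b) \<le> \<tau> * (2 * r * norm (v $ j - u $ j))"
      using assms norm_\<phi>_diff[OF b] by (simp only: norm_mult norm_of_real) (simp add: mult_left_mono)
    have "0 \<le> r" using order_trans[OF norm_ge_zero b(1)] .
    then show "0 \<le> \<tau> * (\<alpha> / 2 + r\<^sup>2)" "0 \<le> \<tau> * (2 * r * norm (v $ j - u $ j))" using assms \<alpha> by auto
  qed (use b in auto)
  also have "\<dots> = \<tau> * (\<alpha> / 2 + r\<^sup>2 + 2 * r * r) * norm ((v - u) $ j)" by (simp add: algebra_simps)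
  finally show "norm (((E \<tau> v - v) - (E \<tau> u - u)) $ j) \<le> \<tau> * (\<alpha> / 2 + r\<^sup>2 + 2 * r * r) * norm ((v - u) $ j)" .
qed (use assms \<alpha> in auto)

lemma E_taylor:
  assumes "0 \<le> \<tau>" "norm v \<le> r"
  shows "norm (E \<tau> v - v - \<tau> *\<^sub>R nl v) \<le> (\<tau> * (\<alpha> / 2 + r\<^sup>2))\<^sup>2 * norm v"
proof (rule norm_vec_le_scaled)
  fix j
  let ?a = "of_real \<tau> * \<phi> (v $ j)"
  have "(E \<tau> v - v - \<tau> *\<^sub>R nl v) $ j = (exp ?a - 1 - ?a) * v $ j"
    by (simp add: E_def nl_def scaleR_conv_of_real[where 'a=complex] algebra_simps)
  also have "norm \<dots> \<le> (norm ?a)\<^sup>2 * norm (v $ j)"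
    unfolding norm_mult[of "exp _ - _ - _"] using Re_scaled[OF assms(1), of "v $ j"] by (intro mult_right_mono norm_exp_taylor_le) auto
  also have "\<dots> \<le> (\<tau> * (\<alpha> / 2 + r\<^sup>2))\<^sup>2 * norm (v $ j)"
    using assms norm_\<phi>[of "v $ j" r] order_trans[OF Finite_Cartesian_Product.norm_nth_le[of v j] assms(2)]
    by (intro mult_right_mono power_mono) (auto simp: norm_mult intro!: mult_left_mono)
  finally show "norm ((E \<tau> v - v - \<tau> *\<^sub>R nl v) $ j) \<le> (\<tau> * (\<alpha> / 2 + r\<^sup>2))\<^sup>2 * norm (v $ j)" .
qed simp

lemma norm_nl: "norm v \<le> r \<Longrightarrow> norm (nl v) \<le> (\<alpha> / 2 + r\<^sup>2) * norm v"
  using \<alpha> by (intro norm_vec_le_scaled)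
    (auto simp: nl_def norm_mult intro!: mult_right_mono norm_\<phi> order_trans[OF Finite_Cartesian_Product.norm_nth_le])

lemma continuous_drift: "continuous_on UNIV (drift h \<alpha> lam)"
proof -
  have "continuous_on UNIV (\<lambda>v. nl v - 2 *\<^sub>R (Z *v v))"
    unfolding nl_def \<phi>_def Complex_eq
    by (intro continuous_intros linear_continuous_on linear_conv_bounded_linear[THEN iffD1] linear_matrix_vec)
  then show ?thesis by (simp add: drift_eq[abs_def])
qed

text \<open>It makes the weights formed from \<open>D\<close> along the solution measurable.\<close>

lemma continuous_D: "continuous_on UNIV (\<lambda>v. D v d)"
  unfolding D_def \<phi>_def Complex_eq by (intro continuous_intros)

lemma bounded_linear_D: "bounded_linear (D v)"
proof -
  have scale: "a \<bullet> (of_real r * b) = r * (a \<bullet> b)" for a b :: complex and r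
    by (simp add: inner_complex_def algebra_simps)
  have "linear (D v)"
    by (rule linearI) (simp_all add: D_def linear_add[OF linear_matrix_vec] linear_cmul[OF linear_matrix_vec] vec_eq_iff
        inner_add_right scale scaleR_conv_of_real[where 'a=complex] algebra_simps)
  then show ?thesis by (simp add: linear_conv_bounded_linear)
qed

text \<open>The drift is a cubic polynomial in the real coordinates, so the remainder is explicit,
  and the part from \<open>Z\<close> cancels. The cubic term is grouped with a quadratic one as
  |d|^2 (v + d), so that the bound on v + d absorbs it.\<close>

lemma drift_taylor:
  assumes "norm v \<le> r" "norm (v + d) \<le> r"
  shows "norm (drift h \<alpha> lam (v + d) - drift h \<alpha> lam v - D v d) \<le> 3 * r * (norm d)\<^sup>2"
proof -
  define \<rho> where "\<rho> = drift h \<alpha> lam (v + d) - drift h \<alpha> lam v - D v d"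
  have comp: "norm (\<rho> $ j) \<le> 3 * r * (norm (d $ j))\<^sup>2" for j
  proof -
    have sq: "(cmod (v $ j + d $ j))\<^sup>2 = (cmod (v $ j))\<^sup>2 + 2 * (v $ j \<bullet> d $ j) + (cmod (d $ j))\<^sup>2"
      by (simp add: power2_norm_eq_inner inner_add_left inner_add_right inner_commute)
    have phi: "\<phi> (v $ j + d $ j) = \<phi> (v $ j) + \<i> * of_real (lam * (2 * (v $ j \<bullet> d $ j) + (cmod (d $ j))\<^sup>2))"
      unfolding \<phi>_def sq by (simp add: complex_eq_iff algebra_simps)
    have "\<rho> $ j = \<i> * of_real lam * (of_real (2 * (v $ j \<bullet> d $ j)) * d $ j + of_real ((cmod (d $ j))\<^sup>2) * (v $ j + d $ j))"
      unfolding \<rho>_def drift_eq nl_def D_def linear_add[OF linear_matrix_vec]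
        vector_minus_component vector_add_component vec_lambda_beta phi scaleR_right_distrib
      by (simp add: algebra_simps)
    also have "norm \<dots> = norm (of_real (2 * (v $ j \<bullet> d $ j)) * d $ j + of_real ((cmod (d $ j))\<^sup>2) * (v $ j + d $ j))"
      using lam by (simp add: norm_mult)
    also have "\<dots> \<le> 2 * r * norm (d $ j) * norm (d $ j) + (norm (d $ j))\<^sup>2 * r"
    proof (intro order_trans[OF norm_triangle_ineq] add_mono)
      have "\<bar>v $ j \<bullet> d $ j\<bar> \<le> norm (v $ j) * norm (d $ j)" by (rule Cauchy_Schwarz_ineq2)
      also have "\<dots> \<le> r * norm (d $ j)"
        using order_trans[OF Finite_Cartesian_Product.norm_nth_le assms(1)] by (intro mult_right_mono) auto
      finally have "2 * \<bar>v $ j \<bullet> d $ j\<bar> \<le> 2 * r * norm (d $ j)" by simp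
      then show "norm (of_real (2 * (v $ j \<bullet> d $ j)) * d $ j) \<le> 2 * r * norm (d $ j) * norm (d $ j)"
        unfolding norm_mult norm_of_real by (intro mult_right_mono) (auto simp: abs_mult)
      show "norm (of_real ((cmod (d $ j))\<^sup>2) * (v $ j + d $ j)) \<le> (norm (d $ j))\<^sup>2 * r"
        unfolding norm_mult norm_of_real using order_trans[OF Finite_Cartesian_Product.norm_nth_le[of "v + d" j] assms(2)]
        by (intro mult_mono) auto
    qed
    finally show ?thesis by (simp add: power2_eq_square algebra_simps)
  qed
  \<comment> \<open>The componentwise bound is quadratic in \<open>d\<close>, so
    \<open>norm_vec_le_scaled\<close> does not apply; summing over the components yields |d|^2
    exactly.\<close>
  have "norm \<rho> \<le> (\<Sum>j\<in>UNIV. norm (\<rho> $ j))"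
    unfolding norm_vec_def by (rule L2_set_le_sum) simp
  also have "\<dots> \<le> (\<Sum>j\<in>UNIV. 3 * r * (norm (d $ j))\<^sup>2)" by (intro sum_mono comp)
  also have "\<dots> = 3 * r * (norm d)\<^sup>2"
    by (simp add: norm_vec_def L2_set_def sum_nonneg sum_distrib_left)
  finally show ?thesis by (simp add: \<rho>_def)
qed

section \<open>Consistency and Lipschitz estimates in terms of an operator bound for
  \<open>Z\<close>\<close>

context
  fixes z :: real
  assumes z: "0 \<le> z" "\<And>x :: complex^'j::{finite,linorder}. norm (Z *v x) \<le> z * norm x"
begin

lemma V_minus_id:
  fixes x :: "complex^'j::{finite,linorder}"
  assumes "0 \<le> \<tau>"
  shows "norm (V \<tau> x - x) \<le> z * \<tau> * norm x"
proof -
  have "norm (Z *v V \<tau> x) \<le> z * norm x"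
    using order_trans[OF z(2) mult_left_mono[OF norm_V[OF assms] z(1)]] .
  then show ?thesis using assms by (simp add: V_diff mult_left_mono mult_ac)
qed

lemma S_minus_id:
  fixes x :: "complex^'j::{finite,linorder}"
  assumes "0 \<le> \<tau>"
  shows "norm (S \<tau> x - x) \<le> 2 * z * \<tau> * norm x"
proof -
  have "S \<tau> x - x = 2 *\<^sub>R (V \<tau> x - x)" by (simp add: S_def algebra_simps scaleR_2)
  then show ?thesis using V_minus_id[OF assms, of x] by simp
qed

text \<open>The resolvent identity leaves - 2 \<tau> Z (V - I) x, and V - I supplies the second
  power of \<tau>.\<close>

lemma S_taylor:
  fixes x :: "complex^'j::{finite,linorder}"
  assumes "0 \<le> \<tau>"
  shows "norm (S \<tau> x - x + (2 * \<tau>) *\<^sub>R (Z *v x)) \<le> 2 * z\<^sup>2 * \<tau>\<^sup>2 * norm x"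
proof -
  have "S \<tau> x - x + (2 * \<tau>) *\<^sub>R (Z *v x) = 2 *\<^sub>R (V \<tau> x - x) + (2 * \<tau>) *\<^sub>R (Z *v x)"
    by (simp add: S_def algebra_simps scaleR_2)
  also have "\<dots> = - ((2 * \<tau>) *\<^sub>R (Z *v (V \<tau> x - x)))"
    by (subst V_diff[OF assms]) (simp add: matrix_vector_mult_diff_distrib algebra_simps)
  also have "norm \<dots> = 2 * \<tau> * norm (Z *v (V \<tau> x - x))" using assms by simp
  also have "\<dots> \<le> 2 * \<tau> * (z * (z * \<tau> * norm x))"
    using assms by (intro mult_left_mono order_trans[OF z(2)] V_minus_id z) auto
  finally show ?thesis by (simp add: power2_eq_square mult_ac)
qed

text \<open>\<tau> (G v - G u) consists of S - I applied to E v - E u and of the difference of E - I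
  at v and u; each carries a factor \<tau>, which cancels.\<close>

lemma G_lipschitz:
  fixes u v :: "complex^'j::{finite,linorder}"
  assumes \<tau>: "0 < \<tau>" "\<tau> \<le> \<tau>\<^sub>m" and r: "norm v \<le> r" "norm u \<le> r"
    and p: "p = \<alpha> / 2 + r\<^sup>2 + 2 * r * r"
  shows "norm (G \<tau> v - G \<tau> u) \<le> (2 * z * (1 + \<tau>\<^sub>m * p) + p) * norm (v - u)"
proof -
  have r0: "0 \<le> r" using order_trans[OF norm_ge_zero r(1)] .
  have p0: "0 \<le> p" unfolding p using \<alpha> r0 by auto
  have E1: "norm ((E \<tau> v - v) - (E \<tau> u - u)) \<le> \<tau> * p * norm (v - u)"
    unfolding p using E_minus_id_lipschitz[of \<tau> v r u] \<tau> r by simp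
  have "E \<tau> v - E \<tau> u = (v - u) + ((E \<tau> v - v) - (E \<tau> u - u))" by simp
  also have "norm \<dots> \<le> norm (v - u) + \<tau> * p * norm (v - u)"
    using norm_triangle_ineq[of "v - u" "(E \<tau> v - v) - (E \<tau> u - u)"] E1 by linarith
  also have "\<dots> \<le> (1 + \<tau>\<^sub>m * p) * norm (v - u)"
    using \<tau> p0 by (simp add: distrib_right mult_right_mono)
  finally have E2: "norm (E \<tau> v - E \<tau> u) \<le> (1 + \<tau>\<^sub>m * p) * norm (v - u)" .
  have "\<tau> *\<^sub>R (G \<tau> v - G \<tau> u) = (S \<tau> (E \<tau> v - E \<tau> u) - (E \<tau> v - E \<tau> u)) + ((E \<tau> v - v) - (E \<tau> u - u))"
    using \<tau> by (simp add: G_def S_diff algebra_simps)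
  then have "\<tau> * norm (G \<tau> v - G \<tau> u) = norm ((S \<tau> (E \<tau> v - E \<tau> u) - (E \<tau> v - E \<tau> u)) + ((E \<tau> v - v) - (E \<tau> u - u)))"
    using \<tau> by (metis abs_of_pos norm_scaleR)
  also have "\<dots> \<le> 2 * z * \<tau> * norm (E \<tau> v - E \<tau> u) + \<tau> * p * norm (v - u)"
    using \<tau> by (intro order_trans[OF norm_triangle_ineq] add_mono E1 S_minus_id) auto
  also have "\<dots> \<le> 2 * z * \<tau> * ((1 + \<tau>\<^sub>m * p) * norm (v - u)) + \<tau> * p * norm (v - u)"
    using \<tau> z p0 by (intro add_mono mult_left_mono E2) auto
  also have "\<dots> = \<tau> * ((2 * z * (1 + \<tau>\<^sub>m * p) + p) * norm (v - u))" by (simp add: algebra_simps)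
  finally show ?thesis using \<tau> by simp
qed

text \<open>Before division by \<tau> there are three errors of order \<tau>^2: the interaction (S -
  I)(E - I) v of the substeps, the rational approximation of the linear part, and the exponential
  with frozen coefficient. They give 2 z p, 2 z^2 and p^2.\<close>

lemma G_consistent:
  fixes v :: "complex^'j::{finite,linorder}"
  assumes \<tau>: "0 < \<tau>" and r: "norm v \<le> r" and p: "p = \<alpha> / 2 + r\<^sup>2"
  shows "norm (G \<tau> v - drift h \<alpha> lam v) \<le> (2 * z * p + 2 * z\<^sup>2 + p\<^sup>2) * r * \<tau>"
proof -
  have r0: "0 \<le> r" using order_trans[OF norm_ge_zero r(1)] .
  have p0: "0 \<le> p" unfolding p using \<alpha> by auto
  have "\<tau> *\<^sub>R (G \<tau> v - drift h \<alpha> lam v) =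
      (S \<tau> (E \<tau> v - v) - (E \<tau> v - v)) + (S \<tau> v - v + (2 * \<tau>) *\<^sub>R (Z *v v)) + (E \<tau> v - v - \<tau> *\<^sub>R nl v)"
    using \<tau> by (simp add: G_def S_diff drift_eq algebra_simps)
  then have "\<tau> * norm (G \<tau> v - drift h \<alpha> lam v) = norm
      ((S \<tau> (E \<tau> v - v) - (E \<tau> v - v)) + (S \<tau> v - v + (2 * \<tau>) *\<^sub>R (Z *v v)) + (E \<tau> v - v - \<tau> *\<^sub>R nl v))"
    using \<tau> by (metis abs_of_pos norm_scaleR)
  also have "\<dots> \<le> 2 * z * \<tau> * norm (E \<tau> v - v) + 2 * z\<^sup>2 * \<tau>\<^sup>2 * norm v + (\<tau> * p)\<^sup>2 * norm v"
    unfolding p using \<tau> r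
    by (intro order_trans[OF norm_triangle_ineq] add_mono S_minus_id S_taylor E_taylor) auto
  also have "\<dots> \<le> 2 * z * \<tau> * (\<tau> * p * r) + 2 * z\<^sup>2 * \<tau>\<^sup>2 * r + (\<tau> * p)\<^sup>2 * r"
  proof (intro add_mono mult_left_mono r)
    have "norm (E \<tau> v - v) \<le> \<tau> * p * norm v" unfolding p using E_minus_id[of \<tau> v r] \<tau> r by simp
    also have "\<dots> \<le> \<tau> * p * r" using r \<tau> p0 by (intro mult_left_mono) auto
    finally show "norm (E \<tau> v - v) \<le> \<tau> * p * r" .
  qed (use z \<tau> in auto)
  also have "\<dots> = \<tau> * ((2 * z * p + 2 * z\<^sup>2 + p\<^sup>2) * r * \<tau>)" by (simp add: algebra_simps power2_eq_square)
  finally show ?thesis using \<tau> by simp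
qed

lemma norm_drift:
  fixes v :: "complex^'j::{finite,linorder}"
  assumes r: "norm v \<le> r"
  shows "norm (drift h \<alpha> lam v) \<le> (\<alpha> / 2 + r\<^sup>2 + 2 * z) * r"
proof -
  have r0: "0 \<le> r" using order_trans[OF norm_ge_zero r(1)] .
  have "norm (drift h \<alpha> lam v) \<le> norm (nl v) + 2 * norm (Z *v v)"
    unfolding drift_eq using norm_triangle_ineq4[of "nl v" "2 *\<^sub>R (Z *v v)"] by simp
  also have "\<dots> \<le> (\<alpha> / 2 + r\<^sup>2) * norm v + 2 * (z * norm v)"
    by (intro add_mono norm_nl r mult_left_mono z) auto
  also have "\<dots> = (\<alpha> / 2 + r\<^sup>2 + 2 * z) * norm v" by (simp add: algebra_simps)
  also have "\<dots> \<le> (\<alpha> / 2 + r\<^sup>2 + 2 * z) * r" using r z \<alpha> by (intro mult_left_mono) auto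
  finally show ?thesis .
qed

text \<open>The summand 2 r^2 comes from differentiating |v_j|^2.\<close>

lemma norm_D:
  fixes v d :: "complex^'j::{finite,linorder}"
  assumes r: "norm v \<le> r"
  shows "norm (D v d) \<le> (\<alpha> / 2 + r\<^sup>2 + 2 * r\<^sup>2 + 2 * z) * norm d"
proof -
  have r0: "0 \<le> r" using order_trans[OF norm_ge_zero r(1)] .
  define q where "q = (\<chi> j. \<phi> (v $ j) * d $ j + \<i> * of_real (lam * (2 * (v $ j \<bullet> d $ j))) * v $ j)"
  have "norm q \<le> (\<alpha> / 2 + r\<^sup>2 + 2 * r\<^sup>2) * norm d"
  proof (rule norm_vec_le_scaled)
    fix j
    have vj: "norm (v $ j) \<le> r" using order_trans[OF Finite_Cartesian_Product.norm_nth_le r] .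
    have "\<bar>v $ j \<bullet> d $ j\<bar> \<le> r * norm (d $ j)"
      using order_trans[OF Cauchy_Schwarz_ineq2 mult_right_mono[OF vj]] by auto
    then have i: "\<bar>lam * (2 * (v $ j \<bullet> d $ j))\<bar> \<le> 2 * r * norm (d $ j)"
      using lam by (simp add: abs_mult)
    have "norm (q $ j) \<le> (\<alpha> / 2 + r\<^sup>2) * norm (d $ j) + 2 * r * norm (d $ j) * r"
      unfolding q_def vec_lambda_beta
    proof (intro order_trans[OF norm_triangle_ineq] add_mono)
      show "norm (\<phi> (v $ j) * d $ j) \<le> (\<alpha> / 2 + r\<^sup>2) * norm (d $ j)"
        unfolding norm_mult by (intro mult_right_mono norm_\<phi> vj) auto
      show "norm (\<i> * of_real (lam * (2 * (v $ j \<bullet> d $ j))) * v $ j) \<le> 2 * r * norm (d $ j) * r"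
        unfolding norm_mult norm_of_real norm_ii mult_1 using i vj r0 by (intro mult_mono) auto
    qed
    then show "norm (q $ j) \<le> (\<alpha> / 2 + r\<^sup>2 + 2 * r\<^sup>2) * norm (d $ j)"
      by (simp add: power2_eq_square algebra_simps)
  qed (use \<alpha> in auto)
  moreover have "norm (D v d) \<le> norm q + 2 * norm (Z *v d)"
    unfolding D_def q_def[symmetric] using norm_triangle_ineq4[of q "2 *\<^sub>R (Z *v d)"] by simp
  moreover have "norm (Z *v d) \<le> z * norm d" by (rule z)
  ultimately show ?thesis by (simp add: algebra_simps)
qed

end

lemma Z_bounded: "\<exists>z\<ge>0. \<forall>x :: complex^'j::{finite,linorder}. norm (Z *v x) \<le> z * norm x"
proof -
  have "bounded_linear (\<lambda>x :: complex^'j::{finite,linorder}. Z *v x)"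
    using linear_matrix_vec linear_conv_bounded_linear by blast
  then show ?thesis
    using onorm onorm_pos_le by blast
qed

end

text \<open>Reduction of the vector noise to its scalar components. The linear sums are tested
  against every basis vector, which leaves one scalar weight per pair; in the quadratic ones
  Cauchy-Schwarz over the components disposes of the mixed products.\<close>

lemma noise_sums:
  fixes e :: "'i \<Rightarrow> 'a::euclidean_space" and B :: "'i \<Rightarrow> real \<Rightarrow> real" and D :: "nat \<Rightarrow> 'a \<Rightarrow> 'a"
  assumes I: "finite I" and \<tau>: "0 < \<tau>"
    and cont: "\<And>p. p \<in> I \<Longrightarrow> continuous_on {0..} (B p)"
    and Dl: "\<And>k. bounded_linear (D k)"
    and lin: "\<And>p u n. p \<in> I \<Longrightarrow> u \<in> Basis \<Longrightarrow> n \<le> N \<Longrightarrow>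
      \<bar>\<Sum>k<n. (D k (e p) \<bullet> u) * integral {real k * \<tau>..real (Suc k) * \<tau>} (\<lambda>s. B p s - B p (real k * \<tau>))\<bar> \<le> A * \<tau>"
    and quad: "\<And>p. p \<in> I \<Longrightarrow>
      (\<Sum>k<N. integral {real k * \<tau>..real (Suc k) * \<tau>} (\<lambda>s. (B p s - B p (real k * \<tau>))\<^sup>2)) \<le> A * \<tau>"
    and w: "w = (\<lambda>t. \<Sum>p\<in>I. B p t *\<^sub>R e p)"
  shows "n \<le> N \<Longrightarrow> norm (\<Sum>k<n. D k (integral {real k * \<tau>..real (Suc k) * \<tau>} (\<lambda>t. w t - w (real k * \<tau>))))
      \<le> (real DIM('a) * real (card I) * A) * \<tau>"
    and "(\<Sum>k<N. integral {real k * \<tau>..real (Suc k) * \<tau>} (\<lambda>t. (norm (w t - w (real k * \<tau>)))\<^sup>2))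
      \<le> ((\<Sum>p\<in>I. (norm (e p))\<^sup>2) * (real (card I) * A)) * \<tau>"
proof -
  define J where "J k = {real k * \<tau>..real (Suc k) * \<tau>}" for k
  define b where "b p k = integral (J k) (\<lambda>s. B p s - B p (real k * \<tau>))" for p k
  define q where "q p k = integral (J k) (\<lambda>s. (B p s - B p (real k * \<tau>))\<^sup>2)" for p k
  have contJ: "continuous_on (J k) (B p)" if "p \<in> I" for p k
    by (rule continuous_on_subset[OF cont[OF that]]) (use \<tau> in \<open>auto simp: J_def intro: order_trans[of _ "real k * \<tau>"]\<close>)
  have wd: "w t - w s = (\<Sum>p\<in>I. (B p t - B p s) *\<^sub>R e p)" for s t
    by (simp add: w sum_subtractf scaleR_left_diff_distrib)
  have wint: "integral (J k) (\<lambda>t. w t - w (real k * \<tau>)) = (\<Sum>p\<in>I. b p k *\<^sub>R e p)" for k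
  proof -
    have int: "(\<lambda>s. B p s - B p (real k * \<tau>)) integrable_on J k" if "p \<in> I" for p
      unfolding J_def by (intro integrable_continuous_real continuous_intros contJ[OF that, of k, unfolded J_def])
    have "integral (J k) (\<lambda>t. (B p t - B p (real k * \<tau>)) *\<^sub>R e p) = b p k *\<^sub>R e p"
      and "(\<lambda>t. (B p t - B p (real k * \<tau>)) *\<^sub>R e p) integrable_on J k" if "p \<in> I" for p
      using integral_linear[OF int[OF that] bounded_linear_scaleR_left[of "e p"]]
        integrable_linear[OF int[OF that] bounded_linear_scaleR_left[of "e p"]] by (auto simp: b_def o_def)
    then show ?thesis unfolding wd using I by (simp add: Henstock_Kurzweil_Integration.integral_sum)
  qed
  show "norm (\<Sum>k<n. D k (integral {real k * \<tau>..real (Suc k) * \<tau>} (\<lambda>t. w t - w (real k * \<tau>))))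
      \<le> (real DIM('a) * real (card I) * A) * \<tau>" if n: "n \<le> N"
  proof -
    have "D k (\<Sum>p\<in>I. b p k *\<^sub>R e p) = (\<Sum>p\<in>I. b p k *\<^sub>R D k (e p))" for k
      using Dl[THEN bounded_linear.linear, of k] by (simp add: linear_sum linear_cmul)
    then have eq: "(\<Sum>k<n. D k (integral (J k) (\<lambda>t. w t - w (real k * \<tau>)))) = (\<Sum>k<n. \<Sum>p\<in>I. b p k *\<^sub>R D k (e p))"
      by (simp add: wint)
    define v where "v = (\<Sum>k<n. \<Sum>p\<in>I. b p k *\<^sub>R D k (e p))"
    have "norm v \<le> (\<Sum>u\<in>Basis. \<bar>v \<bullet> u\<bar>)" by (rule norm_le_l1)
    also have "\<dots> \<le> (\<Sum>u\<in>(Basis::'a set). real (card I) * (A * \<tau>))"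
    proof (rule sum_mono)
      fix u :: 'a assume u: "u \<in> Basis"
      have "v \<bullet> u = (\<Sum>p\<in>I. \<Sum>k<n. (D k (e p) \<bullet> u) * b p k)"
        unfolding v_def by (subst sum.swap) (simp add: inner_sum_left mult.commute)
      also have "\<bar>\<dots>\<bar> \<le> (\<Sum>p\<in>I. A * \<tau>)"
        using lin[OF _ u n] by (intro order_trans[OF sum_abs[where A=I]] sum_mono) (simp add: b_def J_def)
      finally show "\<bar>v \<bullet> u\<bar> \<le> real (card I) * (A * \<tau>)" by simp
    qed
    also have "\<dots> = (real DIM('a) * real (card I) * A) * \<tau>" by simp
    finally show ?thesis using eq by (simp add: v_def J_def)
  qed
  have "(\<Sum>k<N. integral (J k) (\<lambda>t. (norm (w t - w (real k * \<tau>)))\<^sup>2)) \<le> (\<Sum>k<N. (\<Sum>p\<in>I. (norm (e p))\<^sup>2) * (\<Sum>p\<in>I. q p k))"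
  proof (rule sum_mono)
    fix k
    have int: "(\<lambda>s. (B p s - B p (real k * \<tau>))\<^sup>2) integrable_on J k" if "p \<in> I" for p
      unfolding J_def by (intro integrable_continuous_real continuous_intros contJ[OF that, of k, unfolded J_def])
    have "integral (J k) (\<lambda>t. (norm (w t - w (real k * \<tau>)))\<^sup>2)
        \<le> integral (J k) (\<lambda>t. (\<Sum>p\<in>I. (norm (e p))\<^sup>2) * (\<Sum>p\<in>I. (B p t - B p (real k * \<tau>))\<^sup>2))"
    proof (rule integral_le)
      have "continuous_on (J k) w" unfolding w by (intro continuous_intros contJ)
      then show "(\<lambda>t. (norm (w t - w (real k * \<tau>)))\<^sup>2) integrable_on J k"
        unfolding J_def by (intro integrable_continuous_real continuous_intros)
      show "(\<lambda>t. (\<Sum>p\<in>I. (norm (e p))\<^sup>2) * (\<Sum>p\<in>I. (B p t - B p (real k * \<tau>))\<^sup>2)) integrable_on J k"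
        using int I by (intro integrable_on_mult_right integrable_sum) auto
      fix t
      have "norm (w t - w (real k * \<tau>)) \<le> (\<Sum>p\<in>I. norm (e p) * \<bar>B p t - B p (real k * \<tau>)\<bar>)"
        unfolding wd by (rule sum_norm_le) (simp add: mult.commute)
      then have "(norm (w t - w (real k * \<tau>)))\<^sup>2 \<le> (\<Sum>p\<in>I. norm (e p) * \<bar>B p t - B p (real k * \<tau>)\<bar>)\<^sup>2"
        by (intro power_mono) auto
      also have "\<dots> \<le> (\<Sum>p\<in>I. (norm (e p))\<^sup>2) * (\<Sum>p\<in>I. \<bar>B p t - B p (real k * \<tau>)\<bar>\<^sup>2)"
        by (rule Cauchy_Schwarz_ineq_sum)
      finally show "(norm (w t - w (real k * \<tau>)))\<^sup>2 \<le> (\<Sum>p\<in>I. (norm (e p))\<^sup>2) * (\<Sum>p\<in>I. (B p t - B p (real k * \<tau>))\<^sup>2)"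
        by simp
    qed
    also have "\<dots> = (\<Sum>p\<in>I. (norm (e p))\<^sup>2) * (\<Sum>p\<in>I. q p k)"
      using int I by (simp add: Henstock_Kurzweil_Integration.integral_sum q_def)
    finally show "integral (J k) (\<lambda>t. (norm (w t - w (real k * \<tau>)))\<^sup>2) \<le> (\<Sum>p\<in>I. (norm (e p))\<^sup>2) * (\<Sum>p\<in>I. q p k)" .
  qed
  also have "\<dots> = (\<Sum>p\<in>I. (norm (e p))\<^sup>2) * (\<Sum>p\<in>I. \<Sum>k<N. q p k)"
    by (subst sum.swap) (simp add: sum_distrib_left)
  also have "\<dots> \<le> (\<Sum>p\<in>I. (norm (e p))\<^sup>2) * (\<Sum>p\<in>I. A * \<tau>)"
    using quad by (intro mult_left_mono sum_mono sum_nonneg) (auto simp: q_def J_def)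
  finally show "(\<Sum>k<N. integral {real k * \<tau>..real (Suc k) * \<tau>} (\<lambda>t. (norm (w t - w (real k * \<tau>)))\<^sup>2))
      \<le> ((\<Sum>p\<in>I. (norm (e p))\<^sup>2) * (real (card I) * A)) * \<tau>"
    by (simp add: J_def)
qed

text \<open>Rational times make the event measurable. The events decrease in n, and continuous
  paths, being bounded on compact intervals, avoid their intersection, so one of them is small.
  Density and continuity then return the bound for all times.\<close>

lemma (in prob_space) path_sup_bounded:
  fixes X :: "real \<Rightarrow> 'a \<Rightarrow> 'b::euclidean_space"
  assumes X: "\<And>t. 0 \<le> t \<Longrightarrow> X t \<in> borel_measurable M"
    and cont: "AE \<omega> in M. continuous_on {0..} (\<lambda>t. X t \<omega>)" and T: "0 < T" and e: "0 < e"
  shows "\<exists>R::real. \<exists>Bad\<in>sets M. measure M Bad \<le> e \<and>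
    (\<forall>\<omega>\<in>space M - Bad. continuous_on {0..} (\<lambda>t. X t \<omega>) \<longrightarrow> (\<forall>t\<in>{0..T}. norm (X t \<omega>) \<le> R))"
proof -
  define q where "q = {0<..<T} \<inter> \<rat>"
  have clos: "closure q = {0..T}"
    unfolding q_def using T by (subst closure_open_Int_superset) (auto simp: Rats_closure_real)
  define bad where "bad n = (\<Union>t\<in>q. {\<omega> \<in> space M. real n < norm (X t \<omega>)})" for n :: nat
  have "countable q" unfolding q_def by (simp add: countable_rat)
  moreover have Xq: "X t \<in> borel_measurable M" if "t \<in> q" for t
    using that by (intro X) (auto simp: q_def)
  ultimately have bad_sets: "bad n \<in> sets M" for n
    unfolding bad_def by (intro sets.countable_UN') (auto intro!: borel_measurable_less borel_measurable_norm)
  have "AE \<omega> in M. \<omega> \<notin> (\<Inter>n. bad n)"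
    using cont
  proof (rule AE_mp, intro AE_I2 impI)
    fix \<omega> assume "continuous_on {0..} (\<lambda>t. X t \<omega>)"
    then have "compact ((\<lambda>t. X t \<omega>) ` {0..T})"
      by (intro compact_continuous_image continuous_on_subset[of "{0..}" _ "{0..T}"]) auto
    then obtain B where B: "\<And>t. t \<in> {0..T} \<Longrightarrow> norm (X t \<omega>) \<le> B"
      using compact_imp_bounded[THEN bounded_iff[THEN iffD1]] by (metis imageI)
    obtain n :: nat where "B < real n" using reals_Archimedean2 by blast
    then have "norm (X t \<omega>) \<le> real n" if "t \<in> q" for t
      using B[of t] that by (force simp: q_def)
    then have "\<omega> \<notin> bad n" by (auto simp: bad_def not_less)
    then show "\<omega> \<notin> (\<Inter>n. bad n)" by blast
  qed
  then have null: "measure M (\<Inter>n. bad n) = 0"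
    using bad_sets by (subst (asm) AE_iff_measurable[where N="\<Inter>n. bad n"]) (auto simp: measure_def bad_def)
  have "(\<lambda>n. measure M (bad n)) \<longlonglongrightarrow> measure M (\<Inter>n. bad n)"
    using bad_sets by (intro finite_Lim_measure_decseq) (auto simp: decseq_def bad_def)
  then have "eventually (\<lambda>n. measure M (bad n) < e) sequentially"
    unfolding null using e by (rule order_tendstoD)
  then obtain n where n: "measure M (bad n) < e" by (auto simp: eventually_sequentially)
  show ?thesis
  proof (intro exI[of _ "real n"] bexI[of _ "bad n"] conjI ballI impI bad_sets)
    fix \<omega> t assume \<omega>: "\<omega> \<in> space M - bad n" and c: "continuous_on {0..} (\<lambda>t. X t \<omega>)" and t: "t \<in> {0..T}"
    show "norm (X t \<omega>) \<le> real n"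
    proof (rule continuous_on_closure_norm_le[where s=q])
      show "continuous_on (closure q) (\<lambda>t. X t \<omega>)"
        unfolding clos by (rule continuous_on_subset[OF c]) auto
      show "\<forall>t\<in>q. norm (X t \<omega>) \<le> real n" using \<omega> by (auto simp: bad_def not_less)
      show "t \<in> closure q" using t clos by simp
    qed
  qed (use n in simp)
qed

text \<open>\<open>K\<close> is chosen before the step size and the path. The noise is given by its
  scalar expansion, so that the hypotheses on sums are what \<open>weighted_sums_small\<close>
  delivers.\<close>

lemma (in damped_scheme) path_error_bound:
  fixes e :: "'i \<Rightarrow> complex^'j::{finite,linorder}" and T R A \<tau>\<^sub>m :: real
  assumes I: "finite I" and T: "0 < T" and A: "0 \<le> A" and R: "0 \<le> R" and \<tau>\<^sub>m: "0 < \<tau>\<^sub>m"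
  obtains K where "\<And>\<tau> (x :: real \<Rightarrow> complex^'j::{finite,linorder}) B w y n.
    \<tau> \<in> {0<..\<tau>\<^sub>m} \<Longrightarrow> continuous_on {0..} x \<Longrightarrow> \<forall>p\<in>I. continuous_on {0..} (B p) \<Longrightarrow>
    w = (\<lambda>t. \<Sum>p\<in>I. B p t *\<^sub>R e p) \<Longrightarrow>
    \<forall>t\<ge>0. x t = x 0 + integral {0..t} (\<lambda>r. drift h \<alpha> lam (x r)) + w t \<Longrightarrow>
    \<forall>t\<in>{0..T}. norm (x t) \<le> R \<Longrightarrow> \<forall>t\<in>{0..T}. norm (w t) \<le> R \<Longrightarrow>
    y 0 = x 0 \<Longrightarrow>
    \<forall>n. y (Suc n) = S \<tau> (E \<tau> (y n)) + V \<tau> (w (real (Suc n) * \<tau>) - w (real n * \<tau>)) \<Longrightarrow>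
    \<forall>p\<in>I. \<forall>u\<in>Basis. \<forall>n\<le>nat \<lfloor>T / \<tau>\<rfloor>.
      \<bar>\<Sum>k<n. (D (x (real k * \<tau>)) (e p) \<bullet> u) * integral {real k * \<tau>..real (Suc k) * \<tau>} (\<lambda>s. B p s - B p (real k * \<tau>))\<bar> \<le> A * \<tau> \<Longrightarrow>
    \<forall>p\<in>I. (\<Sum>k<nat \<lfloor>T / \<tau>\<rfloor>. integral {real k * \<tau>..real (Suc k) * \<tau>} (\<lambda>s. (B p s - B p (real k * \<tau>))\<^sup>2)) \<le> A * \<tau> \<Longrightarrow>
    n \<le> nat \<lfloor>T / \<tau>\<rfloor> \<Longrightarrow> norm (x (real n * \<tau>) - y n) \<le> K * \<tau>"
proof -
  obtain z where z: "0 \<le> z" "\<And>x :: complex^'j::{finite,linorder}. norm (Z *v x) \<le> z * norm x"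
    using Z_bounded by blast
  \<comment> \<open>The radius is R + 1 because the Lipschitz constant of \<open>G\<close> is also
    used at the scheme, which may leave the ball of radius R by 1.\<close>
  define p where "p = \<alpha> / 2 + (R + 1)\<^sup>2 + 2 * (R + 1) * (R + 1)"
  define L where "L = 2 * z * (1 + \<tau>\<^sub>m * p) + p"
  define c1 where "c1 = (\<alpha> / 2 + R\<^sup>2 + 2 * z) * R"
  define c2 where "c2 = \<alpha> / 2 + R\<^sup>2 + 2 * R\<^sup>2 + 2 * z"
  define c3 where "c3 = 3 * R"
  define c4 where "c4 = (2 * z * (\<alpha> / 2 + R\<^sup>2) + 2 * z\<^sup>2 + (\<alpha> / 2 + R\<^sup>2)\<^sup>2) * R"
  define A1 where "A1 = real DIM(complex^'j::{finite,linorder}) * real (card I) * A"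
  define A2 where "A2 = (\<Sum>p\<in>I. (norm (e p))\<^sup>2) * (real (card I) * A)"
  define a where "a = A1 + (c2 * c1 + 2 * c3 * c1\<^sup>2 * \<tau>\<^sub>m + c4) * T + 2 * c3 * A2 + 2 * z * R"
  define K1 where "K1 = a * exp (L * T)"
  have p0: "0 \<le> p" using \<alpha> R by (simp add: p_def)
  have L0: "0 \<le> L" using p0 z \<tau>\<^sub>m by (simp add: L_def)
  have c0: "0 \<le> c1" "0 \<le> c2" "0 \<le> c3" "0 \<le> c4" using \<alpha> R z by (auto simp: c1_def c2_def c3_def c4_def)
  have A0: "0 \<le> A1" "0 \<le> A2" using A by (auto simp: A1_def A2_def sum_nonneg)
  have a0: "0 \<le> a" using A0 c0 T \<tau>\<^sub>m z R by (simp add: a_def)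
  then have K1: "0 \<le> K1" by (simp add: K1_def)
  \<comment> \<open>When the smallness condition fails, K1 * \<tau> \<ge> 1, so there are at most T
    * K1 steps, and the scheme obeys |y m| \<le> 5^m R: a factor 3 from \<open>norm_S\<close> and a
    noise increment of norm at most 2 R. The inequality 1 \<le> K1 * \<tau> then supplies the factor
    \<tau> of the claim.\<close>
  define M where "M = nat \<lceil>T * K1\<rceil>"
  define K2 where "K2 = 2 * R * 5 ^ M * K1"
  have K2: "0 \<le> K2" using R K1 by (simp add: K2_def)
  show thesis
  proof (rule that[of "K1 + K2"])
    fix \<tau> :: real and x w :: "real \<Rightarrow> complex^'j::{finite,linorder}" and B :: "'i \<Rightarrow> real \<Rightarrow> real"
      and y :: "nat \<Rightarrow> complex^'j::{finite,linorder}" and n :: nat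
    assume \<tau>: "\<tau> \<in> {0<..\<tau>\<^sub>m}" and xc: "continuous_on {0..} x" and Bc: "\<forall>p\<in>I. continuous_on {0..} (B p)"
      and w: "w = (\<lambda>t. \<Sum>p\<in>I. B p t *\<^sub>R e p)"
      and eq: "\<forall>t\<ge>0. x t = x 0 + integral {0..t} (\<lambda>r. drift h \<alpha> lam (x r)) + w t"
      and xR: "\<forall>t\<in>{0..T}. norm (x t) \<le> R" and wR: "\<forall>t\<in>{0..T}. norm (w t) \<le> R" and y0: "y 0 = x 0"
      and y: "\<forall>n. y (Suc n) = S \<tau> (E \<tau> (y n)) + V \<tau> (w (real (Suc n) * \<tau>) - w (real n * \<tau>))"
      and lin: "\<forall>p\<in>I. \<forall>u\<in>Basis. \<forall>n\<le>nat \<lfloor>T / \<tau>\<rfloor>.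
        \<bar>\<Sum>k<n. (D (x (real k * \<tau>)) (e p) \<bullet> u) * integral {real k * \<tau>..real (Suc k) * \<tau>} (\<lambda>s. B p s - B p (real k * \<tau>))\<bar> \<le> A * \<tau>"
      and quad: "\<forall>p\<in>I. (\<Sum>k<nat \<lfloor>T / \<tau>\<rfloor>. integral {real k * \<tau>..real (Suc k) * \<tau>} (\<lambda>s. (B p s - B p (real k * \<tau>))\<^sup>2)) \<le> A * \<tau>"
      and n: "n \<le> nat \<lfloor>T / \<tau>\<rfloor>"
    define N where "N = nat \<lfloor>T / \<tau>\<rfloor>"
    have \<tau>0: "0 < \<tau>" "\<tau> \<le> \<tau>\<^sub>m" using \<tau> by auto
    have "0 \<le> T / \<tau>" using T \<tau>0 by simp
    then have NT': "real N \<le> T / \<tau>" by (simp add: N_def)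
    then have NT: "real N * \<tau> \<le> T" using \<tau>0 by (simp add: field_simps)
    have tT: "real k * \<tau> \<in> {0..T}" if "k \<le> N" for k
      using order_trans[OF mult_right_mono[of "real k" "real N" \<tau>] NT] that \<tau>0 by auto
    show "norm (x (real n * \<tau>) - y n) \<le> (K1 + K2) * \<tau>"
    proof (cases "a * \<tau> * exp (L * T) \<le> 1")
      case True
      have wc: "continuous_on {0..} w" unfolding w using Bc by (intro continuous_intros) auto
      have "norm (x (real n * \<tau>) - y n) \<le> a * \<tau> * exp (L * T)"
      proof (rule pathwise_error_bound[where g="drift h \<alpha> lam" and G="G \<tau>" and V="V \<tau>" and D=D and N=N and w=w
            and \<tau>\<^sub>m=\<tau>\<^sub>m and R=R and c\<^sub>1=c1 and c\<^sub>2=c2 and c\<^sub>3=c3 and c\<^sub>4=c4 and c\<^sub>5=z and A\<^sub>1=A1 and A\<^sub>2=A2 and L=L])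
        show "\<And>v :: complex^'j::{finite,linorder}. norm v \<le> R \<Longrightarrow> norm (drift h \<alpha> lam v) \<le> c1"
          unfolding c1_def by (rule norm_drift[OF z])
        show "\<And>v d :: complex^'j::{finite,linorder}. norm v \<le> R \<Longrightarrow> norm (D v d) \<le> c2 * norm d"
          unfolding c2_def by (rule norm_D[OF z])
        show "\<And>v d :: complex^'j::{finite,linorder}. norm v \<le> R \<Longrightarrow> norm (v + d) \<le> R \<Longrightarrow>
            norm (drift h \<alpha> lam (v + d) - drift h \<alpha> lam v - D v d) \<le> c3 * (norm d)\<^sup>2"
          unfolding c3_def by (rule drift_taylor)
        show "\<And>v :: complex^'j::{finite,linorder}. norm v \<le> R \<Longrightarrow> norm (G \<tau> v - drift h \<alpha> lam v) \<le> c4 * \<tau>"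
          unfolding c4_def using G_consistent[OF z \<tau>0(1)] by blast
        show "\<And>v :: complex^'j::{finite,linorder}. norm (V \<tau> v - v) \<le> z * \<tau> * norm v"
          using V_minus_id[OF z] \<tau>0 by simp
        show "\<And>v u :: complex^'j::{finite,linorder}. norm v \<le> R + 1 \<Longrightarrow> norm u \<le> R + 1 \<Longrightarrow> norm (G \<tau> v - G \<tau> u) \<le> L * norm (v - u)"
          unfolding L_def by (rule G_lipschitz[OF z \<tau>0 _ _ p_def])
        show "y (Suc m) = y m + \<tau> *\<^sub>R G \<tau> (y m) + V \<tau> (w (real (Suc m) * \<tau>) - w (real m * \<tau>))" for m
          using y \<tau>0 by (simp add: G_def)
        show "norm (\<Sum>k<m. D (x (real k * \<tau>)) (integral {real k * \<tau>..real (Suc k) * \<tau>} (\<lambda>t. w t - w (real k * \<tau>)))) \<le> A1 * \<tau>"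
          if "m \<le> N" for m
          unfolding A1_def using that
          by (intro noise_sums(1)[OF I \<tau>0(1) _ bounded_linear_D _ _ w, where N=N])
             (use Bc lin quad in \<open>auto simp: N_def\<close>)
        show "(\<Sum>k<N. integral {real k * \<tau>..real (Suc k) * \<tau>} (\<lambda>t. (norm (w t - w (real k * \<tau>)))\<^sup>2)) \<le> A2 * \<tau>"
          unfolding A2_def
          by (rule noise_sums(2)[where D="\<lambda>k. D (x (real k * \<tau>))", OF I \<tau>0(1) _ bounded_linear_D _ _ w])
             (use Bc lin quad in \<open>auto simp: N_def\<close>)
        show "x t = x 0 + integral {0..t} (\<lambda>r. drift h \<alpha> lam (x r)) + w t" if "0 \<le> t" for t
          using eq that by blast
      qed (use \<tau>0 NT xc wc continuous_drift xR wR bounded_linear_D linear_V c0 z L0 y0 a_def True n N_def in auto)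
      also have "\<dots> = K1 * \<tau>" by (simp add: K1_def)
      also have "\<dots> \<le> (K1 + K2) * \<tau>" using K2 \<tau>0 by (simp add: mult_right_mono)
      finally show ?thesis .
    next
      case False
      then have K1\<tau>: "1 \<le> K1 * \<tau>" by (simp add: K1_def mult_ac)
      have "T / \<tau> \<le> T * K1"
      proof -
        have "T * 1 \<le> T * (K1 * \<tau>)" using K1\<tau> T by (intro mult_left_mono) auto
        then show ?thesis using \<tau>0 by (simp add: field_simps)
      qed
      then have "real N \<le> real M" using NT' unfolding M_def by linarith
      then have nM: "n \<le> M" using n by (simp add: N_def)
      have "norm (y m) \<le> 5 ^ m * R" if "m \<le> N" for m
        using that
      proof (induction m)
        case 0
        then show ?case using xR T by (simp add: y0)
      next
        case (Suc m)
        have "norm (y (Suc m)) \<le> norm (S \<tau> (E \<tau> (y m))) + norm (V \<tau> (w (real (Suc m) * \<tau>) - w (real m * \<tau>)))"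
          using y norm_triangle_ineq by metis
        also have "\<dots> \<le> 3 * norm (y m) + norm (w (real (Suc m) * \<tau>) - w (real m * \<tau>))"
          using norm_S[of \<tau> "E \<tau> (y m)"] norm_E[of \<tau> "y m"] norm_V[of \<tau>] \<tau>0 by (intro add_mono) auto
        also have "\<dots> \<le> 3 * (5 ^ m * R) + (R + R)"
          using Suc wR tT[of m] tT[OF Suc.prems]
          by (intro add_mono mult_left_mono order_trans[OF norm_triangle_ineq4]) auto
        also have "\<dots> \<le> 3 * (5 ^ m * R) + 2 * (5 ^ m * R)"
          using mult_right_mono[of 1 "5 ^ m" R] R by (simp add: mult.commute)
        finally show ?case by (simp add: mult_ac)
      qed
      from this[of n] have "norm (x (real n * \<tau>) - y n) \<le> R + 5 ^ n * R"
        using xR tT[of n] n norm_triangle_ineq4[of "x (real n * \<tau>)" "y n"] by (fastforce simp: N_def)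
      also have "\<dots> \<le> 5 ^ M * R + 5 ^ M * R"
        using R nM mult_right_mono[of 1 "5 ^ M" R] by (intro add_mono mult_right_mono power_increasing) auto
      also have "\<dots> \<le> (2 * R * 5 ^ M) * (K1 * \<tau>)"
        using R K1\<tau> mult_left_mono[of 1 "K1 * \<tau>" "2 * R * 5 ^ M"] by simp
      also have "\<dots> = K2 * \<tau>" by (simp add: K2_def)
      also have "\<dots> \<le> (K1 + K2) * \<tau>" using K1 \<tau>0 by (simp add: mult_right_mono)
      finally show ?thesis .
    qed
  qed
qed

section \<open>Convergence in probability\<close>

text \<open>Over the reals each complex component offers two directions, \<open>axis k 1\<close> and
  \<open>axis k \<i>\<close>.\<close>

lemma noise_decomposition:
  fixes b :: "'p::{finite,linorder} \<Rightarrow> nat \<Rightarrow> real \<Rightarrow> 'w \<Rightarrow> real" and W :: "complex^'p::{finite,linorder}^'j"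
  shows "\<epsilon> *\<^sub>R (W *v complex_noise b t \<omega>) =
    (\<Sum>p\<in>UNIV \<times> {1, 2}. b (fst p) (snd p) t \<omega> *\<^sub>R (\<epsilon> *\<^sub>R (W *v axis (fst p) (if snd p = 1 then 1 else \<i>))))"
proof -
  have "complex_noise b t \<omega> = (\<Sum>k\<in>UNIV. b k 1 t \<omega> *\<^sub>R axis k 1 + b k 2 t \<omega> *\<^sub>R axis k \<i>)"
    by (simp add: complex_noise_def vec_eq_iff axis_def sum.distrib if_distrib complex_eq_iff cong: if_cong)
  also have "\<dots> = (\<Sum>p\<in>UNIV \<times> {1, 2}. b (fst p) (snd p) t \<omega> *\<^sub>R axis (fst p) (if snd p = 1 then 1 else \<i>))"
    by (subst sum.cartesian_product') simp
  finally show ?thesis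
    by (simp add: linear_sum[OF linear_matrix_vec] linear_cmul[OF linear_matrix_vec] scaleR_sum_right mult.commute)
qed

text \<open>The radius, the bound on the weights and \<open>K\<close> are fixed from \<delta> before
  \<tau>. One quarter of \<delta> is spent on the solution leaving the ball, one quarter on the
  noise leaving it, and one half on the noise sums; only the last event depends on \<tau>.\<close>

lemma uniform_error_bound:
  fixes M :: "'w measure" and \<F> :: "real \<Rightarrow> 'w measure"
    and b :: "'p::{finite,linorder} \<Rightarrow> nat \<Rightarrow> real \<Rightarrow> 'w \<Rightarrow> real"
    and \<Psi> :: "real \<Rightarrow> 'w \<Rightarrow> complex^'j::{finite,linorder}"
  assumes prob: "prob_space M" and filt: "filtration (space M) \<F>" and subalg: "\<And>t. subalgebra M (\<F> t)"
    and bm: "\<And>k i. i \<in> {1, 2} \<Longrightarrow> brownian_motion M \<F> (b k i)"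
    and \<alpha>: "0 \<le> \<alpha>" and lam: "\<bar>lam\<bar> = 1"
    and sol: "semidiscrete_solution M \<F> h \<alpha> lam \<epsilon> \<eta> (complex_noise b) \<psi>\<^sub>0 \<Psi>"
    and T: "0 < T" and \<tau>\<^sub>m: "0 < \<tau>\<^sub>m" and \<delta>: "0 < \<delta>"
  shows "\<exists>K. \<forall>\<tau>\<in>{0<..\<tau>\<^sub>m}. \<exists>Bad\<in>sets M. measure M Bad \<le> \<delta> \<and> (\<forall>\<omega>\<in>space M - Bad. \<forall>n\<le>nat \<lfloor>T / \<tau>\<rfloor>.
    norm (\<Psi> (real n * \<tau>) \<omega> - scheme h \<tau> \<alpha> lam \<epsilon> \<eta> (complex_noise b) (\<Psi> 0) n \<omega>) \<le> K * \<tau>)"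
proof -
  interpret prob_space M by (rule prob)
  interpret damped_scheme h \<alpha> lam by unfold_locales (use \<alpha> lam in auto)
  define W :: "complex^'p::{finite,linorder}^'j::{finite,linorder}" where "W = sigma_mat h ** Lambda_mat \<eta>"
  define w where "w t \<omega> = \<epsilon> *\<^sub>R (W *v complex_noise b t \<omega>)" for t \<omega>
  define I :: "('p \<times> nat) set" where "I = UNIV \<times> {1, 2}"
  define bb where "bb p = b (fst p) (snd p)" for p
  define e where "e p = \<epsilon> *\<^sub>R (W *v axis (fst p) (if snd p = (1::nat) then 1 else \<i>))" for p
  have I: "finite I" "I \<noteq> {}" by (auto simp: I_def)
  have w_eq: "w t \<omega> = (\<Sum>p\<in>I. bb p t \<omega> *\<^sub>R e p)" for t \<omega>
    unfolding w_def I_def bb_def e_def by (rule noise_decomposition)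
  have bbm: "brownian_motion M \<F> (bb p)" if "p \<in> I" for p
    using bm that by (auto simp: bb_def I_def)
  have abm: "adapted_brownian_motion M \<F> (bb p)" if "p \<in> I" for p
    by (intro adapted_brownian_motion.intro adapted_brownian_motion_axioms.intro prob filt subalg bbm that)
  have bb_meas: "bb p t \<in> borel_measurable M" if "p \<in> I" "0 \<le> t" for p t
  proof (rule adapted_brownian_motion.measurable_M[OF abm[OF that(1)]])
    show "bb p t \<in> borel_measurable (\<F> t)"
      using bbm[OF that(1)] that(2) unfolding brownian_motion_def by simp
  qed
  have \<Psi>_meas: "\<Psi> t \<in> borel_measurable (\<F> t)" if "0 \<le> t" for t
    using sol that unfolding semidiscrete_solution_def by simp
  define path where "path \<omega> \<longleftrightarrow> (\<forall>p\<in>I. continuous_on {0..} (\<lambda>t. bb p t \<omega>)) \<and> continuous_on {0..} (\<lambda>t. \<Psi> t \<omega>) \<and>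
    (\<forall>t\<ge>0. \<Psi> t \<omega> = \<Psi> 0 \<omega> + integral {0..t} (\<lambda>s. drift h \<alpha> lam (\<Psi> s \<omega>)) + w t \<omega>)" for \<omega>
  have bb_cont: "AE \<omega> in M. \<forall>p\<in>I. continuous_on {0..} (\<lambda>t. bb p t \<omega>)"
    using bbm by (intro AE_finite_allI I) (simp add: brownian_motion_def)
  have \<Psi>_cont: "AE \<omega> in M. continuous_on {0..} (\<lambda>t. \<Psi> t \<omega>)"
    and \<Psi>_eq: "AE \<omega> in M. \<forall>t\<ge>0. \<Psi> t \<omega> = \<Psi> 0 \<omega> + integral {0..t} (\<lambda>s. drift h \<alpha> lam (\<Psi> s \<omega>)) + w t \<omega>"
    using sol unfolding semidiscrete_solution_def w_def W_def by simp_all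
  have w_cont: "continuous_on {0..} (\<lambda>t. w t \<omega>)" if "\<forall>p\<in>I. continuous_on {0..} (\<lambda>t. bb p t \<omega>)" for \<omega>
    unfolding w_eq using that by (intro continuous_intros) auto
  have "AE \<omega> in M. path \<omega>"
    using bb_cont \<Psi>_cont \<Psi>_eq unfolding path_def by eventually_elim blast
  \<comment> \<open>The exceptional paths need not form a measurable set, so they are covered by a
    measurable null set.\<close>
  then obtain Null where Null: "{\<omega> \<in> space M. \<not> path \<omega>} \<subseteq> Null" "emeasure M Null = 0" "Null \<in> sets M"
    by (rule AE_E)
  have "\<exists>R. \<exists>Bad\<in>sets M. measure M Bad \<le> \<delta> / 4 \<and>
    (\<forall>\<omega>\<in>space M - Bad. continuous_on {0..} (\<lambda>t. \<Psi> t \<omega>) \<longrightarrow> (\<forall>t\<in>{0..T}. norm (\<Psi> t \<omega>) \<le> R))"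
    using \<delta> \<Psi>_meas measurable_from_subalg[OF subalg] by (intro path_sup_bounded \<Psi>_cont T) auto
  then obtain R1 Bad1 where Bad1: "Bad1 \<in> sets M" "measure M Bad1 \<le> \<delta> / 4"
    "\<And>\<omega> t. \<omega> \<in> space M - Bad1 \<Longrightarrow> continuous_on {0..} (\<lambda>t. \<Psi> t \<omega>) \<Longrightarrow> t \<in> {0..T} \<Longrightarrow> norm (\<Psi> t \<omega>) \<le> R1"
    by blast
  have "\<exists>R. \<exists>Bad\<in>sets M. measure M Bad \<le> \<delta> / 4 \<and>
    (\<forall>\<omega>\<in>space M - Bad. continuous_on {0..} (\<lambda>t. w t \<omega>) \<longrightarrow> (\<forall>t\<in>{0..T}. norm (w t \<omega>) \<le> R))"
  proof (rule path_sup_bounded)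
    show "w t \<in> borel_measurable M" if "0 \<le> t" for t
      unfolding w_eq[abs_def] using bb_meas[OF _ that] by (intro borel_measurable_sum borel_measurable_scaleR) auto
    show "AE \<omega> in M. continuous_on {0..} (\<lambda>t. w t \<omega>)"
      using bb_cont by eventually_elim (rule w_cont)
  qed (use T \<delta> in auto)
  then obtain R2 Bad2 where Bad2: "Bad2 \<in> sets M" "measure M Bad2 \<le> \<delta> / 4"
    "\<And>\<omega> t. \<omega> \<in> space M - Bad2 \<Longrightarrow> continuous_on {0..} (\<lambda>t. w t \<omega>) \<Longrightarrow> t \<in> {0..T} \<Longrightarrow> norm (w t \<omega>) \<le> R2"
    by blast
  define R where "R = max 0 (max R1 R2)"
  obtain z where z: "0 \<le> z" "\<And>x :: complex^'j::{finite,linorder}. norm (Z *v x) \<le> z * norm x"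
    using Z_bounded by blast
  define c where "c = \<alpha> / 2 + R\<^sup>2 + 2 * R\<^sup>2 + 2 * z"
  have c: "0 \<le> c" using \<alpha> z by (simp add: c_def)
  \<comment> \<open>The summand 1 makes the bound strictly positive, as
    \<open>weighted_sums_small\<close> requires.\<close>
  define Bw where "Bw = c * (\<Sum>p\<in>I. norm (e p)) + 1"
  have Bw: "0 < Bw" using c by (simp add: Bw_def add_nonneg_pos sum_nonneg)
  \<comment> \<open>The number of pairs of a noise direction and a coordinate; each of them receives
    the share \<delta> / (2 * m).\<close>
  define m where "m = real (card I) * real DIM(complex^'j::{finite,linorder})"
  have m: "0 < m" using I by (simp add: m_def card_gt_0_iff del: DIM_cart)
  have \<delta>m: "0 < \<delta> / (2 * m)" using \<delta> m by simp
  define g where "g \<tau> p u k \<omega> = (if norm (\<Psi> (real k * \<tau>) \<omega>) \<le> R then D (\<Psi> (real k * \<tau>) \<omega>) (e p) \<bullet> u else 0)"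
    for \<tau> p u k \<omega>
  have g_meas: "g \<tau> p u k \<in> borel_measurable (\<F> (real k * \<tau>))" if "0 < \<tau>" for \<tau> p u k
  proof -
    have [measurable]: "\<Psi> (real k * \<tau>) \<in> borel_measurable (\<F> (real k * \<tau>))"
      using that by (intro \<Psi>_meas) auto
    have [measurable]: "(\<lambda>v. D v (e p)) \<in> borel_measurable borel"
      using continuous_D by (rule borel_measurable_continuous_onI)
    show ?thesis unfolding g_def[abs_def] by measurable
  qed
  have g_bound: "\<bar>g \<tau> p u k \<omega>\<bar> \<le> Bw" if "p \<in> I" "u \<in> Basis" for \<tau> p u k \<omega>
  proof (cases "norm (\<Psi> (real k * \<tau>) \<omega>) \<le> R")
    case True
    have "\<bar>D (\<Psi> (real k * \<tau>) \<omega>) (e p) \<bullet> u\<bar> \<le> norm (D (\<Psi> (real k * \<tau>) \<omega>) (e p))"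
      using Basis_le_norm[OF that(2)] by simp
    also have "\<dots> \<le> c * norm (e p)"
      unfolding c_def by (rule norm_D[OF z True])
    also have "\<dots> \<le> c * (\<Sum>p\<in>I. norm (e p))"
      using that I c by (intro mult_left_mono member_le_sum) auto
    finally show ?thesis using True by (simp add: g_def Bw_def)
  qed (use Bw in \<open>simp add: g_def\<close>)
  define P where "P p A \<longleftrightarrow> (\<forall>\<tau>>0. \<forall>G. (\<forall>k. G k \<in> borel_measurable (\<F> (real k * \<tau>)) \<and> (\<forall>\<omega>. \<bar>G k \<omega>\<bar> \<le> Bw)) \<longrightarrow>
    (\<exists>Bad\<in>sets M. measure M Bad \<le> \<delta> / (2 * m) \<and>
      (\<forall>\<omega>\<in>space M - Bad. continuous_on {0..} (\<lambda>t. bb p t \<omega>) \<longrightarrow>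
        (\<forall>n\<le>nat \<lfloor>T / \<tau>\<rfloor>. \<bar>\<Sum>k<n. G k \<omega> * integral {real k * \<tau>..real (Suc k) * \<tau>} (\<lambda>s. bb p s \<omega> - bb p (real k * \<tau>) \<omega>)\<bar> \<le> A * \<tau>) \<and>
        (\<Sum>k<nat \<lfloor>T / \<tau>\<rfloor>. integral {real k * \<tau>..real (Suc k) * \<tau>} (\<lambda>s. (bb p s \<omega> - bb p (real k * \<tau>) \<omega>)\<^sup>2)) \<le> A * \<tau>)))"
    for p A
  have "\<exists>A>0. P p A" if "p \<in> I" for p
    unfolding P_def by (rule adapted_brownian_motion.weighted_sums_small[OF abm[OF that] T \<delta>m Bw])
  then obtain Af where Af: "\<And>p. p \<in> I \<Longrightarrow> 0 < Af p" "\<And>p. p \<in> I \<Longrightarrow> P p (Af p)"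
    by metis
  define A where "A = (\<Sum>p\<in>I. Af p)"
  have A: "0 \<le> A" "\<And>p. p \<in> I \<Longrightarrow> Af p \<le> A"
    using Af(1) I by (auto simp: A_def less_imp_le intro!: sum_nonneg member_le_sum)
  have R0: "0 \<le> R" by (simp add: R_def)
  show ?thesis
  proof (rule path_error_bound[OF I(1) T A(1) R0 \<tau>\<^sub>m, of e], rule exI, rule ballI, goal_cases)
    case (1 K \<tau>)
    note K = 1(1) and \<tau> = 1(2)
    define N where "N = nat \<lfloor>T / \<tau>\<rfloor>"
    have \<tau>0: "0 < \<tau>" using \<tau> by auto
    have "0 \<le> T / \<tau>" using T \<tau>0 by simp
    then have "real N \<le> T / \<tau>" by (simp add: N_def)
    then have NT: "real N * \<tau> \<le> T" using \<tau>0 by (simp add: field_simps)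
    have tT: "real k * \<tau> \<in> {0..T}" if "k \<le> N" for k
      using order_trans[OF mult_right_mono[of "real k" "real N" \<tau>] NT] that \<tau>0 by auto
    define Q where "Q p u Bad \<longleftrightarrow> Bad \<in> sets M \<and> measure M Bad \<le> \<delta> / (2 * m) \<and>
      (\<forall>\<omega>\<in>space M - Bad. continuous_on {0..} (\<lambda>t. bb p t \<omega>) \<longrightarrow>
        (\<forall>n\<le>N. \<bar>\<Sum>k<n. g \<tau> p u k \<omega> * integral {real k * \<tau>..real (Suc k) * \<tau>} (\<lambda>s. bb p s \<omega> - bb p (real k * \<tau>) \<omega>)\<bar> \<le> Af p * \<tau>) \<and>
        (\<Sum>k<N. integral {real k * \<tau>..real (Suc k) * \<tau>} (\<lambda>s. (bb p s \<omega> - bb p (real k * \<tau>) \<omega>)\<^sup>2)) \<le> Af p * \<tau>)" for p u Bad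
    have "\<forall>x\<in>I \<times> Basis. \<exists>Bad. Q (fst x) (snd x) Bad"
    proof
      fix x assume x: "x \<in> I \<times> (Basis :: (complex^'j::{finite,linorder}) set)"
      then have p: "fst x \<in> I" and u: "snd x \<in> Basis" by auto
      have "\<forall>k. g \<tau> (fst x) (snd x) k \<in> borel_measurable (\<F> (real k * \<tau>)) \<and> (\<forall>\<omega>. \<bar>g \<tau> (fst x) (snd x) k \<omega>\<bar> \<le> Bw)"
        using g_meas[OF \<tau>0] g_bound[OF p u] by blast
      from Af(2)[OF p, unfolded P_def, THEN spec, THEN mp, OF \<tau>0, THEN spec, THEN mp, OF this]
      show "\<exists>Bad. Q (fst x) (snd x) Bad"
        unfolding Q_def N_def by blast
    qed
    from bchoice[OF this] obtain Bf where Bf: "\<And>p u. p \<in> I \<Longrightarrow> u \<in> Basis \<Longrightarrow> Q p u (Bf (p, u))"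
      by auto
    define Bad3 where "Bad3 = (\<Union>x\<in>I \<times> Basis. Bf x)"
    have Bf_sets: "Bf ` (I \<times> Basis) \<subseteq> sets M" using Bf by (auto simp: Q_def)
    then have Bad3_sets: "Bad3 \<in> sets M"
      unfolding Bad3_def using I by (intro sets.finite_UN) auto
    have "measure M Bad3 \<le> (\<Sum>x\<in>I \<times> Basis. measure M (Bf x))"
      unfolding Bad3_def using I Bf_sets by (intro finite_measure_subadditive_finite) auto
    also have "\<dots> \<le> (\<Sum>x\<in>I \<times> (Basis :: (complex^'j::{finite,linorder}) set). \<delta> / (2 * m))"
      using Bf by (intro sum_mono) (auto simp: Q_def)
    also have "\<dots> = m * (\<delta> / (2 * m))" by (simp add: m_def card_cartesian_product del: DIM_cart)
    also have "\<dots> = \<delta> / 2" using m by simp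
    finally have Bad3: "measure M Bad3 \<le> \<delta> / 2" .
    have Null0: "measure M Null = 0" using Null by (simp add: measure_def)
    show "\<exists>Bad\<in>sets M. measure M Bad \<le> \<delta> \<and> (\<forall>\<omega>\<in>space M - Bad. \<forall>n\<le>nat \<lfloor>T / \<tau>\<rfloor>.
      norm (\<Psi> (real n * \<tau>) \<omega> - scheme h \<tau> \<alpha> lam \<epsilon> \<eta> (complex_noise b) (\<Psi> 0) n \<omega>) \<le> K * \<tau>)"
    proof (intro bexI[of _ "Null \<union> Bad1 \<union> (Bad2 \<union> Bad3)"] conjI ballI allI impI)
      show "Null \<union> Bad1 \<union> (Bad2 \<union> Bad3) \<in> sets M" using Null Bad1 Bad2 Bad3_sets by auto
      have "measure M (Null \<union> Bad1 \<union> (Bad2 \<union> Bad3)) \<le> measure M (Null \<union> Bad1) + measure M (Bad2 \<union> Bad3)"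
        using Null Bad1 Bad2 Bad3_sets by (intro measure_Un_le) auto
      also have "\<dots> \<le> (measure M Null + measure M Bad1) + (measure M Bad2 + measure M Bad3)"
        using Null Bad1 Bad2 Bad3_sets by (intro add_mono measure_Un_le) auto
      finally show "measure M (Null \<union> Bad1 \<union> (Bad2 \<union> Bad3)) \<le> \<delta>"
        using Null0 Bad1(2) Bad2(2) Bad3 by simp
      fix \<omega> n assume \<omega>: "\<omega> \<in> space M - (Null \<union> Bad1 \<union> (Bad2 \<union> Bad3))" and n: "n \<le> nat \<lfloor>T / \<tau>\<rfloor>"
      then have "path \<omega>" using Null(1) by blast
      then have bc: "\<forall>p\<in>I. continuous_on {0..} (\<lambda>t. bb p t \<omega>)" and \<Psi>c: "continuous_on {0..} (\<lambda>t. \<Psi> t \<omega>)"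
        and eq: "\<forall>t\<ge>0. \<Psi> t \<omega> = \<Psi> 0 \<omega> + integral {0..t} (\<lambda>s. drift h \<alpha> lam (\<Psi> s \<omega>)) + w t \<omega>"
        unfolding path_def by blast+
      have \<Psi>R: "norm (\<Psi> t \<omega>) \<le> R" if "t \<in> {0..T}" for t
        using Bad1(3)[OF _ \<Psi>c that] \<omega> by (simp add: R_def le_max_iff_disj)
      have wR: "norm (w t \<omega>) \<le> R" if "t \<in> {0..T}" for t
        using Bad2(3)[OF _ w_cont[OF bc] that] \<omega> by (simp add: R_def le_max_iff_disj)
      have bf: "(\<forall>n\<le>N. \<bar>\<Sum>k<n. g \<tau> p u k \<omega> * integral {real k * \<tau>..real (Suc k) * \<tau>} (\<lambda>s. bb p s \<omega> - bb p (real k * \<tau>) \<omega>)\<bar> \<le> Af p * \<tau>) \<and>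
        (\<Sum>k<N. integral {real k * \<tau>..real (Suc k) * \<tau>} (\<lambda>s. (bb p s \<omega> - bb p (real k * \<tau>) \<omega>)\<^sup>2)) \<le> Af p * \<tau>"
        if "p \<in> I" "u \<in> Basis" for p u
      proof -
        have "\<omega> \<in> space M - Bf (p, u)" using \<omega> that by (auto simp: Bad3_def)
        then show ?thesis using Bf[OF that] bc that(1) unfolding Q_def by blast
      qed
      have A\<tau>: "Af p * \<tau> \<le> A * \<tau>" if "p \<in> I" for p
        using A(2)[OF that] \<tau>0 by (intro mult_right_mono) auto
      show "norm (\<Psi> (real n * \<tau>) \<omega> - scheme h \<tau> \<alpha> lam \<epsilon> \<eta> (complex_noise b) (\<Psi> 0) n \<omega>) \<le> K * \<tau>"
      proof (rule K[of \<tau> "\<lambda>t. \<Psi> t \<omega>" "\<lambda>p t. bb p t \<omega>" "\<lambda>t. w t \<omega>"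
            "\<lambda>n. scheme h \<tau> \<alpha> lam \<epsilon> \<eta> (complex_noise b) (\<Psi> 0) n \<omega>" n, OF \<tau> \<Psi>c bc _ eq _ _ _ _ _ _ n])
        show "(\<lambda>t. w t \<omega>) = (\<lambda>t. \<Sum>p\<in>I. bb p t \<omega> *\<^sub>R e p)" by (simp add: w_eq)
        show "\<forall>n. scheme h \<tau> \<alpha> lam \<epsilon> \<eta> (complex_noise b) (\<Psi> 0) (Suc n) \<omega> =
          S \<tau> (E \<tau> (scheme h \<tau> \<alpha> lam \<epsilon> \<eta> (complex_noise b) (\<Psi> 0) n \<omega>)) + V \<tau> (w (real (Suc n) * \<tau>) \<omega> - w (real n * \<tau>) \<omega>)"
          unfolding w_def W_def by (intro allI scheme_Suc \<tau>0)
        show "\<forall>p\<in>I. \<forall>u\<in>Basis. \<forall>n\<le>nat \<lfloor>T / \<tau>\<rfloor>.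
          \<bar>\<Sum>k<n. (D (\<Psi> (real k * \<tau>) \<omega>) (e p) \<bullet> u) * integral {real k * \<tau>..real (Suc k) * \<tau>} (\<lambda>s. bb p s \<omega> - bb p (real k * \<tau>) \<omega>)\<bar> \<le> A * \<tau>"
        proof (intro ballI allI impI)
          fix p u n assume p: "p \<in> I" and u: "u \<in> (Basis :: (complex^'j::{finite,linorder}) set)" and "n \<le> nat \<lfloor>T / \<tau>\<rfloor>"
          then have n: "n \<le> N" by (simp add: N_def)
          have eq': "(\<Sum>k<n. (D (\<Psi> (real k * \<tau>) \<omega>) (e p) \<bullet> u) * integral {real k * \<tau>..real (Suc k) * \<tau>} (\<lambda>s. bb p s \<omega> - bb p (real k * \<tau>) \<omega>))
            = (\<Sum>k<n. g \<tau> p u k \<omega> * integral {real k * \<tau>..real (Suc k) * \<tau>} (\<lambda>s. bb p s \<omega> - bb p (real k * \<tau>) \<omega>))"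
            using n \<Psi>R[OF tT] by (intro sum.cong refl) (simp add: g_def del: of_nat_Suc)
          show "\<bar>\<Sum>k<n. (D (\<Psi> (real k * \<tau>) \<omega>) (e p) \<bullet> u) * integral {real k * \<tau>..real (Suc k) * \<tau>} (\<lambda>s. bb p s \<omega> - bb p (real k * \<tau>) \<omega>)\<bar> \<le> A * \<tau>"
            unfolding eq' by (rule order_trans[OF bf[OF p u, THEN conjunct1, THEN spec, THEN mp, OF n] A\<tau>[OF p]])
        qed
        \<comment> \<open>The quadratic bound does not involve the coordinate; it is read off from
          any one of the events indexed by pairs.\<close>
        obtain u where u: "u \<in> (Basis :: (complex^'j::{finite,linorder}) set)" using nonempty_Basis by blast
        show "\<forall>p\<in>I. (\<Sum>k<nat \<lfloor>T / \<tau>\<rfloor>. integral {real k * \<tau>..real (Suc k) * \<tau>} (\<lambda>s. (bb p s \<omega> - bb p (real k * \<tau>) \<omega>)\<^sup>2)) \<le> A * \<tau>"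
        proof
          fix p assume p: "p \<in> I"
          from bf[OF p u, THEN conjunct2] A\<tau>[OF p]
          show "(\<Sum>k<nat \<lfloor>T / \<tau>\<rfloor>. integral {real k * \<tau>..real (Suc k) * \<tau>} (\<lambda>s. (bb p s \<omega> - bb p (real k * \<tau>) \<omega>)\<^sup>2)) \<le> A * \<tau>"
            unfolding N_def by (rule order_trans)
        qed
      qed (use \<Psi>R wR in auto)
    qed
  qed
qed

theorem theorem4p2:
  fixes M :: "'w measure" and \<F> :: "real \<Rightarrow> 'w measure"
    and b :: "'p::{finite,linorder} \<Rightarrow> nat \<Rightarrow> real \<Rightarrow> 'w \<Rightarrow> real"
    and \<psi>\<^sub>0 :: "'w \<Rightarrow> real \<Rightarrow> complex"
    and Q :: "(real \<Rightarrow> complex) \<Rightarrow> real \<Rightarrow> complex" and \<eta> :: "nat \<Rightarrow> real"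
    and \<Psi> :: "real \<Rightarrow> 'w \<Rightarrow> complex^'j::{finite,linorder}"
    and h \<alpha> lam \<epsilon> T C :: real
  assumes "prob_space M"
    and "filtration (space M) \<F>" and "\<forall>t. subalgebra M (\<F> t)"
    and "independent_brownian_motions M \<F> b"
    and "h = 1 / (real CARD('j) + 1)"
    and "\<epsilon> \<ge> 0" and "lam = 1 \<or> lam = - 1" and "\<alpha> \<ge> 1 / 2"
    and "positive_operator_L2 Q" and "has_eigenvalues Q \<eta>" and "hilbert_schmidt_L2_H2 \<eta>"
    and "(\<lambda>(\<omega>, x). \<psi>\<^sub>0 \<omega> x) \<in> borel_measurable (\<F> 0 \<Otimes>\<^sub>M restrict_space borel {0<..<1})"
    and "(\<integral>\<^sup>+ \<omega>. L2_norm_sq (\<psi>\<^sub>0 \<omega>) \<partial>M) < \<infinity>"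
    and "semidiscrete_solution M \<F> h \<alpha> lam \<epsilon> \<eta> (complex_noise b) \<psi>\<^sub>0 \<Psi>"
    and "T > 0" and "C > 0"
  shows "((\<lambda>K::real. SUP \<tau>\<in>{0<..C * h ^ 4}.
            measure M {\<omega> \<in> space M.
              sup_error h \<tau> T \<Psi> (scheme h \<tau> \<alpha> lam \<epsilon> \<eta> (complex_noise b) (\<Psi> 0)) \<omega>
                \<ge> ennreal (K * \<tau>)})
          \<longlongrightarrow> 0) at_top"
proof -
  interpret prob_space M by (rule assms(1))
  let ?e = "\<lambda>\<tau>. sup_error h \<tau> T \<Psi> (scheme h \<tau> \<alpha> lam \<epsilon> \<eta> (complex_noise b) (\<Psi> 0))"
  have h: "0 < h" "h \<le> 1" using assms(5) by auto
  \<comment> \<open>This bound on the step sizes serves as the cap in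
    \<open>uniform_error_bound\<close> and makes the range of the supremum nonempty.\<close>
  have Ch: "0 < C * h ^ 4" using h assms(16) by simp
  have uniform: "\<exists>K. \<forall>\<tau>\<in>{0<..C * h ^ 4}. \<exists>Bad\<in>sets M. measure M Bad \<le> \<delta> \<and> (\<forall>\<omega>\<in>space M - Bad. \<forall>n\<le>nat \<lfloor>T / \<tau>\<rfloor>.
    norm (\<Psi> (real n * \<tau>) \<omega> - scheme h \<tau> \<alpha> lam \<epsilon> \<eta> (complex_noise b) (\<Psi> 0) n \<omega>) \<le> K * \<tau>)" if "0 < \<delta>" for \<delta>
  proof (rule uniform_error_bound[OF assms(1,2) _ _ _ _ assms(14,15) Ch that])
    show "brownian_motion M \<F> (b k i)" if "i \<in> {1, 2}" for k i
      using assms(4) that unfolding independent_brownian_motions_def by blast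
  qed (use assms(3,7,8) in auto)
  show ?thesis
  proof (rule tendstoI)
    fix r :: real assume r: "0 < r"
    obtain K where K: "\<And>\<tau>. \<tau> \<in> {0<..C * h ^ 4} \<Longrightarrow> \<exists>Bad\<in>sets M. measure M Bad \<le> r / 2 \<and> (\<forall>\<omega>\<in>space M - Bad. \<forall>n\<le>nat \<lfloor>T / \<tau>\<rfloor>.
      norm (\<Psi> (real n * \<tau>) \<omega> - scheme h \<tau> \<alpha> lam \<epsilon> \<eta> (complex_noise b) (\<Psi> 0) n \<omega>) \<le> K * \<tau>)"
      using uniform[OF half_gt_zero[OF r]] by blast
    \<comment> \<open>K' strictly above \<open>max 0 K\<close> places the event inside
      \<open>Bad\<close>. The maximum with 0 matters because \<open>ennreal\<close> sends negative
      numbers to 0.\<close>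
    have "\<forall>\<^sub>F K' in at_top. max 0 K < K'" by (rule eventually_gt_at_top)
    then show "\<forall>\<^sub>F K' in at_top. dist (SUP \<tau>\<in>{0<..C * h ^ 4}. measure M {\<omega> \<in> space M. ?e \<tau> \<omega> \<ge> ennreal (K' * \<tau>)}) 0 < r"
    proof eventually_elim
      case (elim K')
      have le: "measure M {\<omega> \<in> space M. ?e \<tau> \<omega> \<ge> ennreal (K' * \<tau>)} \<le> r / 2" if \<tau>: "\<tau> \<in> {0<..C * h ^ 4}" for \<tau>
      proof -
        obtain Bad where Bad: "Bad \<in> sets M" "measure M Bad \<le> r / 2"
          and err: "\<And>\<omega> n. \<omega> \<in> space M - Bad \<Longrightarrow> n \<le> nat \<lfloor>T / \<tau>\<rfloor> \<Longrightarrow>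
            norm (\<Psi> (real n * \<tau>) \<omega> - scheme h \<tau> \<alpha> lam \<epsilon> \<eta> (complex_noise b) (\<Psi> 0) n \<omega>) \<le> K * \<tau>"
          using K[OF \<tau>] by blast
        have "{\<omega> \<in> space M. ?e \<tau> \<omega> \<ge> ennreal (K' * \<tau>)} \<subseteq> Bad"
        proof (rule subsetI, rule ccontr)
          fix \<omega> assume \<omega>: "\<omega> \<in> {\<omega> \<in> space M. ?e \<tau> \<omega> \<ge> ennreal (K' * \<tau>)}" and "\<omega> \<notin> Bad"
          have "?e \<tau> \<omega> \<le> ennreal (max 0 K * \<tau>)"
            unfolding sup_error_def
          proof (rule SUP_least, rule ennreal_leI)
            fix n assume n: "n \<in> {1..nat \<lfloor>T / \<tau>\<rfloor>}"
            let ?d = "norm (\<Psi> (real n * \<tau>) \<omega> - scheme h \<tau> \<alpha> lam \<epsilon> \<eta> (complex_noise b) (\<Psi> 0) n \<omega>)"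
            have "sqrt h * ?d \<le> 1 * ?d" using h by (intro mult_right_mono) auto
            also have "\<dots> \<le> K * \<tau>" using err[of \<omega> n] \<omega> \<open>\<omega> \<notin> Bad\<close> n by auto
            also have "\<dots> \<le> max 0 K * \<tau>" using \<tau> by (intro mult_right_mono) auto
            finally show "sqrt h * ?d \<le> max 0 K * \<tau>" .
          qed
          also have "\<dots> < ennreal (K' * \<tau>)"
            using elim \<tau> by (intro ennreal_lessI mult_strict_right_mono) (auto simp: zero_less_mult_iff)
          finally show False using \<omega> by auto
        qed
        then have "measure M {\<omega> \<in> space M. ?e \<tau> \<omega> \<ge> ennreal (K' * \<tau>)} \<le> measure M Bad"
          using Bad(1) by (rule finite_measure_mono)
        then show ?thesis using Bad(2) by linarith
      qed
      have "(SUP \<tau>\<in>{0<..C * h ^ 4}. measure M {\<omega> \<in> space M. ?e \<tau> \<omega> \<ge> ennreal (K' * \<tau>)}) \<le> r / 2"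
        using Ch le by (intro cSUP_least) auto
      moreover have "0 \<le> (SUP \<tau>\<in>{0<..C * h ^ 4}. measure M {\<omega> \<in> space M. ?e \<tau> \<omega> \<ge> ennreal (K' * \<tau>)})"
        using Ch le by (intro cSUP_upper2[where x="C * h ^ 4"] bdd_aboveI2[where M="r / 2"]) auto
      ultimately show ?case using r by (simp add: dist_real_def)
    qed
  qed
qed

end
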